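(* Let $X$ be a $0$-dimensional irreducible but nonreduced proper scheme over a field $k$, and let $L$ be a graded linear series on $X$ with $\kappa(L)=0$. Then there exists a positive integer $r$ such that $$\lim_{n\rightarrow\infty}\dim_kL_{a+nr}$$ exists for every positive integer $a$.
   Context: A graded linear series $L=\bigoplus_{n\ge 0}L_n$ on a proper $k$-scheme $X$ is a graded $k$-subalgebra of the section ring $\bigoplus_{n\ge 0}\Gamma(X,\mathcal L^n)$ of some line bundle $\mathcal L$ on $X$. Let $\sigma(L)$ be the maximal $m$ such that there exist $y_1,\ldots,y_m\in L$ which are homogeneous of positive degree and algebraically independent over $k$. The Kodaira-Iitaka dimension is $\kappa(L)=\sigma(L)-1$ if $\sigma(L)>0$, and $\kappa(L)=-\infty$ if $\sigma(L)=0$. *)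

theory Defs
  imports
    "HOL-Analysis.Abstract_Topology"
    "HOL-Library.Extended_Real"
    "HOL-Algebra.Embedded_Algebras"
    "HOL-Algebra.Generated_Rings"
    "HOL-Algebra.QuotRing"
    "HOL-Algebra.Module"
begin

section \<open>Presheaves of rings, stalks, sheafification\<close>

text \<open>
  The sections over all open sets live in one type \<^typ>\<open>'a\<close>; the carrier of the ring
  \<open>sec P U\<close> selects the sections over \<open>U\<close>. Only open sets matter as arguments.
\<close>

record ('p, 'a) ring_presheaf =
  base :: "'p topology"
  sec :: "'p set \<Rightarrow> 'a ring"
  res :: "'p set \<Rightarrow> 'p set \<Rightarrow> 'a \<Rightarrow> 'a"

locale presheaf_of_rings =
  fixes P :: "('p, 'a) ring_presheaf"
  assumes sec_ring: "openin (base P) U \<Longrightarrow> ring (sec P U)"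
    and res_hom: "\<lbrakk>openin (base P) U; openin (base P) V; V \<subseteq> U\<rbrakk>
      \<Longrightarrow> res P U V \<in> ring_hom (sec P U) (sec P V)"
    and res_id: "\<lbrakk>openin (base P) U; s \<in> carrier (sec P U)\<rbrakk> \<Longrightarrow> res P U U s = s"
    and res_res: "\<lbrakk>openin (base P) U; openin (base P) V; openin (base P) W; W \<subseteq> V; V \<subseteq> U;
      s \<in> carrier (sec P U)\<rbrakk> \<Longrightarrow> res P V W (res P U V s) = res P U W s"

locale ringed_space = presheaf_of_rings P for P :: "('p, 'a) ring_presheaf" +
  assumes sec_cring: "openin (base P) U \<Longrightarrow> cring (sec P U)"
    and glue: "\<lbrakk>\<And>V. V \<in> \<U> \<Longrightarrow> openin (base P) V;
      \<And>V. V \<in> \<U> \<Longrightarrow> s V \<in> carrier (sec P V);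
      \<And>V W. \<lbrakk>V \<in> \<U>; W \<in> \<U>\<rbrakk> \<Longrightarrow> res P V (V \<inter> W) (s V) = res P W (V \<inter> W) (s W)\<rbrakk>
      \<Longrightarrow> \<exists>!t. t \<in> carrier (sec P (\<Union>\<U>)) \<and> (\<forall>V\<in>\<U>. res P (\<Union>\<U>) V t = s V)"

text \<open>A germ is the whole equivalence class of pairs (neighbourhood, section).\<close>

definition germ :: "('p, 'a) ring_presheaf \<Rightarrow> 'p \<Rightarrow> 'p set \<Rightarrow> 'a \<Rightarrow> ('p set \<times> 'a) set" where
  "germ P x U s = {(V, t). openin (base P) V \<and> x \<in> V \<and> t \<in> carrier (sec P V) \<and>
     (\<exists>W. openin (base P) W \<and> x \<in> W \<and> W \<subseteq> U \<inter> V \<and> res P U W s = res P V W t)}"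

definition stalk :: "('p, 'a) ring_presheaf \<Rightarrow> 'p \<Rightarrow> ('p set \<times> 'a) set ring" where
  "stalk P x =
    \<lparr>carrier = {germ P x U s | U s. openin (base P) U \<and> x \<in> U \<and> s \<in> carrier (sec P U)},
     mult = (\<lambda>A B. \<Union>(U, s)\<in>A. \<Union>(V, t)\<in>B.
       germ P x (U \<inter> V) (res P U (U \<inter> V) s \<otimes>\<^bsub>sec P (U \<inter> V)\<^esub> res P V (U \<inter> V) t)),
     one = germ P x (topspace (base P)) \<one>\<^bsub>sec P (topspace (base P))\<^esub>,
     zero = germ P x (topspace (base P)) \<zero>\<^bsub>sec P (topspace (base P))\<^esub>,
     add = (\<lambda>A B. \<Union>(U, s)\<in>A. \<Union>(V, t)\<in>B.
       germ P x (U \<inter> V) (res P U (U \<inter> V) s \<oplus>\<^bsub>sec P (U \<inter> V)\<^esub> res P V (U \<inter> V) t))\<rparr>"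

definition pointwise_ring :: "'p set \<Rightarrow> ('p \<Rightarrow> 'a ring) \<Rightarrow> ('p \<Rightarrow> 'a) ring" where
  "pointwise_ring U R =
    \<lparr>carrier = (\<Pi>\<^sub>E x\<in>U. carrier (R x)),
     mult = (\<lambda>s t. \<lambda>x\<in>U. s x \<otimes>\<^bsub>R x\<^esub> t x),
     one = (\<lambda>x\<in>U. \<one>\<^bsub>R x\<^esub>),
     zero = (\<lambda>x\<in>U. \<zero>\<^bsub>R x\<^esub>),
     add = (\<lambda>s t. \<lambda>x\<in>U. s x \<oplus>\<^bsub>R x\<^esub> t x)\<rparr>"

definition sheafification ::
    "('p, 'a) ring_presheaf \<Rightarrow> ('p, 'p \<Rightarrow> ('p set \<times> 'a) set) ring_presheaf" where
  "sheafification P =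
    \<lparr>base = base P,
     sec = (\<lambda>U. (pointwise_ring U (stalk P))
       \<lparr>carrier := {s \<in> (\<Pi>\<^sub>E x\<in>U. carrier (stalk P x)).
          \<forall>x\<in>U. \<exists>V t. openin (base P) V \<and> x \<in> V \<and> V \<subseteq> U \<and> t \<in> carrier (sec P V) \<and>
            (\<forall>y\<in>V. s y = germ P y V t)}\<rparr>),
     res = (\<lambda>U V s. restrict s V)\<rparr>"


section \<open>The spectrum of a commutative ring\<close>

text \<open>Fractions \<open>a/s\<close> in the localization at a prime \<open>\<pp>\<close>, again as whole equivalence classes.\<close>

definition frac :: "('r, 'e) ring_scheme \<Rightarrow> 'r set \<Rightarrow> 'r \<Rightarrow> 'r \<Rightarrow> ('r \<times> 'r) set" where
  "frac R \<pp> a s = {(b, t). b \<in> carrier R \<and> t \<in> carrier R - \<pp> \<and>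
     (\<exists>u\<in>carrier R - \<pp>. u \<otimes>\<^bsub>R\<^esub> (a \<otimes>\<^bsub>R\<^esub> t) = u \<otimes>\<^bsub>R\<^esub> (b \<otimes>\<^bsub>R\<^esub> s))}"

definition localization :: "('r, 'e) ring_scheme \<Rightarrow> 'r set \<Rightarrow> ('r \<times> 'r) set ring" where
  "localization R \<pp> =
    \<lparr>carrier = {frac R \<pp> a s | a s. a \<in> carrier R \<and> s \<in> carrier R - \<pp>},
     mult = (\<lambda>A B. \<Union>(a, s)\<in>A. \<Union>(b, t)\<in>B. frac R \<pp> (a \<otimes>\<^bsub>R\<^esub> b) (s \<otimes>\<^bsub>R\<^esub> t)),
     one = frac R \<pp> \<one>\<^bsub>R\<^esub> \<one>\<^bsub>R\<^esub>,
     zero = frac R \<pp> \<zero>\<^bsub>R\<^esub> \<one>\<^bsub>R\<^esub>,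
     add = (\<lambda>A B. \<Union>(a, s)\<in>A. \<Union>(b, t)\<in>B.
       frac R \<pp> (a \<otimes>\<^bsub>R\<^esub> t \<oplus>\<^bsub>R\<^esub> b \<otimes>\<^bsub>R\<^esub> s) (s \<otimes>\<^bsub>R\<^esub> t))\<rparr>"

definition zariski :: "('r, 'e) ring_scheme \<Rightarrow> 'r set topology" where
  "zariski R = topology_generated_by {{\<pp>. primeideal \<pp> R \<and> a \<notin> \<pp>} | a. a \<in> carrier R}"

definition Spec :: "('r, 'e) ring_scheme \<Rightarrow> ('r set, 'r set \<Rightarrow> ('r \<times> 'r) set) ring_presheaf" where
  "Spec R =
    \<lparr>base = zariski R,
     sec = (\<lambda>U. (pointwise_ring U (localization R))
       \<lparr>carrier := {s \<in> (\<Pi>\<^sub>E \<pp>\<in>U. carrier (localization R \<pp>)).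
          \<forall>\<pp>\<in>U. \<exists>V a f. openin (zariski R) V \<and> \<pp> \<in> V \<and> V \<subseteq> U \<and> a \<in> carrier R \<and> f \<in> carrier R \<and>
            (\<forall>\<qq>\<in>V. f \<notin> \<qq> \<and> s \<qq> = frac R \<qq> a f)}\<rparr>),
     res = (\<lambda>U V s. restrict s V)\<rparr>"


section \<open>Schemes and their morphisms\<close>

definition restrict_space :: "('p, 'a) ring_presheaf \<Rightarrow> 'p set \<Rightarrow> ('p, 'a) ring_presheaf" where
  "restrict_space X U = X\<lparr>base := subtopology (base X) U\<rparr>"

definition preim :: "('p, 'a) ring_presheaf \<Rightarrow> ('p \<Rightarrow> 'q) \<Rightarrow> 'q set \<Rightarrow> 'p set" where
  "preim X f V = {x \<in> topspace (base X). f x \<in> V}"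

text \<open>
  A morphism \<open>X \<rightarrow> Y\<close> is a pair \<open>(f, \<phi>)\<close> with \<open>\<phi> V\<close> mapping sections over \<open>V\<close> to sections over
  the preimage of \<open>V\<close>.
\<close>

type_synonym ('p, 'a, 'q, 'b) mor = "('p \<Rightarrow> 'q) \<times> ('q set \<Rightarrow> 'b \<Rightarrow> 'a)"

definition ringed_space_iso ::
    "('p, 'a) ring_presheaf \<Rightarrow> ('q, 'b) ring_presheaf \<Rightarrow> ('p, 'a, 'q, 'b) mor \<Rightarrow> bool" where
  "ringed_space_iso X Y m \<longleftrightarrow>
     homeomorphic_map (base X) (base Y) (fst m) \<and>
     (\<forall>V. openin (base Y) V \<longrightarrow> snd m V \<in> ring_iso (sec Y V) (sec X (preim X (fst m) V))) \<and>
     (\<forall>V V'. openin (base Y) V \<and> openin (base Y) V' \<and> V' \<subseteq> V \<longrightarrow>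
       (\<forall>t\<in>carrier (sec Y V).
         snd m V' (res Y V V' t) = res X (preim X (fst m) V) (preim X (fst m) V') (snd m V t)))"

text \<open>
  An affine \<open>U\<close> is isomorphic to the spectrum of its own ring of sections, so no generality is
  lost by letting the ring \<open>R\<close> range over rings on the type \<^typ>\<open>'a\<close> only.
\<close>

definition affine_open :: "('p, 'a) ring_presheaf \<Rightarrow> 'p set \<Rightarrow> bool" where
  "affine_open X U \<longleftrightarrow> openin (base X) U \<and>
     (\<exists>(R :: 'a ring) m. cring R \<and> ringed_space_iso (restrict_space X U) (Spec R) m)"

text \<open>The stalks of a scheme are automatically local, being localizations of rings at primes.\<close>

definition scheme :: "('p, 'a) ring_presheaf \<Rightarrow> bool" where
  "scheme X \<longleftrightarrow> ringed_space X \<and> (\<forall>x\<in>topspace (base X). \<exists>U. x \<in> U \<and> affine_open X U)"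

text \<open>The last clause says that the homomorphisms induced on stalks are local.\<close>

definition morphism ::
    "('p, 'a) ring_presheaf \<Rightarrow> ('q, 'b) ring_presheaf \<Rightarrow> ('p, 'a, 'q, 'b) mor \<Rightarrow> bool" where
  "morphism X Y m \<longleftrightarrow>
     continuous_map (base X) (base Y) (fst m) \<and>
     (\<forall>V. openin (base Y) V \<longrightarrow> snd m V \<in> ring_hom (sec Y V) (sec X (preim X (fst m) V))) \<and>
     (\<forall>V V'. openin (base Y) V \<and> openin (base Y) V' \<and> V' \<subseteq> V \<longrightarrow>
       (\<forall>t\<in>carrier (sec Y V).
         snd m V' (res Y V V' t) = res X (preim X (fst m) V) (preim X (fst m) V') (snd m V t))) \<and>
     (\<forall>V t x. openin (base Y) V \<and> t \<in> carrier (sec Y V) \<and> x \<in> preim X (fst m) V \<and>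
        germ X x (preim X (fst m) V) (snd m V t) \<in> Units (stalk X x) \<longrightarrow>
        germ Y (fst m x) V t \<in> Units (stalk Y (fst m x)))"

text \<open>Equality of morphisms, disregarding values outside the relevant carriers.\<close>

definition mor_eq ::
    "('p, 'a) ring_presheaf \<Rightarrow> ('q, 'b) ring_presheaf \<Rightarrow>
     ('p, 'a, 'q, 'b) mor \<Rightarrow> ('p, 'a, 'q, 'b) mor \<Rightarrow> bool" where
  "mor_eq X Y m n \<longleftrightarrow>
     (\<forall>x\<in>topspace (base X). fst m x = fst n x) \<and>
     (\<forall>V. openin (base Y) V \<longrightarrow> (\<forall>t\<in>carrier (sec Y V). snd m V t = snd n V t))"

text \<open>\<open>mor_comp Y n m\<close> is the composite of \<open>m : X \<rightarrow> Y\<close> and \<open>n : Y \<rightarrow> Z\<close>.\<close>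

definition mor_comp ::
    "('q, 'b) ring_presheaf \<Rightarrow> ('q, 'b, 'z, 'c) mor \<Rightarrow> ('p, 'a, 'q, 'b) mor \<Rightarrow> ('p, 'a, 'z, 'c) mor" where
  "mor_comp Y n m = (fst n \<circ> fst m, \<lambda>V t. snd m (preim Y (fst n) V) (snd n V t))"

definition mor_id :: "('p, 'a, 'p, 'a) mor" where
  "mor_id = (id, \<lambda>V t. t)"


section \<open>Proper morphisms\<close>

text \<open>
  The universal property of the fibre product \<open>W\<close> of \<open>f : X \<rightarrow> S\<close> and \<open>g : Y \<rightarrow> S\<close>. The test
  schemes \<open>T\<close> have points and sections of the same types as \<open>W\<close>, since HOL cannot quantify over
  types inside a definition. If these types are large enough to contain a copy of the actual fibre
  product, then the latter is among the test schemes and \<open>W\<close> is isomorphic to it.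
\<close>

definition fibre_product ::
    "('p, 'a) ring_presheaf \<Rightarrow> ('y, 'c) ring_presheaf \<Rightarrow> ('q, 'b) ring_presheaf \<Rightarrow>
     ('p, 'a, 'q, 'b) mor \<Rightarrow> ('y, 'c, 'q, 'b) mor \<Rightarrow>
     ('w, 'd) ring_presheaf \<Rightarrow> ('w, 'd, 'p, 'a) mor \<Rightarrow> ('w, 'd, 'y, 'c) mor \<Rightarrow> bool" where
  "fibre_product X Y S f g W p q \<longleftrightarrow>
     scheme W \<and> morphism W X p \<and> morphism W Y q \<and>
     mor_eq W S (mor_comp X f p) (mor_comp Y g q) \<and>
     (\<forall>(T :: ('w, 'd) ring_presheaf) a b.
        scheme T \<and> morphism T X a \<and> morphism T Y b \<and>
        mor_eq T S (mor_comp X f a) (mor_comp Y g b) \<longrightarrow>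
        (\<exists>h. morphism T W h \<and> mor_eq T X (mor_comp W p h) a \<and> mor_eq T Y (mor_comp W q h) b \<and>
          (\<forall>h'. morphism T W h' \<and> mor_eq T X (mor_comp W p h') a \<and> mor_eq T Y (mor_comp W q h') b
             \<longrightarrow> mor_eq T W h' h)))"

definition closed_immersion ::
    "('p, 'a) ring_presheaf \<Rightarrow> ('q, 'b) ring_presheaf \<Rightarrow> ('p, 'a, 'q, 'b) mor \<Rightarrow> bool" where
  "closed_immersion X Y m \<longleftrightarrow>
     morphism X Y m \<and>
     closedin (base Y) (fst m ` topspace (base X)) \<and>
     homeomorphic_map (base X) (subtopology (base Y) (fst m ` topspace (base X))) (fst m) \<and>
     (\<forall>V s y. openin (base Y) V \<and> s \<in> carrier (sec X (preim X (fst m) V)) \<and> y \<in> V \<longrightarrow>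
        (\<exists>V' t. openin (base Y) V' \<and> y \<in> V' \<and> V' \<subseteq> V \<and> t \<in> carrier (sec Y V') \<and>
           snd m V' t = res X (preim X (fst m) V) (preim X (fst m) V') s))"

definition finitely_generated_algebra ::
    "('b, 'e) ring_scheme \<Rightarrow> ('a, 'f) ring_scheme \<Rightarrow> ('b \<Rightarrow> 'a) \<Rightarrow> bool" where
  "finitely_generated_algebra B A h \<longleftrightarrow>
     (\<exists>G. finite G \<and> G \<subseteq> carrier A \<and> generate_ring A (h ` carrier B \<union> G) = carrier A)"

definition finite_type ::
    "('p, 'a) ring_presheaf \<Rightarrow> ('q, 'b) ring_presheaf \<Rightarrow> ('p, 'a, 'q, 'b) mor \<Rightarrow> bool" where
  "finite_type X S f \<longleftrightarrow>
     (\<forall>y\<in>topspace (base S). \<exists>V \<U>. y \<in> V \<and> affine_open S V \<and> finite \<U> \<and>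
        \<Union>\<U> = preim X (fst f) V \<and>
        (\<forall>U\<in>\<U>. affine_open X U \<and>
           finitely_generated_algebra (sec S V) (sec X U)
             (\<lambda>t. res X (preim X (fst f) V) U (snd f V t))))"

type_synonym ('p, 'a, 'q, 'b) big = "('p + 'a + 'q + 'b + nat) set"

text \<open>
  Let \<open>\<mu>\<close> be the cardinality of \<^typ>\<open>('p, 'a, 'q, 'b) big\<close>, that is, \<open>2 ^ \<kappa>\<close> where the infinite
  cardinal \<open>\<kappa>\<close> bounds the points and the sections of \<open>X\<close> and \<open>S\<close>. If \<open>Y\<close> has at most \<open>\<mu>\<close>
  points and sections, the fibre product of \<open>X\<close> and \<open>Y\<close> over \<open>S\<close> has at most \<open>2 ^ \<mu>\<close> points and
  sections, so it fits into the type \<^typ>\<open>('p, 'a, 'q, 'b) big set\<close> used for fibre products below.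
  Affine spaces over \<open>S\<close> have at most \<open>\<mu>\<close> points and sections, and for a quasi-compact \<open>f\<close> they
  already suffice to test universal closedness. Hence the bounds on the types do not affect the
  meaning of \<open>proper\<close>.
\<close>

definition separated ::
    "('p, 'a) ring_presheaf \<Rightarrow> ('q, 'b) ring_presheaf \<Rightarrow> ('p, 'a, 'q, 'b) mor \<Rightarrow> bool" where
  "separated X S f \<longleftrightarrow>
     (\<forall>(W :: (('p, 'a, 'q, 'b) big set, ('p, 'a, 'q, 'b) big set) ring_presheaf) p q d.
        fibre_product X X S f f W p q \<and> morphism X W d \<and>
        mor_eq X X (mor_comp W p d) mor_id \<and> mor_eq X X (mor_comp W q d) mor_id \<longrightarrow>
        closed_immersion X W d)"

definition universally_closed ::
    "('p, 'a) ring_presheaf \<Rightarrow> ('q, 'b) ring_presheaf \<Rightarrow> ('p, 'a, 'q, 'b) mor \<Rightarrow> bool" where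
  "universally_closed X S f \<longleftrightarrow>
     (\<forall>(Y :: (('p, 'a, 'q, 'b) big, ('p, 'a, 'q, 'b) big) ring_presheaf) g
       (W :: (('p, 'a, 'q, 'b) big set, ('p, 'a, 'q, 'b) big set) ring_presheaf) p q.
        scheme Y \<and> morphism Y S g \<and> fibre_product X Y S f g W p q \<longrightarrow>
        closed_map (base W) (base Y) (fst q))"

definition proper ::
    "('p, 'a) ring_presheaf \<Rightarrow> ('q, 'b) ring_presheaf \<Rightarrow> ('p, 'a, 'q, 'b) mor \<Rightarrow> bool" where
  "proper X S f \<longleftrightarrow>
     morphism X S f \<and> separated X S f \<and> finite_type X S f \<and> universally_closed X S f"

definition proper_scheme_over ::
    "'k ring \<Rightarrow> ('p, 'a) ring_presheaf \<Rightarrow> ('p, 'a, 'k set, 'k set \<Rightarrow> ('k \<times> 'k) set) mor \<Rightarrow> bool" where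
  "proper_scheme_over k X \<pi> \<longleftrightarrow> scheme X \<and> proper X (Spec k) \<pi>"


section \<open>Irreducibility, dimension, reducedness\<close>

definition irreducible_in :: "'p topology \<Rightarrow> 'p set \<Rightarrow> bool" where
  "irreducible_in T Z \<longleftrightarrow> Z \<subseteq> topspace T \<and> Z \<noteq> {} \<and>
     (\<forall>A B. closedin T A \<and> closedin T B \<and> Z \<subseteq> A \<union> B \<longrightarrow> Z \<subseteq> A \<or> Z \<subseteq> B)"

text \<open>The dimension of the empty space is \<open>-\<infinity>\<close>, as the supremum of the empty set.\<close>

definition krull_dim :: "'p topology \<Rightarrow> ereal" where
  "krull_dim T = Sup {ereal (real n) | n. \<exists>Z.
     (\<forall>i\<le>n. closedin T (Z i) \<and> irreducible_in T (Z i)) \<and> (\<forall>i<n. Z i \<subset> Z (Suc i))}"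

definition reduced :: "('p, 'a) ring_presheaf \<Rightarrow> bool" where
  "reduced X \<longleftrightarrow> (\<forall>U s n. openin (base X) U \<and> s \<in> carrier (sec X U) \<and>
     s [^]\<^bsub>sec X U\<^esub> (n :: nat) = \<zero>\<^bsub>sec X U\<^esub> \<longrightarrow> s = \<zero>\<^bsub>sec X U\<^esub>)"


section \<open>Line bundles\<close>

record ('p, 'a, 'm) module_presheaf =
  msec :: "'p set \<Rightarrow> ('a, 'm) module"
  mres :: "'p set \<Rightarrow> 'p set \<Rightarrow> 'm \<Rightarrow> 'm"

locale sheaf_of_modules = ringed_space X
  for X :: "('p, 'a) ring_presheaf" and M :: "('p, 'a, 'm) module_presheaf" +
  assumes msec_module: "openin (base X) U \<Longrightarrow> module (sec X U) (msec M U)"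
    and mres_closed: "\<lbrakk>openin (base X) U; openin (base X) V; V \<subseteq> U; u \<in> carrier (msec M U)\<rbrakk>
      \<Longrightarrow> mres M U V u \<in> carrier (msec M V)"
    and mres_add: "\<lbrakk>openin (base X) U; openin (base X) V; V \<subseteq> U;
      u \<in> carrier (msec M U); v \<in> carrier (msec M U)\<rbrakk>
      \<Longrightarrow> mres M U V (u \<oplus>\<^bsub>msec M U\<^esub> v) = mres M U V u \<oplus>\<^bsub>msec M V\<^esub> mres M U V v"
    and mres_smult: "\<lbrakk>openin (base X) U; openin (base X) V; V \<subseteq> U;
      r \<in> carrier (sec X U); u \<in> carrier (msec M U)\<rbrakk>
      \<Longrightarrow> mres M U V (r \<odot>\<^bsub>msec M U\<^esub> u) = res X U V r \<odot>\<^bsub>msec M V\<^esub> mres M U V u"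
    and mres_id: "\<lbrakk>openin (base X) U; u \<in> carrier (msec M U)\<rbrakk> \<Longrightarrow> mres M U U u = u"
    and mres_mres: "\<lbrakk>openin (base X) U; openin (base X) V; openin (base X) W; W \<subseteq> V; V \<subseteq> U;
      u \<in> carrier (msec M U)\<rbrakk> \<Longrightarrow> mres M V W (mres M U V u) = mres M U W u"
    and mglue: "\<lbrakk>\<And>V. V \<in> \<U> \<Longrightarrow> openin (base X) V;
      \<And>V. V \<in> \<U> \<Longrightarrow> s V \<in> carrier (msec M V);
      \<And>V W. \<lbrakk>V \<in> \<U>; W \<in> \<U>\<rbrakk> \<Longrightarrow> mres M V (V \<inter> W) (s V) = mres M W (V \<inter> W) (s W)\<rbrakk>
      \<Longrightarrow> \<exists>!v. v \<in> carrier (msec M (\<Union>\<U>)) \<and> (\<forall>V\<in>\<U>. mres M (\<Union>\<U>) V v = s V)"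

text \<open>Line bundles are invertible sheaves: locally isomorphic to the structure sheaf as modules.\<close>

definition line_bundle :: "('p, 'a) ring_presheaf \<Rightarrow> ('p, 'a, 'm) module_presheaf \<Rightarrow> bool" where
  "line_bundle X M \<longleftrightarrow> sheaf_of_modules X M \<and>
     (\<forall>x\<in>topspace (base X). \<exists>U \<phi>. openin (base X) U \<and> x \<in> U \<and>
       (\<forall>V. openin (base X) V \<and> V \<subseteq> U \<longrightarrow>
          bij_betw (\<phi> V) (carrier (sec X V)) (carrier (msec M V)) \<and>
          (\<forall>r\<in>carrier (sec X V). \<forall>s\<in>carrier (sec X V).
             \<phi> V (r \<oplus>\<^bsub>sec X V\<^esub> s) = \<phi> V r \<oplus>\<^bsub>msec M V\<^esub> \<phi> V s \<and>
             \<phi> V (r \<otimes>\<^bsub>sec X V\<^esub> s) = r \<odot>\<^bsub>msec M V\<^esub> \<phi> V s)) \<and>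
       (\<forall>V W. openin (base X) V \<and> openin (base X) W \<and> W \<subseteq> V \<and> V \<subseteq> U \<longrightarrow>
          (\<forall>r\<in>carrier (sec X V). \<phi> W (res X V W r) = mres M V W (\<phi> V r))))"


section \<open>Tensor powers and the section ring\<close>

text \<open>
  The free associative \<open>R\<close>-algebra on a set \<open>B\<close>: finitely supported functions on words over \<open>B\<close>,
  with multiplication induced by concatenation.
\<close>

definition free_algebra :: "('r, 'e) ring_scheme \<Rightarrow> 'm set \<Rightarrow> ('m list \<Rightarrow> 'r) ring" where
  "free_algebra R B =
    \<lparr>carrier = {f. (\<forall>w. f w \<in> carrier R) \<and> finite {w. f w \<noteq> \<zero>\<^bsub>R\<^esub>} \<and>
       (\<forall>w. f w \<noteq> \<zero>\<^bsub>R\<^esub> \<longrightarrow> set w \<subseteq> B)},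
     mult = (\<lambda>f g w. \<Oplus>\<^bsub>R\<^esub>i\<in>{..length w}. f (take i w) \<otimes>\<^bsub>R\<^esub> g (drop i w)),
     one = (\<lambda>w. if w = [] then \<one>\<^bsub>R\<^esub> else \<zero>\<^bsub>R\<^esub>),
     zero = (\<lambda>w. \<zero>\<^bsub>R\<^esub>),
     add = (\<lambda>f g w. f w \<oplus>\<^bsub>R\<^esub> g w)\<rparr>"

definition monomial :: "('r, 'e) ring_scheme \<Rightarrow> 'r \<Rightarrow> 'm list \<Rightarrow> ('m list \<Rightarrow> 'r)" where
  "monomial R r w = (\<lambda>v. if v = w then r else \<zero>\<^bsub>R\<^esub>)"

definition tensor_ideal :: "('r, 'e) ring_scheme \<Rightarrow> ('r, 'm) module \<Rightarrow> ('m list \<Rightarrow> 'r) set" where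
  "tensor_ideal R M =
    (let F = free_algebra R (carrier M) in
     Idl\<^bsub>F\<^esub>
      ({monomial R \<one>\<^bsub>R\<^esub> [u \<oplus>\<^bsub>M\<^esub> v] \<ominus>\<^bsub>F\<^esub> (monomial R \<one>\<^bsub>R\<^esub> [u] \<oplus>\<^bsub>F\<^esub> monomial R \<one>\<^bsub>R\<^esub> [v])
          | u v. u \<in> carrier M \<and> v \<in> carrier M} \<union>
       {monomial R \<one>\<^bsub>R\<^esub> [r \<odot>\<^bsub>M\<^esub> u] \<ominus>\<^bsub>F\<^esub> monomial R r [u]
          | r u. r \<in> carrier R \<and> u \<in> carrier M}))"

definition tensor_algebra ::
    "('r, 'e) ring_scheme \<Rightarrow> ('r, 'm) module \<Rightarrow> ('m list \<Rightarrow> 'r) set ring" where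
  "tensor_algebra R M = free_algebra R (carrier M) Quot tensor_ideal R M"

text \<open>The \<open>n\<close>-th tensor power of \<open>M\<close>, as the homogeneous part of degree \<open>n\<close> of the tensor algebra.\<close>

definition tensor_power ::
    "('r, 'e) ring_scheme \<Rightarrow> ('r, 'm) module \<Rightarrow> nat \<Rightarrow> ('m list \<Rightarrow> 'r) set set" where
  "tensor_power R M n =
    {tensor_ideal R M +>\<^bsub>free_algebra R (carrier M)\<^esub> f | f.
       f \<in> carrier (free_algebra R (carrier M)) \<and> (\<forall>w. f w \<noteq> \<zero>\<^bsub>R\<^esub> \<longrightarrow> length w = n)}"

text \<open>
  For \<open>h : R \<rightarrow> R'\<close> and \<open>g : M \<rightarrow> M'\<close> the induced map of free algebras, sending the monomial
  \<open>r \<cdot> u\<^sub>1 \<dots> u\<^sub>n\<close> to \<open>h r \<cdot> g u\<^sub>1 \<dots> g u\<^sub>n\<close>.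
\<close>

definition free_algebra_map ::
    "('r, 'e) ring_scheme \<Rightarrow> ('s, 'f) ring_scheme \<Rightarrow> ('r \<Rightarrow> 's) \<Rightarrow> ('m \<Rightarrow> 'n) \<Rightarrow>
     ('m list \<Rightarrow> 'r) \<Rightarrow> ('n list \<Rightarrow> 's)" where
  "free_algebra_map R R' h g f = (\<lambda>v. \<Oplus>\<^bsub>R'\<^esub>w\<in>{w. f w \<noteq> \<zero>\<^bsub>R\<^esub> \<and> map g w = v}. h (f w))"

definition tensor_presheaf ::
    "('p, 'a) ring_presheaf \<Rightarrow> ('p, 'a, 'm) module_presheaf \<Rightarrow>
     ('p, ('m list \<Rightarrow> 'a) set) ring_presheaf" where
  "tensor_presheaf X M =
    \<lparr>base = base X,
     sec = (\<lambda>U. tensor_algebra (sec X U) (msec M U)),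
     res = (\<lambda>U V A. tensor_ideal (sec X V) (msec M V)
       <+>\<^bsub>free_algebra (sec X V) (carrier (msec M V))\<^esub>
         free_algebra_map (sec X U) (sec X V) (res X U V) (mres M U V) ` A)\<rparr>"

type_synonym ('p, 'a, 'm) power_section = "'p \<Rightarrow> ('p set \<times> ('m list \<Rightarrow> 'a) set) set"

definition tensor_sections ::
    "('p, 'a) ring_presheaf \<Rightarrow> ('p, 'a, 'm) module_presheaf \<Rightarrow> ('p, 'a, 'm) power_section ring" where
  "tensor_sections X M = sec (sheafification (tensor_presheaf X M)) (topspace (base X))"

text \<open>
  The global sections of the \<open>n\<close>-th tensor power of the sheaf \<open>M\<close>, that is, of the sheaf
  associated with the presheaf that sends \<open>U\<close> to the \<open>n\<close>-th tensor power of \<open>M(U)\<close>.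
\<close>

definition power_sections ::
    "('p, 'a) ring_presheaf \<Rightarrow> ('p, 'a, 'm) module_presheaf \<Rightarrow> nat \<Rightarrow> ('p, 'a, 'm) power_section set" where
  "power_sections X M n = {s \<in> carrier (tensor_sections X M).
     \<forall>x\<in>topspace (base X). \<exists>V t. openin (base X) V \<and> x \<in> V \<and>
       t \<in> tensor_power (sec X V) (msec M V) n \<and>
       (\<forall>y\<in>V. s y = germ (tensor_presheaf X M) y V t)}"

text \<open>
  The section ring is the (internal) direct sum of the groups \<open>power_sections X M n\<close> in the ring of
  global sections of the sheaf of tensor algebras.
\<close>

definition section_ring ::
    "('p, 'a) ring_presheaf \<Rightarrow> ('p, 'a, 'm) module_presheaf \<Rightarrow> ('p, 'a, 'm) power_section ring" where
  "section_ring X M = (tensor_sections X M)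
     \<lparr>carrier := {\<Oplus>\<^bsub>tensor_sections X M\<^esub>n\<in>{..N}. h n | N h. \<forall>n. h n \<in> power_sections X M n}\<rparr>"

text \<open>
  The map from \<open>k\<close> to the degree \<open>0\<close> part of the section ring given by the structure morphism
  \<open>\<pi>\<close> from \<open>X\<close> to the spectrum of \<open>k\<close>.
\<close>

definition scalar ::
    "'k ring \<Rightarrow> ('p, 'a) ring_presheaf \<Rightarrow> ('p, 'a, 'k set, 'k set \<Rightarrow> ('k \<times> 'k) set) mor \<Rightarrow>
     ('p, 'a, 'm) module_presheaf \<Rightarrow> 'k \<Rightarrow> ('p, 'a, 'm) power_section" where
  "scalar k X \<pi> M c =
    (let T = topspace (base X);
         P = topspace (base (Spec k));
         r = snd \<pi> P (\<lambda>\<pp>\<in>P. frac k \<pp> c \<one>\<^bsub>k\<^esub>)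
     in (\<lambda>x\<in>T. germ (tensor_presheaf X M) x T
          (tensor_ideal (sec X T) (msec M T)
             +>\<^bsub>free_algebra (sec X T) (carrier (msec M T))\<^esub> monomial (sec X T) r [])))"


section \<open>Graded linear series and Kodaira-Iitaka dimension\<close>

definition graded_linear_series ::
    "'k ring \<Rightarrow> ('p, 'a) ring_presheaf \<Rightarrow> ('p, 'a, 'k set, 'k set \<Rightarrow> ('k \<times> 'k) set) mor \<Rightarrow>
     ('p, 'a, 'm) module_presheaf \<Rightarrow> ('p, 'a, 'm) power_section set \<Rightarrow> bool" where
  "graded_linear_series k X \<pi> M L \<longleftrightarrow>
     line_bundle X M \<and> subring L (section_ring X M) \<and> scalar k X \<pi> M ` carrier k \<subseteq> L \<and>
     (\<forall>y\<in>L. \<exists>N h. (\<forall>n. h n \<in> L \<inter> power_sections X M n) \<and>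
        y = (\<Oplus>\<^bsub>section_ring X M\<^esub>n\<in>{..N}. h n))"

definition graded_piece ::
    "('p, 'a) ring_presheaf \<Rightarrow> ('p, 'a, 'm) module_presheaf \<Rightarrow>
     ('p, 'a, 'm) power_section set \<Rightarrow> nat \<Rightarrow> ('p, 'a, 'm) power_section set" where
  "graded_piece X M L n = L \<inter> power_sections X M n"

text \<open>
  The library's dimension over a subfield of a ring, here the image of \<open>k\<close>; it is a natural number
  and unspecified for infinite-dimensional spaces, but sections of line bundles on a proper scheme
  over \<open>k\<close> form finite-dimensional spaces.
\<close>

definition graded_piece_dim ::
    "'k ring \<Rightarrow> ('p, 'a) ring_presheaf \<Rightarrow> ('p, 'a, 'k set, 'k set \<Rightarrow> ('k \<times> 'k) set) mor \<Rightarrow>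
     ('p, 'a, 'm) module_presheaf \<Rightarrow> ('p, 'a, 'm) power_section set \<Rightarrow> nat \<Rightarrow> nat" where
  "graded_piece_dim k X \<pi> M L n =
     (ring.dim (section_ring X M) over (scalar k X \<pi> M ` carrier k)) (graded_piece X M L n)"

text \<open>
  Algebraic independence of \<open>y\<^sub>1, \<dots>, y\<^sub>m\<close> over \<open>k\<close> in a \<open>k\<close>-algebra \<open>A\<close> with structure map \<open>\<iota>\<close>;
  the finite set \<open>E\<close> of exponent vectors and the coefficients \<open>c\<close> represent a polynomial.
\<close>

definition algebraically_independent ::
    "('k, 'e) ring_scheme \<Rightarrow> ('a, 'f) ring_scheme \<Rightarrow> ('k \<Rightarrow> 'a) \<Rightarrow> 'a list \<Rightarrow> bool" where
  "algebraically_independent k A \<iota> ys \<longleftrightarrow>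
     (\<forall>(E :: nat list set) c.
        finite E \<and> (\<forall>e\<in>E. length e = length ys) \<and> (\<forall>e\<in>E. c e \<in> carrier k) \<and>
        (\<Oplus>\<^bsub>A\<^esub>e\<in>E. \<iota> (c e) \<otimes>\<^bsub>A\<^esub> foldr (\<otimes>\<^bsub>A\<^esub>) (map2 (\<lambda>y i. y [^]\<^bsub>A\<^esub> i) ys e) \<one>\<^bsub>A\<^esub>) = \<zero>\<^bsub>A\<^esub>
        \<longrightarrow> (\<forall>e\<in>E. c e = \<zero>\<^bsub>k\<^esub>))"

text \<open>
  The supremum in \<^typ>\<open>enat\<close> is the maximum whenever the latter exists, and \<open>0\<close> is always among
  the values for \<open>X\<close> nonempty, by the empty list.
\<close>

definition sigma ::
    "'k ring \<Rightarrow> ('p, 'a) ring_presheaf \<Rightarrow> ('p, 'a, 'k set, 'k set \<Rightarrow> ('k \<times> 'k) set) mor \<Rightarrow>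
     ('p, 'a, 'm) module_presheaf \<Rightarrow> ('p, 'a, 'm) power_section set \<Rightarrow> enat" where
  "sigma k X \<pi> M L = Sup {enat (length ys) | ys.
     (\<forall>y\<in>set ys. \<exists>n>0. y \<in> graded_piece X M L n) \<and>
     algebraically_independent k (section_ring X M) (scalar k X \<pi> M) ys}"

definition kodaira_iitaka_dim ::
    "'k ring \<Rightarrow> ('p, 'a) ring_presheaf \<Rightarrow> ('p, 'a, 'k set, 'k set \<Rightarrow> ('k \<times> 'k) set) mor \<Rightarrow>
     ('p, 'a, 'm) module_presheaf \<Rightarrow> ('p, 'a, 'm) power_section set \<Rightarrow> ereal" where
  "kodaira_iitaka_dim k X \<pi> M L =
     (if sigma k X \<pi> M L > 0 then ereal_of_enat (sigma k X \<pi> M L) - 1 else -\<infinity>)"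

end

theory Submission
  imports
    Defs
    "HOL-Algebra.Finite_Extensions"
    "HOL-Algebra.Generated_Fields"
begin

text \<open>
  The hypotheses on \<open>X\<close> leave only the empty set and \<open>X\<close> itself as open sets, so \<open>X\<close> is determined by
  one ring \<open>A\<close>, its ring of global sections. This ring has two properties. Every element is a unit or
  nilpotent, because \<open>X\<close> is affine and a spectrum with no proper nonempty open set has no element that
  lies in some primes only (\<open>affine_unit_or_nilpotent\<close>). And \<open>A\<close> is finitely generated over \<open>k\<close>,
  because \<open>X\<close> is of finite type. Together they give \<open>dim A < \<infinity>\<close>
  (\<open>finite_dim_of_unit_or_nilpotent\<close>): modulo its nilpotent elements \<open>A\<close> is a field, to which Zariski's
  lemma applies, and finitely many nilpotent elements that measure the failure of the relations in
  this field to hold in \<open>A\<close> add only finitely many dimensions.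

  A line bundle on \<open>X\<close> is free of rank one, say with generator \<open>e\<close>. Hence the tensor algebra is a
  polynomial ring in \<open>e\<close>, its degree \<open>n\<close> part consists of the elements \<open>a e\<^sup>n\<close> with \<open>a \<in> A\<close>, and setting
  \<open>e = 1\<close> is a ring homomorphism to \<open>A\<close> that is injective in each degree (\<open>tensor_value_hom\<close>,
  \<open>tensor_power_value_zero\<close>). It embeds each \<open>L\<^sub>n\<close> as a subspace of \<open>A\<close>, so the dimensions are bounded.

  Since \<open>\<kappa>(L) = 0\<close>, some \<open>y \<in> L\<^sub>r\<close> with \<open>r > 0\<close> is not nilpotent. Its image in \<open>A\<close> is not nilpotent
  either, hence a unit, and multiplication by \<open>y\<close> is an injective map from \<open>L\<^sub>n\<close> to \<open>L\<^sub>n\<^sub>+\<^sub>r\<close>. Thus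
  \<open>dim L\<^sub>a\<^sub>+\<^sub>n\<^sub>r\<close> is nondecreasing in \<open>n\<close> and bounded, and therefore converges
  (\<open>graded_dimension_convergent\<close>).
\<close>

section \<open>Linear algebra over a subfield\<close>

definition linear_subspace :: "('a, 'e) ring_scheme \<Rightarrow> 'a set \<Rightarrow> 'a set \<Rightarrow> bool" where
  "linear_subspace R K E \<longleftrightarrow> E \<subseteq> carrier R \<and> \<zero>\<^bsub>R\<^esub> \<in> E \<and>
     (\<forall>u\<in>E. \<forall>v\<in>E. u \<oplus>\<^bsub>R\<^esub> v \<in> E) \<and> (\<forall>c\<in>K. \<forall>u\<in>E. c \<otimes>\<^bsub>R\<^esub> u \<in> E)"

text \<open>
  The map \<open>\<sigma>\<close> carries the scalars. Two cases matter: a ring homomorphism, with \<open>\<sigma> = g\<close>, and the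
  multiplication by an element from the right, with \<open>\<sigma>\<close> the identity.
\<close>
definition semilinear ::
    "('a, 'e) ring_scheme \<Rightarrow> ('b, 'f) ring_scheme \<Rightarrow> ('a \<Rightarrow> 'b) \<Rightarrow> 'a set \<Rightarrow> 'a set \<Rightarrow> ('a \<Rightarrow> 'b) \<Rightarrow> bool" where
  "semilinear R S \<sigma> K E g \<longleftrightarrow> g ` E \<subseteq> carrier S \<and> g \<zero>\<^bsub>R\<^esub> = \<zero>\<^bsub>S\<^esub> \<and>
     (\<forall>u\<in>E. \<forall>v\<in>E. g (u \<oplus>\<^bsub>R\<^esub> v) = g u \<oplus>\<^bsub>S\<^esub> g v) \<and>
     (\<forall>c\<in>K. \<forall>u\<in>E. g (c \<otimes>\<^bsub>R\<^esub> u) = \<sigma> c \<otimes>\<^bsub>S\<^esub> g u)"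

lemma (in ring) Span_Cons_mem_iff:
  "v \<in> Span K (u # Us) \<longleftrightarrow> (\<exists>c\<in>K. \<exists>w\<in>Span K Us. v = c \<otimes> u \<oplus> w)"
  using line_extension_mem_iff[of v K u "Span K Us"] by simp

lemma (in ring) linear_subspace_Span:
  assumes "subfield K R" "set Us \<subseteq> carrier R"
  shows "linear_subspace R K (Span K Us)"
  using Span_subgroup_props[OF assms] Span_smult_closed[OF assms]
  unfolding linear_subspace_def by blast

lemma (in ring) Span_minimal:
  assumes "linear_subspace R K E" "set Us \<subseteq> E"
  shows "Span K Us \<subseteq> E"
  using assms(2)
proof (induction Us)
  case Nil
  then show ?case using assms(1) by (simp add: linear_subspace_def)
next
  case (Cons u Us)
  show ?case
  proof
    fix v assume "v \<in> Span K (u # Us)"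
    then obtain c w where "c \<in> K" "w \<in> Span K Us" "v = c \<otimes> u \<oplus> w"
      unfolding Span_Cons_mem_iff by auto
    moreover have "Span K Us \<subseteq> E" "u \<in> E" using Cons by auto
    ultimately show "v \<in> E" using assms(1) unfolding linear_subspace_def by blast
  qed
qed

lemma linear_subspace_minus:
  assumes "ring R" "subfield K R" "linear_subspace R K E" "u \<in> E"
  shows "\<ominus>\<^bsub>R\<^esub> u \<in> E"
proof -
  interpret ring R by fact
  have "\<ominus>\<^bsub>R\<^esub> \<one>\<^bsub>R\<^esub> \<in> K" using subringE[OF subfieldE(1)[OF assms(2)]] by auto
  then have "(\<ominus>\<^bsub>R\<^esub> \<one>\<^bsub>R\<^esub>) \<otimes>\<^bsub>R\<^esub> u \<in> E" using assms(3,4) unfolding linear_subspace_def by auto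
  moreover have "u \<in> carrier R" using assms(3,4) unfolding linear_subspace_def by auto
  ultimately show ?thesis by (simp add: l_minus)
qed

lemma Span_semilinear_image:
  assumes "ring R" "ring S" "linear_subspace R K E" "semilinear R S \<sigma> K E g" "set Us \<subseteq> E"
  shows "ring.Span S (\<sigma> ` K) (map g Us) = g ` ring.Span R K Us"
proof -
  interpret R: ring R by fact
  interpret S: ring S by fact
  show ?thesis
    using assms(5)
  proof (induction Us)
    case Nil
    then show ?case using assms(4) by (simp add: semilinear_def)
  next
    case (Cons u Us)
    have sub: "R.Span K Us \<subseteq> E" using R.Span_minimal[OF assms(3)] Cons.prems by simp
    have IH: "S.Span (\<sigma> ` K) (map g Us) = g ` R.Span K Us" using Cons by simp
    have u: "u \<in> E" using Cons.prems by simp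
    have eq: "g (c \<otimes>\<^bsub>R\<^esub> u \<oplus>\<^bsub>R\<^esub> w) = \<sigma> c \<otimes>\<^bsub>S\<^esub> g u \<oplus>\<^bsub>S\<^esub> g w" if "c \<in> K" "w \<in> R.Span K Us" for c w
      using that sub u assms(3,4) unfolding semilinear_def linear_subspace_def by (metis subsetD)
    show ?case
    proof (intro equalityI subsetI)
      fix x assume "x \<in> S.Span (\<sigma> ` K) (map g (u # Us))"
      then obtain c w where "c \<in> K" "w \<in> R.Span K Us" "x = \<sigma> c \<otimes>\<^bsub>S\<^esub> g u \<oplus>\<^bsub>S\<^esub> g w"
        unfolding list.map S.Span_Cons_mem_iff IH by auto
      then show "x \<in> g ` R.Span K (u # Us)"
        using eq[of c w] by (intro image_eqI[of _ _ "c \<otimes>\<^bsub>R\<^esub> u \<oplus>\<^bsub>R\<^esub> w"]) (auto simp: R.Span_Cons_mem_iff simp del: R.Span.simps)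
    next
      fix x assume "x \<in> g ` R.Span K (u # Us)"
      then obtain c w where "c \<in> K" "w \<in> R.Span K Us" "x = g (c \<otimes>\<^bsub>R\<^esub> u \<oplus>\<^bsub>R\<^esub> w)"
        using R.Span_Cons_mem_iff[of _ K u Us] by (metis (no_types, lifting) imageE)
      then show "x \<in> S.Span (\<sigma> ` K) (map g (u # Us))"
        using eq[of c w] unfolding list.map S.Span_Cons_mem_iff IH by auto
    qed
  qed
qed

lemma independent_semilinear_image:
  assumes "ring R" "ring S" "linear_subspace R K E" "semilinear R S \<sigma> K E g" "inj_on g E"
    and "set Us \<subseteq> E" "ring.independent R K Us"
  shows "ring.independent S (\<sigma> ` K) (map g Us)"
proof -
  interpret R: ring R by fact
  interpret S: ring S by fact
  show ?thesis
    using assms(6,7)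
  proof (induction Us)
    case Nil
    then show ?case by simp
  next
    case (Cons u Us)
    have u: "u \<in> E" "u \<notin> R.Span K Us" "set Us \<subseteq> E" "R.independent K Us"
      using Cons.prems R.independent_backwards by auto
    have "R.Span K Us \<subseteq> E" using R.Span_minimal[OF assms(3) u(3)] .
    then have "g u \<notin> g ` R.Span K Us"
      using u assms(5) unfolding inj_on_def by blast
    then have "g u \<notin> S.Span (\<sigma> ` K) (map g Us)"
      using Span_semilinear_image[OF assms(1-4) u(3)] by simp
    moreover have "g u \<in> carrier S" using assms(4) u(1) unfolding semilinear_def by auto
    ultimately show ?case using Cons.IH u S.li_Cons by simp
  qed
qed

text \<open>
  A spanning list, thinned out to a basis, has at least as many elements as an independent list.
\<close>
lemma (in ring) independent_length_le_spanning:
  assumes "subfield K R" "set Vs \<subseteq> carrier R" "independent K Us" "set Us \<subseteq> Span K Vs"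
  shows "length Us \<le> length Vs"
proof -
  have "\<exists>n\<le>length Vs. dimension n K (Span K Vs)" using assms(2)
  proof (induction Vs)
    case Nil
    then show ?case using zero_dim by simp
  next
    case (Cons v Vs)
    then obtain n where n: "n \<le> length Vs" "dimension n K (Span K Vs)" by auto
    show ?case
    proof (cases "v \<in> Span K Vs")
      case True
      then have "Span K (v # Vs) \<subseteq> Span K Vs"
        using Cons.prems Span_minimal[OF linear_subspace_Span[OF assms(1)], of Vs "v # Vs"]
          Span_base_incl[OF assms(1), of Vs] by (simp del: Span.simps)
      then have "Span K (v # Vs) = Span K Vs"
        using mono_Span[OF assms(1), of Vs v] Cons.prems by (auto simp del: Span.simps)
      then show ?thesis using n by (intro exI[of _ n]) (simp del: Span.simps)
    next
      case False
      then show ?thesis using n Suc_dim[of v "Span K Vs" n K] Cons.prems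
        by (intro exI[of _ "Suc n"]) simp
    qed
  qed
  then show ?thesis
    using independent_length_le_dimension[OF assms(1) _ assms(3,4)] by force
qed

text \<open>
  An independent list of maximal length is a basis. The dimension is meaningful only for
  finite-dimensional spaces, and a bound on the length of independent lists ensures that.
\<close>
lemma (in ring) dimension_exists_if_bounded:
  assumes "subfield K R" "linear_subspace R K E"
    and bound: "\<And>Us. independent K Us \<Longrightarrow> set Us \<subseteq> E \<Longrightarrow> length Us \<le> N"
  obtains Us where "independent K Us" "set Us \<subseteq> E" "Span K Us = E" "(dim over K) E = length Us"
proof -
  let ?P = "\<lambda>n. \<exists>Us. independent K Us \<and> set Us \<subseteq> E \<and> length Us = n"
  have "?P 0" by (auto intro: exI[of _ "[]"])
  moreover have "\<forall>n. ?P n \<longrightarrow> n \<le> N" using bound by auto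
  ultimately obtain n where n: "?P n" "\<And>m. ?P m \<Longrightarrow> m \<le> n"
    using Nat.ex_has_greatest_nat[of ?P 0 N] by blast
  from n(1) obtain Us where Us: "independent K Us" "set Us \<subseteq> E" "length Us = n" by blast
  have "Span K Us \<subseteq> E" using Span_minimal[OF assms(2) Us(2)] .
  moreover have "E \<subseteq> Span K Us"
  proof
    fix v assume v: "v \<in> E"
    show "v \<in> Span K Us"
    proof (rule ccontr)
      assume "v \<notin> Span K Us"
      moreover have "v \<in> carrier R" using v assms(2) unfolding linear_subspace_def by auto
      ultimately have "independent K (v # Us)" using Us li_Cons by simp
      then have "?P (Suc n)" using Us v by (intro exI[of _ "v # Us"]) auto
      then show False using n(2) by fastforce
    qed
  qed
  ultimately have "Span K Us = E" by simp
  moreover have "dimension (length Us) K E"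
    using dimension_independent[OF Us(1)] \<open>Span K Us = E\<close> by simp
  then have "(dim over K) E = length Us" using dimI[OF assms(1)] by simp
  ultimately show thesis using Us that by blast
qed

text \<open>
  Since \<open>a\<close> commutes with the scalars, multiplication by \<open>a\<close> is linear, so its values on a spanning list
  decide where it maps the span.
\<close>
lemma (in ring) Span_mult_closedI:
  assumes "subfield K R" "a \<in> carrier R" "set Us \<subseteq> carrier R" "set Vs \<subseteq> carrier R"
    and comm: "\<And>c. c \<in> K \<Longrightarrow> a \<otimes> c = c \<otimes> a"
    and "\<And>u. u \<in> set Us \<Longrightarrow> a \<otimes> u \<in> Span K Vs"
    and "v \<in> Span K Us"
  shows "a \<otimes> v \<in> Span K Vs"
proof -
  let ?E = "{v \<in> carrier R. a \<otimes> v \<in> Span K Vs}"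
  have K: "K \<subseteq> carrier R" using subfieldE(3)[OF assms(1)] .
  have "linear_subspace R K ?E"
    unfolding linear_subspace_def
  proof (intro conjI ballI)
    fix c u assume c: "c \<in> K" and u: "u \<in> ?E"
    have "a \<otimes> (c \<otimes> u) = c \<otimes> (a \<otimes> u)"
      using c u K assms(2) comm[OF c] by (simp add: m_assoc[symmetric] subsetD)
    then show "c \<otimes> u \<in> ?E" using c u K Span_smult_closed[OF assms(1,4)] by auto
  qed (use assms Span_subgroup_props[OF assms(1,4)] in \<open>auto simp add: r_distr simp del: Span.simps\<close>)
  then have "Span K Us \<subseteq> ?E"
    using assms by (intro Span_minimal) (auto simp del: Span.simps)
  then show ?thesis using assms(7) by (auto simp del: Span.simps)
qed

text \<open>
  The elements that map \<open>E\<close> to itself form a subring. A subspace that is stable under ring generators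
  and contains \<open>\<one>\<close> is therefore the whole ring; this replaces all computations with monomials below.
\<close>
lemma (in ring) generate_ring_stabilizes:
  assumes "E \<subseteq> carrier R" "\<And>u v. u \<in> E \<Longrightarrow> v \<in> E \<Longrightarrow> u \<oplus> v \<in> E" "\<And>u. u \<in> E \<Longrightarrow> \<ominus> u \<in> E"
    and "H \<subseteq> carrier R" "\<And>h u. h \<in> H \<Longrightarrow> u \<in> E \<Longrightarrow> h \<otimes> u \<in> E"
    and "a \<in> generate_ring R H" "u \<in> E"
  shows "a \<otimes> u \<in> E"
  using assms(6,7)
proof (induction arbitrary: u)
  case one
  then show ?case using assms(1) by (simp add: subsetD)
next
  case (incl h)
  then show ?case using assms by auto
next
  case (a_inv h)
  then have "h \<in> carrier R" "u \<in> carrier R"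
    using assms(1) generate_ring_in_carrier[OF assms(4)] by auto
  then show ?case using a_inv assms(3)[of "h \<otimes> u"] by (simp add: l_minus)
next
  case (eng_add h1 h2)
  then have "h1 \<in> carrier R" "h2 \<in> carrier R" "u \<in> carrier R"
    using assms(1) generate_ring_in_carrier[OF assms(4)] by auto
  then show ?case using eng_add assms(2) by (simp add: l_distr)
next
  case (eng_mult h1 h2)
  then have "h1 \<in> carrier R" "h2 \<in> carrier R" "u \<in> carrier R"
    using assms(1) generate_ring_in_carrier[OF assms(4)] by auto
  then show ?case using eng_mult by (simp add: m_assoc)
qed

section \<open>Zariski's lemma\<close>

text \<open>
  For invertible \<open>s\<close> this is the localization \<open>B[1/s]\<close>, realized inside \<open>R\<close>.
\<close>
definition denominator_ring :: "('a, 'e) ring_scheme \<Rightarrow> 'a set \<Rightarrow> 'a \<Rightarrow> 'a set" where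
  "denominator_ring R B s = {t \<in> carrier R. \<exists>m::nat. s [^]\<^bsub>R\<^esub> m \<otimes>\<^bsub>R\<^esub> t \<in> B}"

lemma (in ring) subring_nat_pow_closed:
  assumes "subring B R" "s \<in> B"
  shows "s [^] (m::nat) \<in> B"
  using subringE[OF assms(1)] assms(2) by (induction m) auto

lemma (in cring) denominator_ring_subring:
  assumes B: "subring B R" and s: "s \<in> B"
  shows "subring (denominator_ring R B s) R" "B \<subseteq> denominator_ring R B s"
proof -
  note BE = subringE[OF B]
  have sR: "s \<in> carrier R" using BE(1) s by auto
  have pow: "s [^] (m::nat) \<in> B" for m using subring_nat_pow_closed[OF B s] .
  show incl: "B \<subseteq> denominator_ring R B s"
  proof
    fix b assume "b \<in> B"
    then have "b \<in> carrier R" "s [^] (0::nat) \<otimes> b \<in> B" using BE(1) by auto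
    then show "b \<in> denominator_ring R B s" unfolding denominator_ring_def by blast
  qed
  show "subring (denominator_ring R B s) R"
  proof (rule subringI)
    show "denominator_ring R B s \<subseteq> carrier R" unfolding denominator_ring_def by auto
    show "\<one> \<in> denominator_ring R B s" using incl BE(3) by auto
  next
    fix t assume "t \<in> denominator_ring R B s"
    then obtain m :: nat where t: "t \<in> carrier R" "s [^] m \<otimes> t \<in> B"
      unfolding denominator_ring_def by blast
    then have "s [^] m \<otimes> (\<ominus> t) \<in> B" using BE(5)[OF t(2)] sR by (simp add: r_minus)
    then show "\<ominus> t \<in> denominator_ring R B s" using t unfolding denominator_ring_def by blast
  next
    fix t t' assume "t \<in> denominator_ring R B s" "t' \<in> denominator_ring R B s"
    then obtain m n :: nat where t: "t \<in> carrier R" "s [^] m \<otimes> t \<in> B"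
      and t': "t' \<in> carrier R" "s [^] n \<otimes> t' \<in> B"
      unfolding denominator_ring_def by blast
    have c: "s [^] m \<in> carrier R" "s [^] n \<in> carrier R" using sR by auto
    have "s [^] (m + n) = s [^] m \<otimes> s [^] n" using sR by (simp add: nat_pow_mult)
    then have "s [^] (m + n) \<otimes> (t \<otimes> t') = (s [^] m \<otimes> t) \<otimes> (s [^] n \<otimes> t')"
      and "s [^] (m + n) \<otimes> (t \<oplus> t') = s [^] n \<otimes> (s [^] m \<otimes> t) \<oplus> s [^] m \<otimes> (s [^] n \<otimes> t')"
      using c t(1) t'(1) by algebra+
    moreover have "s [^] n \<otimes> (s [^] m \<otimes> t) \<in> B" "s [^] m \<otimes> (s [^] n \<otimes> t') \<in> B"
      using BE(6) pow t t' by auto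
    ultimately have "s [^] (m + n) \<otimes> (t \<otimes> t') \<in> B" "s [^] (m + n) \<otimes> (t \<oplus> t') \<in> B"
      using BE(6,7) t(2) t'(2) by simp_all
    then show "t \<otimes> t' \<in> denominator_ring R B s" "t \<oplus> t' \<in> denominator_ring R B s"
      using t(1) t'(1) unfolding denominator_ring_def by blast+
  qed
qed

lemma (in cring) denominator_ring_mono:
  assumes B: "subring B R" and s: "s \<in> B" "s' \<in> B"
  shows "denominator_ring R B s \<subseteq> denominator_ring R B (s \<otimes> s')"
proof
  note BE = subringE[OF B]
  fix t assume "t \<in> denominator_ring R B s"
  then obtain m :: nat where t: "t \<in> carrier R" "s [^] m \<otimes> t \<in> B"
    unfolding denominator_ring_def by blast
  have sR: "s \<in> carrier R" "s' \<in> carrier R" using BE(1) s by auto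
  then have "(s \<otimes> s') [^] m \<otimes> t = s' [^] m \<otimes> (s [^] m \<otimes> t)"
    using t(1) by (simp add: nat_pow_distrib m_ac)
  moreover have "s' [^] m \<otimes> (s [^] m \<otimes> t) \<in> B"
    using BE(6) subring_nat_pow_closed[OF B s(2)] t(2) by blast
  ultimately show "t \<in> denominator_ring R B (s \<otimes> s')"
    using t(1) unfolding denominator_ring_def by (auto intro: exI[of _ m])
qed

text \<open>
  The only operation that needs a new denominator is inversion: if \<open>s\<^sup>m h = b\<close> lies in \<open>B\<close>, then
  \<open>b h\<^sup>-\<^sup>1 = s\<^sup>m\<close> does, so \<open>b\<close> is a denominator of \<open>h\<^sup>-\<^sup>1\<close>.
\<close>
lemma (in field) generate_field_denominator:
  assumes B: "subring B R" and H: "H \<subseteq> B" and f: "f \<in> generate_field R H"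
  shows "\<exists>s\<in>B - {\<zero>}. f \<in> denominator_ring R B s"
  using f
proof induction
  note BE = subringE[OF B]
  have sub: "B \<subseteq> denominator_ring R B \<one>" using denominator_ring_subring(2)[OF B BE(3)] .
  {
    case one
    then show ?case using sub BE(3) one_not_zero by (intro bexI[of _ \<one>]) auto
  next
    case (incl h)
    then show ?case using sub H BE(3) one_not_zero by (intro bexI[of _ \<one>]) auto
  next
    case (a_inv h)
    then show ?case using subringE(5)[OF denominator_ring_subring(1)[OF B]] by blast
  next
    case (m_inv h)
    then obtain s where s: "s \<in> B" "s \<noteq> \<zero>" "h \<in> denominator_ring R B s" by blast
    then obtain m :: nat where h: "h \<in> carrier R" "s [^] m \<otimes> h \<in> B"
      unfolding denominator_ring_def by blast
    have sR: "s \<in> carrier R" using BE(1) s by auto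
    have hU: "h \<in> Units R" using h(1) m_inv(2) field_Units by simp
    have "s [^] m \<noteq> \<zero>"
      using s(2) sR Units_pow_closed[of s m] field_Units by auto
    then have nz: "s [^] m \<otimes> h \<noteq> \<zero>" using integral[of "s [^] m" h] sR h(1) m_inv(2) by auto
    have "(s [^] m \<otimes> h) [^] (1::nat) \<otimes> inv h = s [^] m"
      using sR h(1) hU by (simp add: m_assoc)
    then have "(s [^] m \<otimes> h) [^] (1::nat) \<otimes> inv h \<in> B"
      using subring_nat_pow_closed[OF B s(1)] by simp
    then have "inv h \<in> denominator_ring R B (s [^] m \<otimes> h)"
      using hU unfolding denominator_ring_def by blast
    then show ?case using h(2) nz by blast
  next
    case (eng_add h1 h2)
    then obtain s s' where s: "s \<in> B" "s \<noteq> \<zero>" "h1 \<in> denominator_ring R B s"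
      and s': "s' \<in> B" "s' \<noteq> \<zero>" "h2 \<in> denominator_ring R B s'" by blast
    have "s \<in> carrier R" "s' \<in> carrier R" using BE(1) s s' by auto
    then have "h1 \<in> denominator_ring R B (s \<otimes> s')" "h2 \<in> denominator_ring R B (s \<otimes> s')"
      "s \<otimes> s' \<noteq> \<zero>" "s \<otimes> s' \<in> B"
      using denominator_ring_mono[OF B s(1) s'(1)] denominator_ring_mono[OF B s'(1) s(1)] s s'
        integral[of s s'] BE(6) by (auto simp: m_comm)
    then show ?case using subringE(7)[OF denominator_ring_subring(1)[OF B]] by blast
  next
    case (eng_mult h1 h2)
    then obtain s s' where s: "s \<in> B" "s \<noteq> \<zero>" "h1 \<in> denominator_ring R B s"
      and s': "s' \<in> B" "s' \<noteq> \<zero>" "h2 \<in> denominator_ring R B s'" by blast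
    have "s \<in> carrier R" "s' \<in> carrier R" using BE(1) s s' by auto
    then have "h1 \<in> denominator_ring R B (s \<otimes> s')" "h2 \<in> denominator_ring R B (s \<otimes> s')"
      "s \<otimes> s' \<noteq> \<zero>" "s \<otimes> s' \<in> B"
      using denominator_ring_mono[OF B s(1) s'(1)] denominator_ring_mono[OF B s'(1) s(1)] s s'
        integral[of s s'] BE(6) by (auto simp: m_comm)
    then show ?case using subringE(6)[OF denominator_ring_subring(1)[OF B]] by blast
  }
qed

lemma (in field) common_denominator:
  assumes B: "subring B R" and H: "H \<subseteq> B" and "finite C" "C \<subseteq> generate_field R H"
  shows "\<exists>s\<in>B - {\<zero>}. C \<subseteq> denominator_ring R B s"
  using assms(3,4)
proof (induction C)
  case empty
  then show ?case using subringE(3)[OF B] one_not_zero by blast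
next
  case (insert f C)
  then obtain s where s: "s \<in> B" "s \<noteq> \<zero>" "C \<subseteq> denominator_ring R B s" by auto
  obtain s' where s': "s' \<in> B" "s' \<noteq> \<zero>" "f \<in> denominator_ring R B s'"
    using generate_field_denominator[OF B H, of f] insert.prems by auto
  have "s \<in> carrier R" "s' \<in> carrier R" using subringE(1)[OF B] s s' by auto
  then have "C \<subseteq> denominator_ring R B (s \<otimes> s')" "f \<in> denominator_ring R B (s \<otimes> s')"
      "s \<otimes> s' \<noteq> \<zero>" "s \<otimes> s' \<in> B"
    using denominator_ring_mono[OF B s(1) s'(1)] denominator_ring_mono[OF B s'(1) s(1)] s s'
      integral[of s s'] subringE(6)[OF B] by (auto simp: m_comm)
  then show ?case by blast
qed

text \<open>
  Let \<open>Es\<close> be a basis of the ring over the field \<open>F\<close> generated by \<open>H\<close>. The coordinates of the products of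
  the finitely many generators with the basis vectors have a common denominator \<open>s\<close>, so the
  \<open>B[1/s]\<close>-combinations of \<open>Es\<close> are stable under all generators and hence under all of \<open>F\<close>. Multiplying a
  single basis vector by \<open>h \<in> F\<close> shows that the coordinate \<open>h\<close> lies in \<open>B[1/s]\<close>.
\<close>
lemma (in field) field_in_denominator_ring:
  assumes B: "subring B R" and H: "H \<subseteq> B" "B \<subseteq> generate_field R H" and HR: "H \<subseteq> carrier R"
    and fin: "finite_dimension (generate_field R H) (carrier R)"
    and G: "finite G" "G \<subseteq> carrier R" "generate_ring R (B \<union> G) = carrier R"
  shows "\<exists>s\<in>B - {\<zero>}. generate_field R H \<subseteq> denominator_ring R B s"
proof -
  define F where "F = generate_field R H"
  have F: "subfield F R" unfolding F_def using generate_field_is_subfield[OF HR] .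
  have FR: "F \<subseteq> carrier R" using subfieldE(3)[OF F] .
  note BE = subringE[OF B]
  obtain n where "dimension n F (carrier R)"
    using fin unfolding F_def finite_dimension_def by blast
  then obtain Es where Es: "set Es \<subseteq> carrier R" "independent F Es" "Span F Es = carrier R"
    using exists_base[OF F] by blast
  have "\<exists>cs. set cs \<subseteq> F \<and> length cs = length Es \<and> a = combine cs Es" if "a \<in> carrier R" for a
    using Span_mem_iff_length_version[OF F Es(1)] Es(3) that by auto
  then obtain coord where coord: "\<And>a. a \<in> carrier R \<Longrightarrow>
      set (coord a) \<subseteq> F \<and> length (coord a) = length Es \<and> a = combine (coord a) Es"
    by metis
  define C where "C = (\<Union>g\<in>G. \<Union>e\<in>set Es. set (coord (g \<otimes> e)))"
  have "finite C" unfolding C_def using G(1) by auto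
  have "C \<subseteq> F"
  proof
    fix c assume "c \<in> C"
    then obtain g e where ge: "g \<in> G" "e \<in> set Es" "c \<in> set (coord (g \<otimes> e))"
      unfolding C_def by blast
    then have "g \<otimes> e \<in> carrier R" using G(2) Es(1) by blast
    from coord[OF this] show "c \<in> F" using ge(3) by blast
  qed
  then obtain s where s: "s \<in> B" "s \<noteq> \<zero>" "C \<subseteq> denominator_ring R B s"
    using common_denominator[OF B H(1) \<open>finite C\<close>] unfolding F_def by blast
  define T where "T = denominator_ring R B s"
  have T: "subring T R" "B \<subseteq> T" using denominator_ring_subring[OF B s(1)] unfolding T_def by auto
  note TE = subringE[OF T(1)]
  have TF: "T \<subseteq> F"
  proof
    fix t assume "t \<in> T"
    then obtain m :: nat where t: "t \<in> carrier R" "s [^] m \<otimes> t \<in> B"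
      unfolding T_def denominator_ring_def by blast
    have sR: "s \<in> carrier R" using BE(1) s by auto
    have "s [^] m \<noteq> \<zero>" using s(2) sR Units_pow_closed[of s m] field_Units by auto
    then have "s [^] m \<in> F - {\<zero>}"
      using subring_nat_pow_closed[OF B s(1)] H(2) unfolding F_def by auto
    then show "t \<in> F" using subfield_m_inv_simprule[OF F] t H(2) unfolding F_def by blast
  qed
  (* The B[1/s]-lattice spanned by the basis. *)
  define M where "M = {combine ts Es | ts. set ts \<subseteq> T \<and> length ts = length Es}"
  have MR: "M \<subseteq> carrier R" unfolding M_def using TE(1) Es(1) by auto
  have M_add: "u \<oplus> v \<in> M" if uv: "u \<in> M" "v \<in> M" for u v
  proof -
    obtain ts where ts: "set ts \<subseteq> T" "length ts = length Es" "u = combine ts Es"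
      using uv(1) unfolding M_def by blast
    obtain ts' where ts': "set ts' \<subseteq> T" "length ts' = length Es" "v = combine ts' Es"
      using uv(2) unfolding M_def by blast
    have "u \<oplus> v = combine (map2 (\<oplus>) ts ts') Es"
      using combine_add[of ts Es ts'] ts ts' TE(1) Es(1) by auto
    moreover have "set (map2 (\<oplus>) ts ts') \<subseteq> T"
    proof
      fix c assume "c \<in> set (map2 (\<oplus>) ts ts')"
      then obtain a b where "(a, b) \<in> set (zip ts ts')" "c = a \<oplus> b" by auto
      moreover from this have "a \<in> set ts" "b \<in> set ts'"
        using set_zip_leftD set_zip_rightD by fast+
      ultimately show "c \<in> T" using ts(1) ts'(1) TE(7) by blast
    qed
    ultimately show ?thesis using ts ts' unfolding M_def by (auto intro!: exI[of _ "map2 (\<oplus>) ts ts'"])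
  qed
  have M_smult: "t \<otimes> u \<in> M" if tu: "t \<in> T" "u \<in> M" for t u
  proof -
    obtain ts where ts: "set ts \<subseteq> T" "length ts = length Es" "u = combine ts Es"
      using tu(2) unfolding M_def by blast
    have "t \<otimes> u = combine (map ((\<otimes>) t) ts) Es"
      using combine_r_distr[of ts Es t] ts TE(1) Es(1) tu(1) by auto
    moreover have "set (map ((\<otimes>) t) ts) \<subseteq> T" using ts(1) tu(1) TE(6) by auto
    ultimately show ?thesis using ts unfolding M_def by (auto intro!: exI[of _ "map ((\<otimes>) t) ts"])
  qed
  have M_zero: "\<zero> \<in> M"
    unfolding M_def mem_Collect_eq using combine_replicate[OF Es(1)] TE(2)
    by (intro exI[of _ "replicate (length Es) \<zero>"]) (simp add: set_replicate_conv_if)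
  have M_neg: "\<ominus> u \<in> M" if "u \<in> M" for u
  proof -
    have "u \<in> carrier R" using MR that by auto
    then have "\<ominus> u = (\<ominus> \<one>) \<otimes> u" by (simp add: l_minus)
    then show ?thesis using M_smult[OF TE(5)[OF TE(3)] that] by simp
  qed
  have GM: "g \<otimes> u \<in> M" if g: "g \<in> G" and u: "u \<in> M" for g u
  proof -
    have gR: "g \<in> carrier R" using g G(2) by auto
    have ge: "g \<otimes> e \<in> M" if "e \<in> set Es" for e
    proof -
      have "g \<otimes> e \<in> carrier R" using that gR Es(1) by auto
      moreover have "set (coord (g \<otimes> e)) \<subseteq> T" using that g s(3) unfolding C_def T_def by blast
      ultimately show ?thesis using coord[of "g \<otimes> e"] unfolding M_def by blast
    qed
    have "g \<otimes> combine ts Us \<in> M" if "set ts \<subseteq> T" "set Us \<subseteq> set Es" for ts Us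
      using that
    proof (induction ts Us rule: combine.induct)
      case (1 k Ks u Us)
      have R: "k \<in> carrier R" "u \<in> carrier R" "combine Ks Us \<in> carrier R"
        using 1 TE(1) Es(1) by (auto intro!: combine_in_carrier)
      have "g \<otimes> combine (k # Ks) (u # Us) = k \<otimes> (g \<otimes> u) \<oplus> g \<otimes> combine Ks Us"
        using R gR by (simp add: r_distr m_lcomm)
      then show ?case using 1 M_add M_smult ge by simp
    qed (use M_zero gR in auto)
    then show ?thesis using u unfolding M_def by blast
  qed
  have "Es \<noteq> []"
  proof
    assume "Es = []"
    then have "carrier R = {\<zero>}" using Es(3) by simp
    then show False using one_closed one_not_zero by auto
  qed
  then obtain e Es' where E: "Es = e # Es'" by (cases Es) auto
  have e_coord: "combine (h # replicate (length Es') \<zero>) Es = h \<otimes> e" if "h \<in> carrier R" for h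
    using combine_replicate[of Es'] Es(1) that unfolding E by simp
  have "\<one> \<otimes> e \<in> M"
    unfolding M_def mem_Collect_eq using e_coord[of \<one>] TE(2,3) E
    by (intro exI[of _ "\<one> # replicate (length Es') \<zero>"]) (simp add: set_replicate_conv_if del: combine.simps)
  then have eM: "e \<in> M" using Es(1) E by simp
  have "F \<subseteq> T"
  proof
    fix h assume h: "h \<in> F"
    have hR: "h \<in> carrier R" using h FR by auto
    have "h \<otimes> e \<in> M"
    proof (rule generate_ring_stabilizes[OF MR M_add M_neg _ _ _ eM])
      show "B \<union> G \<subseteq> carrier R" using BE(1) G(2) by simp
      show "h \<in> generate_ring R (B \<union> G)" using hR G(3) by simp
      show "x \<otimes> u \<in> M" if "x \<in> B \<union> G" "u \<in> M" for x u
        using that GM M_smult T(2) by auto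
    qed
    then obtain ts where ts: "set ts \<subseteq> T" "length ts = length Es" "h \<otimes> e = combine ts Es"
      unfolding M_def by blast
    have h0: "set (h # replicate (length Es') \<zero>) \<subseteq> F"
      using h subringE(2)[OF subfieldE(1)[OF F]] by (auto simp: set_replicate_conv_if)
    have "h \<otimes> e \<in> Span F Es" using Es(3) hR Es(1) E by simp
    from unique_decomposition[OF F Es(2) this]
    have "ts = h # replicate (length Es') \<zero>"
      using ts(1) subset_trans[OF ts(1) TF] ts(2,3) h0 e_coord[OF hR] E by (auto simp del: combine.simps Span.simps)
    then show "h \<in> T" using ts(1) by simp
  qed
  then show ?thesis using s(1,2) unfolding F_def T_def by blast
qed

text \<open>
  In \<open>K[x]\<close> the element \<open>g = s x + 1\<close> is prime to \<open>s\<close>. If its inverse had a power of \<open>s\<close> as denominator, then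
  \<open>g\<close> would divide a power of \<open>s\<close> and thus be a unit of \<open>K[x]\<close>. But as a polynomial it has positive degree.
\<close>
lemma (in field) transcendental_no_common_denominator:
  assumes K: "subfield K R" and x: "x \<in> carrier R" "(transcendental over K) x"
    and s: "s \<in> simple_extension K x" "s \<noteq> \<zero>"
  shows "\<not> generate_field R (insert x K) \<subseteq> denominator_ring R (simple_extension K x) s"
proof
  assume sub: "generate_field R (insert x K) \<subseteq> denominator_ring R (simple_extension K x) s"
  define B where "B = simple_extension K x"
  have Ksr: "subring K R" using subfieldE(1)[OF K] .
  have KR: "K \<subseteq> carrier R" using subfieldE(3)[OF K] .
  have B: "subring B R" unfolding B_def using simple_extension_is_subring[OF Ksr x(1)] .
  note BE = subringE[OF B]
  have Beval: "B = (\<lambda>p. eval p x) ` carrier (K[X])"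
    unfolding B_def using simple_extension_as_eval_img[OF KR x(1)] .
  have xB: "x \<in> B" unfolding B_def using simple_extension_mem[OF Ksr x(1)] .
  have KB: "K \<subseteq> B" unfolding B_def using simple_extension_incl[OF KR x(1)] .
  have sB: "s \<in> B" using s(1) unfolding B_def .
  have sR: "s \<in> carrier R" using sB BE(1) by auto
  obtain p where p: "p \<in> carrier (K[X])" "s = eval p x" using sB Beval by blast
  have pK: "set p \<subseteq> K" using p(1) polynomial_incl unfolding univ_poly_carrier[symmetric] by auto
  have pne: "p \<noteq> []" using s(2) p(2) by auto
  define g where "g = s \<otimes> x \<oplus> \<one>"
  have g_eval: "g = eval (p @ [\<one>]) x"
    unfolding g_def p(2) using eval_append_aux[of p \<one> x] pK KR x(1) by auto
  have pp: "p @ [\<one>] \<in> carrier (K[X])"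
    using p(1) pK pne subringE(3)[OF Ksr] unfolding univ_poly_carrier[symmetric] polynomial_def
    by (auto simp: hd_append)
  have gB: "g \<in> B" unfolding g_def using BE(3,6,7) sB xB by auto
  have gR: "g \<in> carrier R" using gB BE(1) by auto
  have g0: "g \<noteq> \<zero>"
    using eval_transcendental[OF x(2) pp] g_eval by auto
  have H: "insert x K \<subseteq> carrier R" using x(1) KR by simp
  have "x \<in> generate_field R (insert x K)" "K \<subseteq> generate_field R (insert x K)"
    by (auto intro: generate_field.incl)
  then have BF: "B \<subseteq> generate_field R (insert x K)"
    unfolding B_def
    by (intro simple_extension_subring_incl[OF subfieldE(1)[OF generate_field_is_subfield[OF H]]])
  have "inv g \<in> generate_field R (insert x K)"
    using generate_field.m_inv[OF subsetD[OF BF gB] g0] .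
  then have "inv g \<in> denominator_ring R B s"
    unfolding B_def by (rule subsetD[OF sub])
  then obtain m :: nat where m: "s [^] m \<otimes> inv g \<in> B" "inv g \<in> carrier R"
    unfolding denominator_ring_def by blast
  have gU: "g \<in> Units R" using gR g0 field_Units by simp
  have "g \<otimes> (s [^] m \<otimes> inv g) = s [^] m"
    using gU gR sR m_lcomm[of g "s [^] m" "inv g"] by simp
  then have ex: "\<exists>a\<in>B. g \<otimes> a = s [^] m" using m(1) by blast
  (* Since s x = g - 1, an equation g a = s^(k+1) yields g (s^k - x a) = s^k. *)
  have desc: "\<exists>b\<in>B. g \<otimes> b = \<one>" if "a \<in> B" "g \<otimes> a = s [^] k" for a and k :: nat
    using that
  proof (induction k arbitrary: a)
    case 0
    then show ?case by auto
  next
    case (Suc k)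
    have aR: "a \<in> carrier R" using Suc.prems(1) BE(1) by auto
    have skB: "s [^] k \<in> B" using subring_nat_pow_closed[OF B sB] .
    have skR: "s [^] k \<in> carrier R" using sR by simp
    have ga: "g \<otimes> a = s [^] k \<otimes> s" using Suc.prems(2) by simp
    have "g \<otimes> (s [^] k \<ominus> x \<otimes> a) = g \<otimes> s [^] k \<ominus> x \<otimes> (g \<otimes> a)"
      using gR skR x(1) aR by algebra
    also have "\<dots> = (s \<otimes> x) \<otimes> s [^] k \<oplus> s [^] k \<ominus> (s \<otimes> x) \<otimes> s [^] k"
    proof -
      have "g \<otimes> s [^] k = (s \<otimes> x) \<otimes> s [^] k \<oplus> s [^] k"
        unfolding g_def using sR skR x(1) by (simp add: l_distr)
      moreover have "x \<otimes> (s [^] k \<otimes> s) = (s \<otimes> x) \<otimes> s [^] k"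
        using sR skR x(1) by (simp add: m_ac)
      ultimately show ?thesis unfolding ga by simp
    qed
    also have "\<dots> = s [^] k"
    proof -
      have "c \<oplus> d \<ominus> c = d" if "c \<in> carrier R" "d \<in> carrier R" for c d
        using that by algebra
      then show ?thesis using sR skR x(1) by simp
    qed
    finally have "g \<otimes> (s [^] k \<ominus> x \<otimes> a) = s [^] k" .
    moreover have "s [^] k \<ominus> x \<otimes> a \<in> B"
      unfolding minus_eq using skB xB Suc.prems(1) BE(5,6,7) by blast
    ultimately show ?case using Suc.IH by blast
  qed
  obtain b where b: "b \<in> B" "g \<otimes> b = \<one>" using ex desc by blast
  obtain q where q: "q \<in> carrier (K[X])" "b = eval q x" using b(1) Beval by blast
  interpret UP: domain "K[X]" using univ_poly_is_domain[OF Ksr] .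
  interpret ev: ring_hom_ring "K[X]" R "\<lambda>p. eval p x" using eval_ring_hom[OF Ksr x(1)] .
  have "eval ((p @ [\<one>]) \<otimes>\<^bsub>K[X]\<^esub> q) x = eval \<one>\<^bsub>K[X]\<^esub> x"
    using ev.hom_mult[OF pp q(1)] ev.hom_one b(2) unfolding g_eval q(2) by simp
  then have "(p @ [\<one>]) \<otimes>\<^bsub>K[X]\<^esub> q = \<one>\<^bsub>K[X]\<^esub>"
    using inj_onD[OF x(2)[unfolded over_def transcendental_def]] pp q(1) UP.m_closed UP.one_closed
    by blast
  then have "p @ [\<one>] \<in> Units (K[X])"
    using pp q(1) UP.m_comm[OF pp q(1)] unfolding Units_def by auto
  then show False using univ_poly_units[OF K] pne by auto
qed

text \<open>
  By induction on the number of generators the ring is finite over the field generated by \<open>K\<close> and one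
  generator \<open>x\<close>. If \<open>x\<close> is algebraic, the tower law finishes the proof. If \<open>x\<close> is transcendental, all rational
  functions in \<open>x\<close> have a common denominator, which is absurd.
\<close>
theorem (in field) zariski_lemma:
  assumes "subfield K R" "finite G" "G \<subseteq> carrier R" "generate_ring R (K \<union> G) = carrier R"
  shows "finite_dimension K (carrier R)"
  using assms(2,1,3,4)
proof (induction G arbitrary: K)
  case empty
  have "generate_ring R K \<subseteq> K"
    using generate_ring_min_subring1[OF subfieldE(3) subfieldE(1)] empty.prems(1) by blast
  then have "K = carrier R" using empty.prems(3) subfieldE(3)[OF empty.prems(1)] by simp
  then show ?case
    using dimension_one[OF empty.prems(1)] unfolding finite_dimension_def by auto
next
  case (insert x G)
  note K = insert.prems(1)
  have Ksr: "subring K R" using subfieldE(1)[OF K] .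
  have KR: "K \<subseteq> carrier R" using subfieldE(3)[OF K] .
  have x: "x \<in> carrier R" and G: "G \<subseteq> carrier R" using insert.prems(2) by auto
  define F where "F = generate_field R (insert x K)"
  have H: "insert x K \<subseteq> carrier R" using x KR by simp
  have F: "subfield F R" unfolding F_def using generate_field_is_subfield[OF H] .
  have FR: "F \<subseteq> carrier R" using subfieldE(3)[OF F] .
  have xKF: "insert x K \<subseteq> F" unfolding F_def by (auto intro: generate_field.incl)
  have genF: "generate_ring R (F \<union> G) = carrier R"
  proof
    show "generate_ring R (F \<union> G) \<subseteq> carrier R" using generate_ring_incl FR G by simp
    have "K \<union> insert x G \<subseteq> F \<union> G" using xKF by auto
    then have "generate_ring R (K \<union> insert x G) \<subseteq> generate_ring R (F \<union> G)"
      using mono_generate_ring[of "K \<union> insert x G" "F \<union> G"] FR G by simp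
    then show "carrier R \<subseteq> generate_ring R (F \<union> G)" using insert.prems(3) by simp
  qed
  have finF: "finite_dimension F (carrier R)" using insert.IH[OF F G genF] .
  define B where "B = simple_extension K x"
  have B: "subring B R" unfolding B_def using simple_extension_is_subring[OF Ksr x] .
  have HB: "insert x K \<subseteq> B"
    unfolding B_def using simple_extension_mem[OF Ksr x] simple_extension_incl[OF KR x] by blast
  have BF: "B \<subseteq> F"
    unfolding B_def using simple_extension_subring_incl[OF subfieldE(1)[OF F]] xKF by blast
  show ?case
  proof (cases "(algebraic over K) x")
    case True
    then have "subfield B R" unfolding B_def using simple_extension_is_subfield[OF K x] by simp
    then have "F \<subseteq> B" unfolding F_def using generate_field_min_subfield1[OF H] HB by blast
    then have "F = B" using BF by simp
    moreover have "finite_dimension K B"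
      unfolding B_def using finite_dimension_simple_extension[OF K x] True by simp
    ultimately have "finite_dimension K F" by simp
    then show ?thesis
      using finF telescopic_base[OF K F] unfolding finite_dimension_def by blast
  next
    case False
    then have tr: "(transcendental over K) x" unfolding over_def by simp
    have "K \<union> insert x G \<subseteq> B \<union> G" using HB by auto
    then have "generate_ring R (B \<union> G) = carrier R"
      using mono_generate_ring[of "K \<union> insert x G" "B \<union> G"] insert.prems(3)
        generate_ring_incl[of "B \<union> G"] G subringE(1)[OF B] by auto
    then obtain s where "s \<in> B - {\<zero>}" "F \<subseteq> denominator_ring R B s"
      using field_in_denominator_ring[OF B HB _ H _ insert.hyps(1) G] BF finF
      unfolding F_def by blast
    then show ?thesis
      using transcendental_no_common_denominator[OF K x tr] unfolding F_def B_def by blast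
  qed
qed

section \<open>Finitely generated algebras of units and nilpotent elements\<close>

text \<open>
  The span of all monomials in the given elements. It has finite dimension because the exponents are
  bounded; the monomials are built by adding one nilpotent element \<open>x\<close> at a time, with its powers below \<open>d\<close>.
\<close>
lemma (in cring) nilpotents_stabilize_finite_Span:
  assumes "subfield K R" "finite N" "N \<subseteq> carrier R" "\<And>x. x \<in> N \<Longrightarrow> \<exists>d::nat. x [^] d = \<zero>"
  shows "\<exists>Ws. set Ws \<subseteq> carrier R \<and> \<one> \<in> Span K Ws \<and> (\<forall>x\<in>N. \<forall>w\<in>Span K Ws. x \<otimes> w \<in> Span K Ws)"
  using assms(2-4)
proof (induction N)
  case empty
  have "\<one> \<in> Span K [\<one>]" using Span_base_incl[OF assms(1), of "[\<one>]"] by simp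
  then show ?case by (intro exI[of _ "[\<one>]"]) simp
next
  case (insert x N)
  then obtain Ws where Ws: "set Ws \<subseteq> carrier R" "\<one> \<in> Span K Ws"
      "\<And>y w. y \<in> N \<Longrightarrow> w \<in> Span K Ws \<Longrightarrow> y \<otimes> w \<in> Span K Ws"
    by auto
  obtain d :: nat where d: "x [^] d = \<zero>" using insert.prems by blast
  have x: "x \<in> carrier R" using insert.prems by simp
  have KR: "K \<subseteq> carrier R" using subfieldE(3)[OF assms(1)] .
  have "\<one> \<noteq> \<zero>" using subfieldE(6)[OF assms(1)] .
  then have d0: "0 < d" using d by (cases d) auto
  define Vs where "Vs = concat (map (\<lambda>i. map (\<lambda>w. x [^] i \<otimes> w) Ws) [0..<d])"
  have Vs: "set Vs = {x [^] i \<otimes> w | i w. i < d \<and> w \<in> set Ws}"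
    unfolding Vs_def by (auto simp: image_iff) blast
  have Vs_carr: "set Vs \<subseteq> carrier R" unfolding Vs using Ws(1) x by auto
  note Vs_base = Span_base_incl[OF assms(1) Vs_carr]
  have pow: "x [^] i \<otimes> w \<in> Span K Vs" if "w \<in> Span K Ws" "i < d" for i w
  proof (rule Span_mult_closedI[OF assms(1) _ Ws(1) Vs_carr _ _ that(1)])
    show "x [^] i \<in> carrier R" using x by simp
    show "x [^] i \<otimes> c = c \<otimes> x [^] i" if "c \<in> K" for c
      using that KR x by (intro m_comm) auto
    show "x [^] i \<otimes> u \<in> Span K Vs" if "u \<in> set Ws" for u
      using that \<open>i < d\<close> Vs Vs_base by blast
  qed
  have "y \<otimes> w \<in> Span K Vs" if y: "y \<in> insert x N" and w: "w \<in> Span K Vs" for y w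
  proof (rule Span_mult_closedI[OF assms(1) _ Vs_carr Vs_carr _ _ w])
    show yR: "y \<in> carrier R" using y insert.prems by auto
    show "y \<otimes> c = c \<otimes> y" if "c \<in> K" for c
      using that KR yR by (intro m_comm) auto
    fix u assume "u \<in> set Vs"
    then obtain i w where u: "u = x [^] i \<otimes> w" "i < d" "w \<in> set Ws" unfolding Vs by blast
    have wR: "w \<in> carrier R" and wS: "w \<in> Span K Ws"
      using u(3) Ws(1) Span_base_incl[OF assms(1) Ws(1)] by auto
    show "y \<otimes> u \<in> Span K Vs"
    proof (cases "y = x")
      case True
      have eq: "y \<otimes> u = x [^] Suc i \<otimes> w"
        unfolding u True using x wR by (simp add: m_assoc[symmetric] m_comm)
      show ?thesis
      proof (cases "Suc i < d")
        case True
        then show ?thesis unfolding eq using pow[OF wS] by blast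
      next
        case False
        then have "Suc i = d" using u(2) by simp
        then have "y \<otimes> u = \<zero>" using eq d wR by simp
        then show ?thesis using Span_subgroup_props(2)[OF assms(1) Vs_carr] by simp
      qed
    next
      case False
      then have "y \<otimes> w \<in> Span K Ws" using y Ws(3) wS by auto
      then have "x [^] i \<otimes> (y \<otimes> w) \<in> Span K Vs" using pow u(2) by blast
      moreover have "y \<otimes> u = x [^] i \<otimes> (y \<otimes> w)"
        unfolding u(1) using x yR wR by (simp add: m_lcomm)
      ultimately show ?thesis by simp
    qed
  qed
  moreover have "\<one> \<in> Span K Vs" using pow[OF Ws(2) d0] by simp
  ultimately show ?case using Vs_carr by blast
qed

text \<open>
  Let \<open>Us\<close> be elements whose images span \<open>Q\<close>. Each product of a generator with an element of
  \<open>\<one> # Us\<close> is a combination of \<open>Us\<close> up to an error that is nilpotent. There are finitely many errors, so they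
  stabilize the span of a list \<open>Ws\<close>. The products of \<open>\<one> # Us\<close> with \<open>Ws\<close> then span a space that contains
  \<open>\<one>\<close> and is stable under the generators, hence everything.
\<close>
lemma (in cring) finite_dim_of_nil_reduction:
  assumes K: "subfield K R" and G: "finite G" "G \<subseteq> carrier R"
    and gen: "generate_ring R (K \<union> G) = carrier R"
    and h: "ring_hom_ring R Q h"
    and nil: "\<And>a. a \<in> carrier R \<Longrightarrow> h a = \<zero>\<^bsub>Q\<^esub> \<Longrightarrow> \<exists>d::nat. a [^] d = \<zero>"
    and Us: "set Us \<subseteq> carrier R" "h ` carrier R \<subseteq> ring.Span Q (h ` K) (map h Us)"
  shows "\<exists>Vs. set Vs \<subseteq> carrier R \<and> Span K Vs = carrier R"
proof -
  interpret h: ring_hom_ring R Q h by fact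
  have KR: "K \<subseteq> carrier R" using subfieldE(3)[OF K] .
  have lift: "\<exists>w\<in>Span K Us. \<exists>n\<in>carrier R. a = w \<oplus> n \<and> h n = \<zero>\<^bsub>Q\<^esub>" if a: "a \<in> carrier R" for a
  proof -
    have "h a \<in> h ` Span K Us" using Us(2) a h.Span_hom[OF KR Us(1)] by auto
    then obtain w where w: "w \<in> Span K Us" "h a = h w" by blast
    then have wR: "w \<in> carrier R" using Span_subgroup_props(1)[OF K Us(1)] by blast
    have "a = w \<oplus> (a \<ominus> w)" using a wR by algebra
    moreover have "h (a \<ominus> w) = \<zero>\<^bsub>Q\<^esub>"
      using a wR w by (simp add: minus_eq h.hom_a_inv h.S.r_neg)
    ultimately show ?thesis using w(1) a wR by (intro bexI[of _ w] bexI[of _ "a \<ominus> w"]) auto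
  qed
  define err where "err p = (SOME n. n \<in> carrier R \<and> h n = \<zero>\<^bsub>Q\<^esub> \<and> (\<exists>w\<in>Span K Us. p = w \<oplus> n))" for p
  have err: "err p \<in> carrier R \<and> h (err p) = \<zero>\<^bsub>Q\<^esub> \<and> (\<exists>w\<in>Span K Us. p = w \<oplus> err p)"
    if "p \<in> carrier R" for p
    unfolding err_def by (rule someI_ex) (use lift[OF that] in blast)
  define P where "P = (\<lambda>(g, u). g \<otimes> u) ` (G \<times> set (\<one> # Us))"
  have P: "finite P" "P \<subseteq> carrier R" using G Us(1) unfolding P_def by auto
  define N where "N = err ` P"
  have N: "finite N" "N \<subseteq> carrier R" "\<And>x. x \<in> N \<Longrightarrow> \<exists>d::nat. x [^] d = \<zero>"
    using P err nil unfolding N_def by blast+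
  obtain Ws where Ws: "set Ws \<subseteq> carrier R" "\<one> \<in> Span K Ws"
      "\<And>x w. x \<in> N \<Longrightarrow> w \<in> Span K Ws \<Longrightarrow> x \<otimes> w \<in> Span K Ws"
    using nilpotents_stabilize_finite_Span[OF K N] by blast
  have WsR: "Span K Ws \<subseteq> carrier R" using Span_subgroup_props(1)[OF K Ws(1)] .
  define Vs where "Vs = concat (map (\<lambda>u. map (\<lambda>w. u \<otimes> w) Ws) (\<one> # Us))"
  have Vs: "set Vs = {u \<otimes> w | u w. u \<in> set (\<one> # Us) \<and> w \<in> set Ws}"
    unfolding Vs_def by (auto simp: image_iff)
  have VsR: "set Vs \<subseteq> carrier R" unfolding Vs using Us(1) Ws(1) by auto
  note V = Span_subgroup_props[OF K VsR]
  have comm: "a \<otimes> c = c \<otimes> a" if "c \<in> K" "a \<in> carrier R" for a c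
    using that KR by (intro m_comm) auto
  have uw: "u \<otimes> w \<in> Span K Vs" if u: "u \<in> set (\<one> # Us)" and w: "w \<in> Span K Ws" for u w
  proof (rule Span_mult_closedI[OF K _ Ws(1) VsR _ _ w])
    show uR: "u \<in> carrier R" using u Us(1) by auto
    show "u \<otimes> c = c \<otimes> u" if "c \<in> K" for c using comm that uR .
    show "u \<otimes> w \<in> Span K Vs" if "w \<in> set Ws" for w
      using Span_base_incl[OF K VsR] Vs u that by blast
  qed
  have sw: "s \<otimes> w \<in> Span K Vs" if s: "s \<in> Span K Us" and w: "w \<in> Span K Ws" for s w
  proof -
    have wR: "w \<in> carrier R" using w WsR by auto
    have sR: "s \<in> carrier R" using s Span_subgroup_props(1)[OF K Us(1)] by auto
    have "w \<otimes> s \<in> Span K Vs"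
    proof (rule Span_mult_closedI[OF K wR Us(1) VsR _ _ s])
      show "w \<otimes> c = c \<otimes> w" if "c \<in> K" for c using comm that wR .
      show "w \<otimes> u \<in> Span K Vs" if "u \<in> set Us" for u
        using uw[of u w] that w wR Us(1) m_comm[of w u] by auto
    qed
    then show ?thesis using m_comm[OF sR wR] by simp
  qed
  have pw: "p \<otimes> w \<in> Span K Vs" if p: "p \<in> P" and w: "w \<in> Span K Ws" for p w
  proof -
    have pR: "p \<in> carrier R" and wR: "w \<in> carrier R" using p P w WsR by auto
    obtain s where s: "s \<in> Span K Us" "p = s \<oplus> err p" using err[OF pR] by blast
    have sR: "s \<in> carrier R" using s Span_subgroup_props(1)[OF K Us(1)] by auto
    have eN: "err p \<in> N" using p unfolding N_def by blast
    have eR: "err p \<in> carrier R" using eN N(2) by auto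
    have ew: "err p \<otimes> w \<in> Span K Ws" using Ws(3)[OF eN w] .
    then have "\<one> \<otimes> (err p \<otimes> w) \<in> Span K Vs" by (intro uw) simp_all
    then have "err p \<otimes> w \<in> Span K Vs" using eR wR by simp
    moreover have "p \<otimes> w = s \<otimes> w \<oplus> err p \<otimes> w"
      using s(2) sR eR wR l_distr by metis
    ultimately show ?thesis using sw[OF s(1) w] V(3) by simp
  qed
  have "K \<union> G \<subseteq> carrier R" using KR G(2) by simp
  have one: "\<one> \<in> Span K Vs" using uw[OF _ Ws(2), of \<one>] by simp
  have "a \<otimes> \<one> \<in> Span K Vs" if "a \<in> carrier R" for a
  proof (rule generate_ring_stabilizes[OF V(1,3,4) \<open>K \<union> G \<subseteq> carrier R\<close> _ _ one])
    show "a \<in> generate_ring R (K \<union> G)" using that gen by simp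
    fix x v assume x: "x \<in> K \<union> G" and v: "v \<in> Span K Vs"
    show "x \<otimes> v \<in> Span K Vs"
    proof (cases "x \<in> K")
      case True
      then show ?thesis using Span_smult_closed[OF K VsR] v by blast
    next
      case False
      then have xG: "x \<in> G" using x by simp
      then have xR: "x \<in> carrier R" using G(2) by auto
      show ?thesis
      proof (rule Span_mult_closedI[OF K xR VsR VsR _ _ v])
        show "x \<otimes> c = c \<otimes> x" if "c \<in> K" for c using comm that xR .
        fix v assume "v \<in> set Vs"
        then obtain u w where uw: "v = u \<otimes> w" "u \<in> set (\<one> # Us)" "w \<in> set Ws" unfolding Vs by blast
        have "u \<in> carrier R" "w \<in> carrier R" "w \<in> Span K Ws"
          using uw Us(1) Ws(1) Span_base_incl[OF K Ws(1)] by auto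
        moreover have "x \<otimes> u \<in> P" using xG uw(2) unfolding P_def by blast
        ultimately show "x \<otimes> v \<in> Span K Vs"
          using pw[of "x \<otimes> u" w] xR unfolding uw(1) by (simp add: m_assoc)
      qed
    qed
  qed
  then have "carrier R \<subseteq> Span K Vs" by auto
  then show ?thesis using V(1) VsR by blast
qed

text \<open>
  The point is that a sum of two nonunits is a nonunit. Dividing by a sum that is a unit, one may assume
  that \<open>c \<oplus> d = \<one>\<close> with both nilpotent. From \<open>d x = \<zero>\<close> follows \<open>x = c x = c\<^sup>2 x = \<dots> = \<zero>\<close>, so no power of \<open>d\<close>
  vanishes.
\<close>
lemma (in cring) nonunits_maximalideal:
  assumes "\<one> \<noteq> \<zero>" and un: "\<And>a. a \<in> carrier R \<Longrightarrow> a \<in> Units R \<or> (\<exists>n::nat. a [^] n = \<zero>)"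
  shows "maximalideal (carrier R - Units R) R"
proof -
  let ?m = "carrier R - Units R"
  have nil: "a \<notin> Units R" if "a [^] (n::nat) = \<zero>" for a n
  proof
    assume "a \<in> Units R"
    then have "a [^] n \<in> Units R" by (rule Units_pow_closed)
    then have "\<zero> \<in> Units R" using that by simp
    then have "\<exists>b\<in>carrier R. \<one> = \<zero> \<otimes> b" using Units_r_inv[of \<zero>] Units_inv_closed by metis
    then show False using assms(1) by auto
  qed
  have mult: "a \<otimes> b \<notin> Units R" if "a \<in> ?m" "b \<in> carrier R" for a b
    using that unit_factor by blast
  have add: "a \<oplus> b \<notin> Units R" if a: "a \<in> ?m" and b: "b \<in> ?m" for a b
  proof
    assume u: "a \<oplus> b \<in> Units R"
    define c where "c = inv (a \<oplus> b) \<otimes> a"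
    define d where "d = inv (a \<oplus> b) \<otimes> b"
    have iR: "inv (a \<oplus> b) \<in> carrier R" using u by simp
    have cd: "c \<in> carrier R" "d \<in> carrier R" using iR a b unfolding c_def d_def by auto
    have "c \<oplus> d = inv (a \<oplus> b) \<otimes> (a \<oplus> b)"
      using iR a b unfolding c_def d_def by (simp add: r_distr)
    then have sum: "c \<oplus> d = \<one>" using u by simp
    have "c \<notin> Units R" "d \<notin> Units R"
      using mult[OF a iR] mult[OF b iR] iR a b unfolding c_def d_def by (simp_all add: m_comm)
    then obtain n m :: nat where n: "c [^] n = \<zero>" and m: "d [^] m = \<zero>" using un cd by blast
    have inj: "x = \<zero>" if x: "x \<in> carrier R" and dx: "d \<otimes> x = \<zero>" for x
    proof -
      have "x = (c \<oplus> d) \<otimes> x" using x sum by simp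
      then have cx: "x = c \<otimes> x" using x cd dx by (simp add: l_distr)
      have "x = c [^] k \<otimes> x" for k :: nat
      proof (induction k)
        case (Suc k)
        have "c [^] Suc k \<otimes> x = c [^] k \<otimes> (c \<otimes> x)" using cd x by (simp add: m_assoc)
        then show ?case using cx Suc by simp
      qed (use x in simp)
      from this[of n] show ?thesis using n x by simp
    qed
    have "d [^] k \<noteq> \<zero>" for k :: nat
    proof (induction k)
      case (Suc k)
      then show ?case using inj[of "d [^] k"] cd by (auto simp: m_comm)
    qed (use assms(1) in simp)
    then show False using m by simp
  qed
  have zero: "\<zero> \<in> ?m" using nil[of \<zero> 1] by simp
  have neg: "\<ominus> a \<in> ?m" if "a \<in> ?m" for a
  proof -
    have "\<ominus> a = a \<otimes> (\<ominus> \<one>)" using that by (simp add: r_minus)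
    then show ?thesis using mult[OF that, of "\<ominus> \<one>"] that by simp
  qed
  have "ideal ?m R"
  proof (intro idealI ring_axioms)
    show "subgroup ?m (add_monoid R)"
      by (rule group.subgroupI[OF a_group])
        (use zero neg add in \<open>auto simp: a_inv_def[symmetric]\<close>)
  qed (use mult in \<open>auto simp: m_comm\<close>)
  then show ?thesis
  proof (rule maximalidealI)
    show "carrier R \<noteq> ?m" using Units_one_closed one_closed by blast
    fix J assume J: "ideal J R" "?m \<subseteq> J" "J \<subseteq> carrier R"
    show "J = ?m \<or> J = carrier R"
    proof (cases "J = ?m")
      case False
      then obtain u where u: "u \<in> J" "u \<in> Units R" using J by blast
      have "inv u \<otimes> u \<in> J" using ideal.I_l_closed[OF J(1) u(1) Units_inv_closed[OF u(2)]] .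
      then have "\<one> \<in> J" using Units_l_inv[OF u(2)] by metis
      then show ?thesis using ideal.one_imp_carrier[OF J(1)] by simp
    qed simp
  qed
qed

text \<open>
  Zariski's lemma, applied to the residue field, gives a finite spanning list there, and
  \<open>finite_dim_of_nil_reduction\<close> lifts it, since the kernel of the projection consists of nilpotent elements.
\<close>
theorem (in cring) finite_dim_of_unit_or_nilpotent:
  assumes K: "subfield K R" and G: "finite G" "G \<subseteq> carrier R"
    and gen: "generate_ring R (K \<union> G) = carrier R"
    and un: "\<And>a. a \<in> carrier R \<Longrightarrow> a \<in> Units R \<or> (\<exists>n::nat. a [^] n = \<zero>)"
  shows "\<exists>Vs. set Vs \<subseteq> carrier R \<and> Span K Vs = carrier R"
proof -
  let ?m = "carrier R - Units R"
  let ?Q = "R Quot ?m"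
  let ?h = "(+>) ?m"
  have one: "\<one> \<noteq> \<zero>" using subfieldE(6)[OF K] .
  interpret m: maximalideal ?m R using nonunits_maximalideal[OF one un] .
  interpret Q: field ?Q using m.quotient_is_field[OF is_cring] .
  interpret h: ring_hom_ring R ?Q ?h using m.rcos_ring_hom_ring .
  have KR: "K \<subseteq> carrier R" using subfieldE(3)[OF K] .
  have hK: "subfield (?h ` K) ?Q" using h.img_is_subfield[OF K Q.one_not_zero] by simp
  have surj: "carrier ?Q = ?h ` carrier R"
    unfolding FactRing_def A_RCOSETS_def' by auto
  have hH: "?h ` K \<union> ?h ` G \<subseteq> carrier ?Q" using KR G(2) h.hom_closed by blast
  have gR: "a \<in> carrier R" if "a \<in> generate_ring R (K \<union> G)" for a using that gen by simp
  have "?h a \<in> generate_ring ?Q (?h ` K \<union> ?h ` G)" if "a \<in> generate_ring R (K \<union> G)" for a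
    using that
  proof induction
    case one
    then show ?case using generate_ring.one[of ?Q] by simp
  next
    case (incl a)
    then show ?case by (intro generate_ring.incl) auto
  next
    case (a_inv a)
    moreover have "a \<in> carrier R" using gR[OF a_inv(1)] .
    ultimately show ?case using generate_ring.a_inv by (metis h.hom_a_inv)
  next
    case (eng_add a b)
    moreover have "a \<in> carrier R" "b \<in> carrier R"
      using gR[OF eng_add(1)] gR[OF eng_add(2)] .
    ultimately show ?case using generate_ring.eng_add by (metis h.hom_add)
  next
    case (eng_mult a b)
    moreover have "a \<in> carrier R" "b \<in> carrier R"
      using gR[OF eng_mult(1)] gR[OF eng_mult(2)] .
    ultimately show ?case using generate_ring.eng_mult by (metis h.hom_mult)
  qed
  then have "generate_ring ?Q (?h ` K \<union> ?h ` G) = carrier ?Q"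
    using surj gen Q.generate_ring_incl[OF hH] by auto
  then have "Q.finite_dimension (?h ` K) (carrier ?Q)"
    using Q.zariski_lemma[OF hK finite_imageI[OF G(1)]] hH by blast
  then obtain n where "Q.dimension n (?h ` K) (carrier ?Q)"
    unfolding Q.finite_dimension_def by blast
  then obtain Us' where Us': "set Us' \<subseteq> carrier ?Q" "Q.Span (?h ` K) Us' = carrier ?Q"
    using Q.exists_base[OF hK] by blast
  define Us where "Us = map (inv_into (carrier R) ?h) Us'"
  have "set Us' \<subseteq> ?h ` carrier R" using Us'(1) unfolding surj .
  then have Us: "set Us \<subseteq> carrier R" "Us' = map ?h Us"
    unfolding Us_def by (auto simp: inv_into_into f_inv_into_f subset_iff intro!: map_idI[symmetric])
  show ?thesis
  proof (rule finite_dim_of_nil_reduction[OF K G gen h.ring_hom_ring_axioms _ Us(1)])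
    fix a assume a: "a \<in> carrier R" "?h a = \<zero>\<^bsub>?Q\<^esub>"
    then have "a \<in> ?m" using m.a_rcos_self unfolding FactRing_def by auto
    then show "\<exists>d::nat. a [^] d = \<zero>" using un by auto
  next
    show "?h ` carrier R \<subseteq> Q.Span (?h ` K) (map ?h Us)" using Us' Us(2) surj by simp
  qed
qed

section \<open>Elements lying in every prime ideal\<close>

text \<open>
  If no power of \<open>a\<close> vanishes, then by Zorn's lemma there is an ideal that is maximal among those
  containing no power of \<open>a\<close>. It is prime: enlarging it by \<open>x\<close> or by \<open>y\<close> produces powers of \<open>a\<close>, and their
  product would be in the ideal together with \<open>x y\<close>.
\<close>
lemma (in cring) nilpotent_if_in_all_primes:
  assumes a: "a \<in> carrier R" and primes: "\<And>\<pp>. primeideal \<pp> R \<Longrightarrow> a \<in> \<pp>"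
  shows "\<exists>n::nat. a [^] n = \<zero>"
proof (rule ccontr)
  assume "\<not> ?thesis"
  then have nn: "\<And>n::nat. a [^] n \<noteq> \<zero>" by auto
  define S where "S = {I. ideal I R \<and> (\<forall>n::nat. a [^] n \<notin> I)}"
  have zero: "{\<zero>} \<in> S" unfolding S_def using nn zeroideal by auto
  have "\<exists>M\<in>S. \<forall>I\<in>S. M \<subseteq> I \<longrightarrow> I = M"
  proof (rule subset_Zorn)
    fix C assume C: "subset.chain S C"
    show "\<exists>U\<in>S. \<forall>I\<in>C. I \<subseteq> U"
    proof (cases "C = {}")
      case True
      then show ?thesis using zero by auto
    next
      case False
      have "C \<subseteq> S" using C unfolding pred_on.chain_def by auto
      have "subset.chain {I. ideal I R} C"
        using C unfolding S_def pred_on.chain_def by auto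
      then have "ideal (\<Union>C) R" using False chain_Union_is_ideal[of C] by (simp del: Union_iff)
      then have "\<Union>C \<in> S" using \<open>C \<subseteq> S\<close> unfolding S_def by auto
      then show ?thesis by auto
    qed
  qed
  then obtain M where MS: "M \<in> S" and maxS: "\<And>I. I \<in> S \<Longrightarrow> M \<subseteq> I \<Longrightarrow> I = M" by auto
  have M: "ideal M R" "a [^] (n::nat) \<notin> M" for n using MS unfolding S_def by auto
  have max: "\<exists>n::nat. a [^] n \<in> I" if "ideal I R" "M \<subseteq> I" "I \<noteq> M" for I
    using maxS[of I] that unfolding S_def by auto
  interpret M: ideal M R by fact
  have hit: "\<exists>n::nat. \<exists>m\<in>M. \<exists>r\<in>carrier R. a [^] n = m \<oplus> r \<otimes> x"
    if x: "x \<in> carrier R" "x \<notin> M" for x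
  proof -
    let ?J = "M <+>\<^bsub>R\<^esub> PIdl x"
    have J: "ideal ?J R" using add_ideals[OF M(1) cgenideal_ideal[OF x(1)]] .
    have PI: "ideal (PIdl x) R" using cgenideal_ideal[OF x(1)] .
    have x0: "\<zero> \<in> PIdl x" "x \<in> PIdl x" "\<zero> \<in> M"
      using PI cgenideal_self[OF x(1)] additive_subgroup.zero_closed[OF ideal.axioms(1)] M(1) by auto
    have "m \<in> ?J" if "m \<in> M" for m
      unfolding set_add_def' using that x0(1) M.a_Hcarr by fastforce
    moreover have "x \<in> ?J"
    proof -
      have "x = \<zero> \<oplus> x" using x(1) by simp
      then show ?thesis unfolding set_add_def' using x0 by blast
    qed
    ultimately have "M \<subseteq> ?J" "?J \<noteq> M" using x(2) by auto
    then obtain n :: nat where "a [^] n \<in> ?J" using max[OF J] by blast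
    then show ?thesis unfolding set_add_def' cgenideal_def by auto
  qed
  have "primeideal M R"
  proof (rule primeidealI[OF M(1) is_cring])
    show "carrier R \<noteq> M" using M(2)[of 0] by auto
    fix x y assume xy: "x \<in> carrier R" "y \<in> carrier R" "x \<otimes> y \<in> M"
    show "x \<in> M \<or> y \<in> M"
    proof (rule ccontr)
      assume "\<not> (x \<in> M \<or> y \<in> M)"
      then obtain n k :: nat and m r m' r' where
        n: "m \<in> M" "r \<in> carrier R" "a [^] n = m \<oplus> r \<otimes> x" and
        k: "m' \<in> M" "r' \<in> carrier R" "a [^] k = m' \<oplus> r' \<otimes> y"
        using hit[of x] hit[of y] xy by blast
      have mR: "m \<in> carrier R" "m' \<in> carrier R" using n(1) k(1) M.a_Hcarr by auto
      have "a [^] (n + k) = (m \<oplus> r \<otimes> x) \<otimes> (m' \<oplus> r' \<otimes> y)"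
        using a n(3) k(3) by (simp add: nat_pow_mult[symmetric])
      also have "\<dots> = (m' \<oplus> r' \<otimes> y) \<otimes> m \<oplus> ((r \<otimes> x) \<otimes> m' \<oplus> (r \<otimes> r') \<otimes> (x \<otimes> y))"
        using mR n(2) k(2) xy(1,2) by algebra
      also have "\<dots> \<in> M"
      proof -
        have "(m' \<oplus> r' \<otimes> y) \<otimes> m \<in> M" "(r \<otimes> x) \<otimes> m' \<in> M" "(r \<otimes> r') \<otimes> (x \<otimes> y) \<in> M"
          using n(1,2) k(1,2) xy mR by (simp_all add: M.I_l_closed)
        then show ?thesis by (simp add: M.a_closed)
      qed
      finally show False using M(2) by blast
    qed
  qed
  then show False using primes[of M] M(2)[of 1] a by simp
qed

section \<open>The free associative algebra\<close>

(* From here on, X is free to stand for a scheme instead of the polynomial variable. *)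
no_notation var ("X\<index>")

lemma free_algebra_simps:
  "\<zero>\<^bsub>free_algebra R B\<^esub> = (\<lambda>w. \<zero>\<^bsub>R\<^esub>)"
  "\<one>\<^bsub>free_algebra R B\<^esub> = (\<lambda>w. if w = [] then \<one>\<^bsub>R\<^esub> else \<zero>\<^bsub>R\<^esub>)"
  "f \<oplus>\<^bsub>free_algebra R B\<^esub> g = (\<lambda>w. f w \<oplus>\<^bsub>R\<^esub> g w)"
  "f \<otimes>\<^bsub>free_algebra R B\<^esub> g = (\<lambda>w. \<Oplus>\<^bsub>R\<^esub>i\<in>{..length w}. f (take i w) \<otimes>\<^bsub>R\<^esub> g (drop i w))"
  by (simp_all add: free_algebra_def)

lemma free_algebra_carrier:
  "f \<in> carrier (free_algebra R B) \<longleftrightarrow> (\<forall>w. f w \<in> carrier R) \<and> finite {w. f w \<noteq> \<zero>\<^bsub>R\<^esub>} \<and>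
     (\<forall>w. f w \<noteq> \<zero>\<^bsub>R\<^esub> \<longrightarrow> set w \<subseteq> B)"
  by (simp add: free_algebra_def)

text \<open>
  The multiplication of the free algebra. It makes sense for all coefficient functions, also those of
  infinite support, and this allows recursion on the word in the proofs of the ring axioms.
\<close>
definition convolution :: "('r, 'e) ring_scheme \<Rightarrow> ('m list \<Rightarrow> 'r) \<Rightarrow> ('m list \<Rightarrow> 'r) \<Rightarrow> 'm list \<Rightarrow> 'r" where
  "convolution R f g w = (\<Oplus>\<^bsub>R\<^esub>i\<in>{..length w}. f (take i w) \<otimes>\<^bsub>R\<^esub> g (drop i w))"

lemma free_algebra_mult: "f \<otimes>\<^bsub>free_algebra R B\<^esub> g = convolution R f g"
  by (simp add: free_algebra_simps convolution_def fun_eq_iff)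

context ring
begin

lemma convolution_closed:
  assumes "\<And>w. f w \<in> carrier R" "\<And>w. g w \<in> carrier R"
  shows "convolution R f g w \<in> carrier R"
  unfolding convolution_def using assms by (intro finsum_closed) auto

lemma convolution_Nil:
  assumes "\<And>w. f w \<in> carrier R" "\<And>w. g w \<in> carrier R"
  shows "convolution R f g [] = f [] \<otimes> g []"
  unfolding convolution_def using assms by (simp add: finsum_insert)

text \<open>
  Splitting a word \<open>a # w\<close> either gives the first factor at least the letter \<open>a\<close>, or nothing. This turns the
  ring axioms into inductions on the word that never reindex a double sum.
\<close>
lemma convolution_Cons:
  assumes "\<And>w. f w \<in> carrier R" "\<And>w. g w \<in> carrier R"
  shows "convolution R f g (a # w) = convolution R (\<lambda>v. f (a # v)) g w \<oplus> f [] \<otimes> g (a # w)"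
  unfolding convolution_def list.size add_Suc_right add_0_right
  by (subst finsum_Suc2) (use assms in auto)

lemma convolution_add_left:
  assumes "\<And>w. f w \<in> carrier R" "\<And>w. g w \<in> carrier R" "\<And>w. h w \<in> carrier R"
  shows "convolution R (\<lambda>w. f w \<oplus> g w) h w = convolution R f h w \<oplus> convolution R g h w"
  using assms
  by (induction w arbitrary: f g) (auto simp add: convolution_Nil convolution_Cons convolution_closed l_distr a_ac)

lemma convolution_add_right:
  assumes "\<And>w. f w \<in> carrier R" "\<And>w. g w \<in> carrier R" "\<And>w. h w \<in> carrier R"
  shows "convolution R h (\<lambda>w. f w \<oplus> g w) w = convolution R h f w \<oplus> convolution R h g w"
  using assms
  by (induction w arbitrary: h) (auto simp add: convolution_Nil convolution_Cons convolution_closed r_distr a_ac)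

lemma convolution_smult_left:
  assumes "\<And>w. f w \<in> carrier R" "\<And>w. g w \<in> carrier R" "c \<in> carrier R"
  shows "convolution R (\<lambda>w. c \<otimes> f w) g w = c \<otimes> convolution R f g w"
  using assms
  by (induction w arbitrary: f) (auto simp add: convolution_Nil convolution_Cons convolution_closed r_distr m_assoc)

lemma convolution_assoc:
  assumes "\<And>w. f w \<in> carrier R" "\<And>w. g w \<in> carrier R" "\<And>w. h w \<in> carrier R"
  shows "convolution R (convolution R f g) h w = convolution R f (convolution R g h) w"
  using assms
proof (induction w arbitrary: f g h)
  case Nil
  then show ?case by (simp add: convolution_Nil convolution_closed m_assoc)
next
  case (Cons a w)
  note c = Cons.prems
  have eq: "(\<lambda>v. convolution R f g (a # v)) = (\<lambda>v. convolution R (\<lambda>v. f (a # v)) g v \<oplus> f [] \<otimes> g (a # v))"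
    using c by (simp add: convolution_Cons)
  have "convolution R (convolution R f g) h (a # w)
      = convolution R (convolution R (\<lambda>v. f (a # v)) g) h w \<oplus> f [] \<otimes> convolution R (\<lambda>v. g (a # v)) h w
        \<oplus> f [] \<otimes> g [] \<otimes> h (a # w)"
    using c by (simp add: convolution_Cons[of "convolution R f g"] eq convolution_closed convolution_Nil convolution_add_left convolution_smult_left)
  also have "\<dots> = convolution R f (convolution R g h) (a # w)"
    using c Cons.IH[of "\<lambda>v. f (a # v)" g h]
    by (simp add: convolution_Cons convolution_closed r_distr m_assoc a_assoc)
  finally show ?case .
qed

lemma convolution_zero_left:
  assumes "\<And>w. g w \<in> carrier R" shows "convolution R (\<lambda>w. \<zero>) g w = \<zero>"
  using assms by (induction w) (auto simp add: convolution_Nil convolution_Cons)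

lemma convolution_one_left:
  assumes "\<And>w. g w \<in> carrier R" shows "convolution R (\<lambda>w. if w = [] then \<one> else \<zero>) g w = g w"
  using assms by (cases w) (auto simp add: convolution_Nil convolution_Cons convolution_zero_left)

lemma convolution_one_right:
  assumes "\<And>w. f w \<in> carrier R" shows "convolution R f (\<lambda>w. if w = [] then \<one> else \<zero>) w = f w"
  using assms by (induction w arbitrary: f) (auto simp add: convolution_Nil convolution_Cons convolution_closed)

lemma convolution_nonzeroD:
  assumes "convolution R f g w \<noteq> \<zero>" "\<And>w. f w \<in> carrier R" "\<And>w. g w \<in> carrier R"
  obtains u v where "w = u @ v" "f u \<noteq> \<zero>" "g v \<noteq> \<zero>"
proof -
  have "\<exists>i\<in>{..length w}. f (take i w) \<otimes> g (drop i w) \<noteq> \<zero>"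
  proof (rule ccontr)
    assume "\<not> ?thesis"
    then have "convolution R f g w = (\<Oplus>i\<in>{..length w}. \<zero>)"
      unfolding convolution_def by (intro finsum_cong') auto
    then show False using assms(1) by simp
  qed
  then obtain i where i: "f (take i w) \<otimes> g (drop i w) \<noteq> \<zero>" by blast
  then have "f (take i w) \<noteq> \<zero>" "g (drop i w) \<noteq> \<zero>" using assms(2,3) by auto
  then show thesis using that[of "take i w" "drop i w"] by simp
qed

theorem free_algebra_ring: "ring (free_algebra R B)"
proof (rule ringI)
  let ?F = "free_algebra R B"
  show "abelian_group ?F"
  proof (rule abelian_groupI)
    fix f g assume f: "f \<in> carrier ?F" and g: "g \<in> carrier ?F"
    have "{w. f w \<oplus> g w \<noteq> \<zero>} \<subseteq> {w. f w \<noteq> \<zero>} \<union> {w. g w \<noteq> \<zero>}" by auto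
    then have "finite {w. f w \<oplus> g w \<noteq> \<zero>}"
      using f g unfolding free_algebra_carrier by (auto intro: finite_subset)
    moreover have "set w \<subseteq> B" if "f w \<oplus> g w \<noteq> \<zero>" for w
    proof -
      have "f w \<noteq> \<zero> \<or> g w \<noteq> \<zero>" using that by auto
      then show ?thesis using f g unfolding free_algebra_carrier by blast
    qed
    ultimately show "f \<oplus>\<^bsub>?F\<^esub> g \<in> carrier ?F"
      using f g unfolding free_algebra_carrier free_algebra_simps by simp
  next
    show "\<zero>\<^bsub>?F\<^esub> \<in> carrier ?F" unfolding free_algebra_carrier free_algebra_simps by simp
  next
    fix f assume f: "f \<in> carrier ?F"
    have c: "\<And>w. f w \<in> carrier R" using f unfolding free_algebra_carrier by blast
    have "\<ominus> f w \<noteq> \<zero> \<longleftrightarrow> f w \<noteq> \<zero>" for w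
      using c[of w] minus_minus[of "f w"] by (cases "f w = \<zero>") force+
    with c show "\<exists>g\<in>carrier ?F. g \<oplus>\<^bsub>?F\<^esub> f = \<zero>\<^bsub>?F\<^esub>"
      using f unfolding free_algebra_carrier free_algebra_simps
      by (intro bexI[of _ "\<lambda>w. \<ominus> f w"]) (auto simp: l_neg free_algebra_carrier)
  qed (auto simp: free_algebra_carrier free_algebra_simps a_ac)
  show "monoid ?F"
  proof (rule monoidI)
    fix f g assume f: "f \<in> carrier ?F" and g: "g \<in> carrier ?F"
    have c: "\<And>w. f w \<in> carrier R" "\<And>w. g w \<in> carrier R"
      using f g unfolding free_algebra_carrier by blast+
    have "{w. convolution R f g w \<noteq> \<zero>} \<subseteq> (\<lambda>(u, v). u @ v) ` ({w. f w \<noteq> \<zero>} \<times> {w. g w \<noteq> \<zero>})"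
    proof
      fix w assume "w \<in> {w. convolution R f g w \<noteq> \<zero>}"
      then obtain u v where "w = u @ v" "f u \<noteq> \<zero>" "g v \<noteq> \<zero>" using convolution_nonzeroD c by blast
      then show "w \<in> (\<lambda>(u, v). u @ v) ` ({w. f w \<noteq> \<zero>} \<times> {w. g w \<noteq> \<zero>})"
        by (intro image_eqI[of _ _ "(u, v)"]) auto
    qed
    then have "finite {w. convolution R f g w \<noteq> \<zero>}"
      using f g unfolding free_algebra_carrier by (auto intro: finite_subset)
    moreover have "set w \<subseteq> B" if nz: "convolution R f g w \<noteq> \<zero>" for w
    proof -
      obtain u v where "w = u @ v" "f u \<noteq> \<zero>" "g v \<noteq> \<zero>"
        using convolution_nonzeroD[OF nz c] by blast
      then show ?thesis using f g unfolding free_algebra_carrier by auto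
    qed
    ultimately show "f \<otimes>\<^bsub>?F\<^esub> g \<in> carrier ?F"
      using convolution_closed[of f g, OF c] unfolding free_algebra_carrier free_algebra_mult by blast
  next
    show "\<one>\<^bsub>?F\<^esub> \<in> carrier ?F"
      unfolding free_algebra_carrier free_algebra_simps by (auto intro: finite_subset[of _ "{[]}"])
  next
    fix f g h assume "f \<in> carrier ?F" "g \<in> carrier ?F" "h \<in> carrier ?F"
    then show "f \<otimes>\<^bsub>?F\<^esub> g \<otimes>\<^bsub>?F\<^esub> h = f \<otimes>\<^bsub>?F\<^esub> (g \<otimes>\<^bsub>?F\<^esub> h)"
      unfolding free_algebra_carrier free_algebra_mult by (simp add: convolution_assoc fun_eq_iff)
  next
    fix f assume "f \<in> carrier ?F"
    then show "\<one>\<^bsub>?F\<^esub> \<otimes>\<^bsub>?F\<^esub> f = f" "f \<otimes>\<^bsub>?F\<^esub> \<one>\<^bsub>?F\<^esub> = f"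
      unfolding free_algebra_carrier free_algebra_mult free_algebra_simps(2)
      by (simp_all add: convolution_one_left convolution_one_right fun_eq_iff)
  qed
  fix f g h assume "f \<in> carrier ?F" "g \<in> carrier ?F" "h \<in> carrier ?F"
  then show "(f \<oplus>\<^bsub>?F\<^esub> g) \<otimes>\<^bsub>?F\<^esub> h = f \<otimes>\<^bsub>?F\<^esub> h \<oplus>\<^bsub>?F\<^esub> g \<otimes>\<^bsub>?F\<^esub> h"
    "h \<otimes>\<^bsub>?F\<^esub> (f \<oplus>\<^bsub>?F\<^esub> g) = h \<otimes>\<^bsub>?F\<^esub> f \<oplus>\<^bsub>?F\<^esub> h \<otimes>\<^bsub>?F\<^esub> g"
    unfolding free_algebra_carrier free_algebra_mult free_algebra_simps(3)
    by (simp_all add: convolution_add_left convolution_add_right fun_eq_iff)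
qed

lemma monomial_closed:
  assumes "r \<in> carrier R" "set w \<subseteq> B"
  shows "monomial R r w \<in> carrier (free_algebra R B)"
  unfolding free_algebra_carrier monomial_def using assms by (auto intro: finite_subset[of _ "{w}"])

lemma monomial_mult:
  fixes u v :: "'m list"
  assumes "r \<in> carrier R" "s \<in> carrier R"
  shows "monomial R r u \<otimes>\<^bsub>free_algebra R B\<^esub> monomial R s v
    = monomial R (r \<otimes> s) (u @ v)"
proof -
  have c: "\<And>w u :: 'm list. monomial R r u w \<in> carrier R" "\<And>w u :: 'm list. monomial R s u w \<in> carrier R"
    using assms by (auto simp: monomial_def)
  have "convolution R (monomial R r u) (monomial R s v) w = monomial R (r \<otimes> s) (u @ v) w" for w
  proof (induction u arbitrary: w)
    case Nil
    have eq: "monomial R r [] = (\<lambda>w. r \<otimes> (if w = [] then \<one> else \<zero>))"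
      using assms by (auto simp: monomial_def)
    have "convolution R (monomial R r []) (monomial R s v) w = r \<otimes> monomial R s v w"
      unfolding eq by (subst convolution_smult_left) (use assms c convolution_one_left[of "monomial R s v", OF c(2)] in auto)
    then show ?case using assms by (simp add: monomial_def)
  next
    case (Cons a u)
    show ?case
    proof (cases w)
      case Nil
      then show ?thesis using convolution_Nil[of "monomial R r (a # u)" "monomial R s v", OF c(1) c(2)] c(2)[of v "[]"]
        by (simp add: monomial_def[of R _ "a # u"] monomial_def[of R _ "a # u @ v"])
    next
      case w: (Cons b w')
      have "(\<lambda>x. monomial R r (a # u) (b # x)) = (if b = a then monomial R r u else (\<lambda>x. \<zero>))"
        by (auto simp: monomial_def)
      moreover have "monomial R r (a # u) [] = \<zero>" by (simp add: monomial_def)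
      moreover have "monomial R (r \<otimes> s) ((a # u) @ v) (b # w')
          = (if b = a then monomial R (r \<otimes> s) (u @ v) w' else \<zero>)"
        by (auto simp: monomial_def)
      moreover have "convolution R (monomial R r (a # u)) (monomial R s v) (b # w')
          = convolution R (\<lambda>x. monomial R r (a # u) (b # x)) (monomial R s v) w'
            \<oplus> monomial R r (a # u) [] \<otimes> monomial R s v (b # w')"
        using convolution_Cons[of "monomial R r (a # u)" "monomial R s v", OF c(1) c(2)] .
      moreover have "convolution R (monomial R r u) (monomial R s v) w' \<in> carrier R"
        using convolution_closed[of "monomial R r u" "monomial R s v", OF c(1) c(2)] .
      moreover have "convolution R (\<lambda>x. \<zero>) (monomial R s v) w' = \<zero>"
        using convolution_zero_left[of "monomial R s v", OF c(2)] .
      moreover have "\<zero> \<otimes> monomial R s v (b # w') = \<zero>" using c(2) by simp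
      ultimately show ?thesis unfolding w using Cons.IH[of w'] by simp
    qed
  qed
  then show ?thesis unfolding free_algebra_mult by (simp add: fun_eq_iff)
qed

text \<open>
  An element of the free algebra is a sum of monomials. The induction adds each word only once, so that
  the support of the partial sum \<open>f\<close> stays inside that of the result.
\<close>
lemma free_algebra_induct [consumes 1, case_names zero add]:
  assumes "f \<in> carrier (free_algebra R B)"
    and "P (\<lambda>w. \<zero>)"
    and step: "\<And>f r w. f \<in> carrier (free_algebra R B) \<Longrightarrow> P f \<Longrightarrow> r \<in> carrier R \<Longrightarrow> r \<noteq> \<zero> \<Longrightarrow>
      set w \<subseteq> B \<Longrightarrow> f w = \<zero> \<Longrightarrow> P (f \<oplus>\<^bsub>free_algebra R B\<^esub> monomial R r w)"
  shows "P f"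
proof -
  have "finite {w. f w \<noteq> \<zero>}" using assms(1) unfolding free_algebra_carrier by blast
  then show ?thesis using assms(1)
  proof (induction "{w. f w \<noteq> \<zero>}" arbitrary: f rule: finite_induct)
    case empty
    then have "f = (\<lambda>w. \<zero>)" by auto
    then show ?case using assms(2) by simp
  next
    case (insert w S)
    have wS: "\<And>v. f v \<noteq> \<zero> \<longleftrightarrow> v = w \<or> v \<in> S" using insert.hyps(4) by auto
    have c: "\<And>v. f v \<in> carrier R" and B: "set w \<subseteq> B"
      using insert.prems wS unfolding free_algebra_carrier by blast+
    define g where "g = f(w := \<zero>)"
    have supp: "{v. g v \<noteq> \<zero>} = S" unfolding g_def using wS insert.hyps(2) by auto
    have g: "g \<in> carrier (free_algebra R B)"
      using insert.prems insert.hyps(1) supp c unfolding free_algebra_carrier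
      by (auto simp: g_def)
    have "f = g \<oplus>\<^bsub>free_algebra R B\<^esub> monomial R (f w) w"
      using c by (auto simp: g_def free_algebra_simps monomial_def)
    moreover have "P (g \<oplus>\<^bsub>free_algebra R B\<^esub> monomial R (f w) w)"
      using insert.hyps(3)[OF supp[symmetric] g] wS[of w] by (intro step g c B) (auto simp: g_def)
    ultimately show ?case by simp
  qed
qed

end

section \<open>The tensor algebra of a free module of rank one\<close>

locale free_rank_one_module = module R M
  for R :: "('r, 'e) ring_scheme" (structure) and M :: "('r, 'm) module" +
  fixes \<theta> :: "'m \<Rightarrow> 'r" and e :: 'm
  assumes coord_closed [simp]: "u \<in> carrier M \<Longrightarrow> \<theta> u \<in> carrier R"
    and coord_add: "\<lbrakk>u \<in> carrier M; v \<in> carrier M\<rbrakk> \<Longrightarrow> \<theta> (u \<oplus>\<^bsub>M\<^esub> v) = \<theta> u \<oplus> \<theta> v"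
    and coord_smult: "\<lbrakk>r \<in> carrier R; u \<in> carrier M\<rbrakk> \<Longrightarrow> \<theta> (r \<odot>\<^bsub>M\<^esub> u) = r \<otimes> \<theta> u"
    and gen_closed [simp]: "e \<in> carrier M"
    and coord_gen: "\<theta> e = \<one>"
    and coord_expand: "u \<in> carrier M \<Longrightarrow> u = \<theta> u \<odot>\<^bsub>M\<^esub> e"
begin

abbreviation F :: "('m list \<Rightarrow> 'r) ring" where "F \<equiv> free_algebra R (carrier M)"
abbreviation J :: "('m list \<Rightarrow> 'r) set" where "J \<equiv> tensor_ideal R M"
abbreviation T :: "('m list \<Rightarrow> 'r) set ring" where "T \<equiv> tensor_algebra R M"

sublocale F: ring F using free_algebra_ring .

definition weight :: "'m list \<Rightarrow> 'r" where "weight w = foldr (\<lambda>u r. \<theta> u \<otimes> r) w \<one>"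

lemma weight_Nil [simp]: "weight [] = \<one>" by (simp add: weight_def)
lemma weight_Cons [simp]: "weight (u # w) = \<theta> u \<otimes> weight w" by (simp add: weight_def)

lemma weight_closed [simp]: "set w \<subseteq> carrier M \<Longrightarrow> weight w \<in> carrier R"
  by (induction w) auto

lemma weight_append: "set v \<subseteq> carrier M \<Longrightarrow> set w \<subseteq> carrier M \<Longrightarrow> weight (v @ w) = weight v \<otimes> weight w"
  by (induction v) (auto simp: m_assoc)

text \<open>
  The homomorphism of algebras from the free algebra to \<open>R\<close> that sends each letter \<open>u\<close> to its coordinate
  \<open>\<theta> u\<close>. It will induce the map on the tensor algebra that sets \<open>e = \<one>\<close>.
\<close>
definition eval_free :: "('m list \<Rightarrow> 'r) \<Rightarrow> 'r" where
  "eval_free f = (\<Oplus>w\<in>{w. f w \<noteq> \<zero>}. f w \<otimes> weight w)"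

lemma eval_free_superset:
  assumes "f \<in> carrier F" "finite S" "{w. f w \<noteq> \<zero>} \<subseteq> S" "\<And>w. w \<in> S \<Longrightarrow> set w \<subseteq> carrier M"
  shows "eval_free f = (\<Oplus>w\<in>S. f w \<otimes> weight w)"
  unfolding eval_free_def
  by (rule R.add.finprod_mono_neutral_cong_left)
    (use assms in \<open>auto simp: free_algebra_carrier\<close>)

lemma eval_free_closed [simp]: "f \<in> carrier F \<Longrightarrow> eval_free f \<in> carrier R"
  unfolding eval_free_def free_algebra_carrier by (intro R.finsum_closed) auto

lemma eval_free_add:
  assumes f: "f \<in> carrier F" and g: "g \<in> carrier F"
  shows "eval_free (f \<oplus>\<^bsub>F\<^esub> g) = eval_free f \<oplus> eval_free g"
proof -
  let ?S = "{w. f w \<noteq> \<zero>} \<union> {w. g w \<noteq> \<zero>}"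
  have S: "finite ?S" "\<And>w. w \<in> ?S \<Longrightarrow> set w \<subseteq> carrier M"
    and c: "\<And>w. f w \<in> carrier R" "\<And>w. g w \<in> carrier R"
    using f g unfolding free_algebra_carrier by blast+
  have "{w. (f \<oplus>\<^bsub>F\<^esub> g) w \<noteq> \<zero>} \<subseteq> ?S" by (auto simp: free_algebra_simps)
  then have "eval_free (f \<oplus>\<^bsub>F\<^esub> g) = (\<Oplus>w\<in>?S. (f w \<oplus> g w) \<otimes> weight w)"
    using eval_free_superset[OF F.a_closed[OF f g] S(1) _ S(2)] by (simp add: free_algebra_simps)
  also have "\<dots> = (\<Oplus>w\<in>?S. f w \<otimes> weight w \<oplus> g w \<otimes> weight w)"
    using S(2) c by (intro R.finsum_cong') (auto simp: l_distr)
  also have "\<dots> = (\<Oplus>w\<in>?S. f w \<otimes> weight w) \<oplus> (\<Oplus>w\<in>?S. g w \<otimes> weight w)"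
    using S(2) c by (intro R.finsum_addf) auto
  also have "\<dots> = eval_free f \<oplus> eval_free g"
    using eval_free_superset[OF f S(1) _ S(2)] eval_free_superset[OF g S(1) _ S(2)] by simp
  finally show ?thesis .
qed

lemma eval_free_monomial:
  assumes "r \<in> carrier R" "set w \<subseteq> carrier M"
  shows "eval_free (monomial R r w) = r \<otimes> weight w"
proof -
  have "eval_free (monomial R r w) = (\<Oplus>v\<in>{w}. monomial R r w v \<otimes> weight v)"
    using assms by (intro eval_free_superset monomial_closed) (auto simp: monomial_def)
  also have "\<dots> = r \<otimes> weight w" using assms by (simp add: monomial_def)
  finally show ?thesis .
qed

lemma eval_free_zero: "eval_free (\<lambda>w. \<zero>) = \<zero>"
  by (simp add: eval_free_def)

text \<open>
  Both sides are additive in each factor, so it suffices to compare them on monomials.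
\<close>
lemma eval_free_mult:
  assumes f: "f \<in> carrier F" and g: "g \<in> carrier F"
  shows "eval_free (f \<otimes>\<^bsub>F\<^esub> g) = eval_free f \<otimes> eval_free g"
proof -
  have mono: "eval_free (monomial R r w \<otimes>\<^bsub>F\<^esub> g) = (r \<otimes> weight w) \<otimes> eval_free g"
    if r: "r \<in> carrier R" "set w \<subseteq> carrier M" for r w
    using g
  proof (induction g rule: free_algebra_induct)
    case zero
    have "monomial R r w \<otimes>\<^bsub>F\<^esub> (\<lambda>w. \<zero>) = (\<lambda>w. \<zero>)"
      using F.r_null[OF monomial_closed[OF r]] by (simp add: free_algebra_simps(1))
    then show ?case using r by (simp add: eval_free_zero)
  next
    case (add g s v)
    have m: "monomial R r w \<in> carrier F" "monomial R s v \<in> carrier F"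
      using monomial_closed[OF r] monomial_closed[OF add.hyps(2,4)] by auto
    have "eval_free (monomial R r w \<otimes>\<^bsub>F\<^esub> (g \<oplus>\<^bsub>F\<^esub> monomial R s v))
        = eval_free (monomial R r w \<otimes>\<^bsub>F\<^esub> g) \<oplus> eval_free (monomial R (r \<otimes> s) (w @ v))"
      using m add.hyps(1,2,4) r monomial_closed[of "r \<otimes> s" "w @ v" "carrier M"]
      by (simp add: F.r_distr eval_free_add monomial_mult)
    also have "\<dots> = (r \<otimes> weight w) \<otimes> eval_free g \<oplus> (r \<otimes> s) \<otimes> (weight w \<otimes> weight v)"
      using r add by (simp add: eval_free_monomial weight_append)
    also have "\<dots> = (r \<otimes> weight w) \<otimes> (eval_free g \<oplus> s \<otimes> weight v)"
      using r add.hyps(1,2,4) by (simp add: r_distr m_ac)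
    also have "\<dots> = (r \<otimes> weight w) \<otimes> eval_free (g \<oplus>\<^bsub>F\<^esub> monomial R s v)"
      using m add.hyps(1,2,4) by (simp add: eval_free_add eval_free_monomial)
    finally show ?case .
  qed
  show ?thesis
    using f
  proof (induction f rule: free_algebra_induct)
    case zero
    have "(\<lambda>w. \<zero>) \<otimes>\<^bsub>F\<^esub> g = (\<lambda>w. \<zero>)"
      using F.l_null[OF g] by (simp add: free_algebra_simps(1))
    then show ?case using g by (simp add: eval_free_zero)
  next
    case (add f r w)
    have m: "monomial R r w \<in> carrier F" using monomial_closed[OF add.hyps(2,4)] .
    show ?case
      using m add.hyps(1,2,4) add.IH g
      by (simp add: F.l_distr eval_free_add mono eval_free_monomial l_distr)
  qed
qed

lemma one_eq_monomial: "\<one>\<^bsub>F\<^esub> = monomial R \<one> []"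
  by (auto simp: free_algebra_simps monomial_def)

lemma eval_free_hom: "ring_hom_ring F R eval_free"
proof (rule ring_hom_ringI)
  show "eval_free \<one>\<^bsub>F\<^esub> = \<one>" unfolding one_eq_monomial by (simp add: eval_free_monomial)
qed (simp_all add: F.ring_axioms ring_axioms eval_free_mult eval_free_add)

lemma tensor_relations_closed:
  "u \<in> carrier M \<Longrightarrow> v \<in> carrier M \<Longrightarrow>
    monomial R \<one> [u \<oplus>\<^bsub>M\<^esub> v] \<ominus>\<^bsub>F\<^esub> (monomial R \<one> [u] \<oplus>\<^bsub>F\<^esub> monomial R \<one> [v]) \<in> carrier F"
  "r \<in> carrier R \<Longrightarrow> u \<in> carrier M \<Longrightarrow>
    monomial R \<one> [r \<odot>\<^bsub>M\<^esub> u] \<ominus>\<^bsub>F\<^esub> monomial R r [u] \<in> carrier F"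
  by (auto intro!: F.minus_closed F.a_closed monomial_closed)

lemma tensor_ideal_ideal: "ideal J F"
  unfolding tensor_ideal_def Let_def
  by (rule F.genideal_ideal) (use tensor_relations_closed in blast)

lemma tensor_ideal_smult_relation:
  assumes "r \<in> carrier R" "u \<in> carrier M"
  shows "monomial R \<one> [r \<odot>\<^bsub>M\<^esub> u] \<ominus>\<^bsub>F\<^esub> monomial R r [u] \<in> J"
proof -
  have "S \<subseteq> Idl\<^bsub>F\<^esub> S" if "S \<subseteq> carrier F" for S using F.genideal_self[OF that] .
  then show ?thesis
    unfolding tensor_ideal_def Let_def
    by (rule subsetD) (use assms tensor_relations_closed in blast)+
qed

text \<open>
  The kernel is an ideal, and it contains the relations of the tensor algebra because the coordinate
  function is linear.
\<close>
lemma eval_free_tensor_ideal: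
  assumes "f \<in> J"
  shows "eval_free f = \<zero>"
proof -
  interpret ev: ring_hom_ring F R eval_free using eval_free_hom .
  have mc: "monomial R r [u] \<in> carrier F" if "r \<in> carrier R" "u \<in> carrier M" for r u
    using that by (intro monomial_closed) auto
  have sub: "eval_free (x \<ominus>\<^bsub>F\<^esub> y) = eval_free x \<ominus> eval_free y" if "x \<in> carrier F" "y \<in> carrier F" for x y
    using that by (simp add: F.minus_eq R.minus_eq ev.hom_a_inv eval_free_add)
  have 1: "eval_free (monomial R \<one> [u \<oplus>\<^bsub>M\<^esub> v] \<ominus>\<^bsub>F\<^esub> (monomial R \<one> [u] \<oplus>\<^bsub>F\<^esub> monomial R \<one> [v])) = \<zero>"
    if "u \<in> carrier M" "v \<in> carrier M" for u v
    using that mc by (simp add: sub eval_free_add eval_free_monomial coord_add R.r_neg R.minus_eq)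
  have 2: "eval_free (monomial R \<one> [r \<odot>\<^bsub>M\<^esub> u] \<ominus>\<^bsub>F\<^esub> monomial R r [u]) = \<zero>"
    if "r \<in> carrier R" "u \<in> carrier M" for r u
    using that mc by (simp add: sub eval_free_monomial coord_smult R.r_neg R.minus_eq)
  have "J \<subseteq> a_kernel F R eval_free"
    unfolding tensor_ideal_def Let_def
  proof (rule F.genideal_minimal[OF ev.kernel_is_ideal])
    show "{monomial R \<one> [u \<oplus>\<^bsub>M\<^esub> v] \<ominus>\<^bsub>F\<^esub> (monomial R \<one> [u] \<oplus>\<^bsub>F\<^esub> monomial R \<one> [v])
          | u v. u \<in> carrier M \<and> v \<in> carrier M} \<union>
       {monomial R \<one> [r \<odot>\<^bsub>M\<^esub> u] \<ominus>\<^bsub>F\<^esub> monomial R r [u]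
          | r u. r \<in> carrier R \<and> u \<in> carrier M} \<subseteq> a_kernel F R eval_free"
    proof
      fix x
      assume "x \<in> {monomial R \<one> [u \<oplus>\<^bsub>M\<^esub> v] \<ominus>\<^bsub>F\<^esub> (monomial R \<one> [u] \<oplus>\<^bsub>F\<^esub> monomial R \<one> [v])
          | u v. u \<in> carrier M \<and> v \<in> carrier M} \<union>
         {monomial R \<one> [r \<odot>\<^bsub>M\<^esub> u] \<ominus>\<^bsub>F\<^esub> monomial R r [u]
          | r u. r \<in> carrier R \<and> u \<in> carrier M}"
      then have "x \<in> carrier F \<and> eval_free x = \<zero>"
        by (elim UnE CollectE exE conjE) (simp_all only: 1 2 tensor_relations_closed)
      then show "x \<in> a_kernel F R eval_free" unfolding a_kernel_def' by blast
    qed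
  qed
  then show ?thesis using assms unfolding a_kernel_def' by blast
qed

sublocale J: ideal J F using tensor_ideal_ideal .

definition tensor_class :: "('m list \<Rightarrow> 'r) \<Rightarrow> ('m list \<Rightarrow> 'r) set" where "tensor_class f = J +>\<^bsub>F\<^esub> f"

lemma tensor_class_hom: "ring_hom_ring F T tensor_class"
  using J.rcos_ring_hom_ring unfolding tensor_class_def tensor_algebra_def .

sublocale tensor_class: ring_hom_ring F T tensor_class using tensor_class_hom .

lemma tensor_algebra_carrier: "carrier T = tensor_class ` carrier F"
  unfolding tensor_algebra_def FactRing_def A_RCOSETS_def' tensor_class_def by auto

lemma tensor_class_eq_iff: "f \<in> carrier F \<Longrightarrow> g \<in> carrier F \<Longrightarrow> tensor_class f = tensor_class g \<longleftrightarrow> f \<ominus>\<^bsub>F\<^esub> g \<in> J"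
  unfolding tensor_class_def using F.quotient_eq_iff_same_a_r_cos[OF tensor_ideal_ideal] by simp

definition tensor_value :: "('m list \<Rightarrow> 'r) set \<Rightarrow> 'r" where
  "tensor_value C = eval_free (SOME f. f \<in> carrier F \<and> C = tensor_class f)"

text \<open>
  Two representatives of a class differ by an element of the tensor ideal, on which \<open>eval_free\<close> vanishes.
\<close>
lemma tensor_value_tensor_class:
  assumes f: "f \<in> carrier F"
  shows "tensor_value (tensor_class f) = eval_free f"
proof -
  interpret ev: ring_hom_ring F R eval_free using eval_free_hom .
  define g where "g = (SOME g. g \<in> carrier F \<and> tensor_class f = tensor_class g)"
  have g: "g \<in> carrier F" "tensor_class f = tensor_class g"
    using someI[of "\<lambda>g. g \<in> carrier F \<and> tensor_class f = tensor_class g" f] f unfolding g_def by auto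
  then have "eval_free (f \<ominus>\<^bsub>F\<^esub> g) = \<zero>" using f tensor_class_eq_iff eval_free_tensor_ideal by blast
  then have "eval_free f \<ominus> eval_free g = \<zero>"
    using f g by (simp add: F.minus_eq R.minus_eq ev.hom_a_inv eval_free_add)
  then have "eval_free f = eval_free g" using f g by simp
  then show ?thesis unfolding tensor_value_def g_def by simp
qed

lemma tensor_value_hom: "ring_hom_ring T R tensor_value"
proof (rule ring_hom_ringI)
  interpret ev: ring_hom_ring F R eval_free using eval_free_hom .
  show "tensor_value \<one>\<^bsub>T\<^esub> = \<one>"
    using tensor_value_tensor_class[OF F.one_closed] by simp
  fix x y assume "x \<in> carrier T" "y \<in> carrier T"
  then obtain f g where fg: "f \<in> carrier F" "x = tensor_class f" "g \<in> carrier F" "y = tensor_class g"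
    unfolding tensor_algebra_carrier by blast
  then show "tensor_value (x \<otimes>\<^bsub>T\<^esub> y) = tensor_value x \<otimes> tensor_value y"
    "tensor_value (x \<oplus>\<^bsub>T\<^esub> y) = tensor_value x \<oplus> tensor_value y"
    using tensor_value_tensor_class[of "f \<otimes>\<^bsub>F\<^esub> g"] tensor_value_tensor_class[of "f \<oplus>\<^bsub>F\<^esub> g"]
    by (simp_all add: tensor_value_tensor_class eval_free_mult eval_free_add)
qed (auto simp: tensor_class.S.ring_axioms ring_axioms tensor_algebra_carrier tensor_value_tensor_class)

text \<open>
  This is the relation of the tensor algebra for \<open>u = \<theta> u \<odot> e\<close>.
\<close>
lemma tensor_class_letter:
  assumes "u \<in> carrier M"
  shows "tensor_class (monomial R \<one> [u]) = tensor_class (monomial R (\<theta> u) [e])"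
proof -
  have "monomial R \<one> [\<theta> u \<odot>\<^bsub>M\<^esub> e] \<ominus>\<^bsub>F\<^esub> monomial R (\<theta> u) [e] \<in> J"
    using tensor_ideal_smult_relation assms by simp
  moreover have "monomial R \<one> [u] = monomial R \<one> [\<theta> u \<odot>\<^bsub>M\<^esub> e]"
    using coord_expand[OF assms] by metis
  ultimately show ?thesis using assms by (subst tensor_class_eq_iff) (auto intro!: monomial_closed)
qed

lemma tensor_class_word:
  assumes "set w \<subseteq> carrier M"
  shows "tensor_class (monomial R \<one> w) = tensor_class (monomial R (weight w) (replicate (length w) e))"
  using assms
proof (induction w)
  case (Cons u w)
  have re: "set (replicate n e) \<subseteq> carrier M" for n by auto
  have c: "u \<in> carrier M" "set w \<subseteq> carrier M" using Cons.prems by auto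
  have "monomial R \<one> (u # w) = monomial R \<one> [u] \<otimes>\<^bsub>F\<^esub> monomial R \<one> w"
    using monomial_mult[of \<one> \<one> "carrier M" "[u]" w] by simp
  then have "tensor_class (monomial R \<one> (u # w)) = tensor_class (monomial R \<one> [u]) \<otimes>\<^bsub>T\<^esub> tensor_class (monomial R \<one> w)"
    using c by (simp add: monomial_closed)
  also have "\<dots> = tensor_class (monomial R (\<theta> u) [e]) \<otimes>\<^bsub>T\<^esub> tensor_class (monomial R (weight w) (replicate (length w) e))"
    using tensor_class_letter[OF c(1)] Cons.IH[OF c(2)] by simp
  also have "\<dots> = tensor_class (monomial R (\<theta> u) [e] \<otimes>\<^bsub>F\<^esub> monomial R (weight w) (replicate (length w) e))"
    using c re by (intro tensor_class.hom_mult[symmetric] monomial_closed) auto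
  also have "\<dots> = tensor_class (monomial R (weight (u # w)) (replicate (length (u # w)) e))"
    using monomial_mult[of "\<theta> u" "weight w" "carrier M" "[e]" "replicate (length w) e"] c by simp
  finally show ?case .
qed simp

lemma tensor_class_monomial:
  assumes "r \<in> carrier R" "set w \<subseteq> carrier M"
  shows "tensor_class (monomial R r w) = tensor_class (monomial R (r \<otimes> weight w) (replicate (length w) e))"
proof -
  have re: "set (replicate n e) \<subseteq> carrier M" for n by auto
  have "monomial R r w = monomial R r [] \<otimes>\<^bsub>F\<^esub> monomial R \<one> w"
    using monomial_mult[of r \<one> "carrier M" "[]" w] assms by simp
  then have "tensor_class (monomial R r w) = tensor_class (monomial R r []) \<otimes>\<^bsub>T\<^esub> tensor_class (monomial R \<one> w)"
    using assms by (simp add: monomial_closed)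
  also have "\<dots> = tensor_class (monomial R r [] \<otimes>\<^bsub>F\<^esub> monomial R (weight w) (replicate (length w) e))"
    unfolding tensor_class_word[OF assms(2)]
    using assms re by (intro tensor_class.hom_mult[symmetric] monomial_closed) auto
  also have "\<dots> = tensor_class (monomial R (r \<otimes> weight w) (replicate (length w) e))"
    using monomial_mult[of r "weight w" "carrier M" "[]" "replicate (length w) e"] assms by simp
  finally show ?thesis .
qed

lemma monomial_add:
  assumes "r \<in> carrier R" "s \<in> carrier R"
  shows "monomial R r w \<oplus>\<^bsub>F\<^esub> monomial R s w = monomial R (r \<oplus> s) w"
  using assms by (auto simp: free_algebra_simps monomial_def)

text \<open>
  In the tensor algebra every homogeneous element of degree \<open>n\<close> is a scalar multiple of \<open>e\<^sup>n\<close>, the scalar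
  being its value at \<open>e = \<one>\<close>.
\<close>
lemma tensor_class_homogeneous:
  assumes "f \<in> carrier F" "\<And>w. f w \<noteq> \<zero> \<Longrightarrow> length w = n"
  shows "tensor_class f = tensor_class (monomial R (eval_free f) (replicate n e))"
  using assms
proof (induction f rule: free_algebra_induct)
  case zero
  have "monomial R \<zero> (replicate n e) = (\<lambda>w. \<zero>)" by (auto simp: monomial_def)
  then show ?case by (simp add: eval_free_zero)
next
  case (add f r w)
  have re: "set (replicate n e) \<subseteq> carrier M" by auto
  have c: "\<And>v. f v \<in> carrier R" using add.hyps(1) unfolding free_algebra_carrier by blast
  have val: "(f \<oplus>\<^bsub>F\<^esub> monomial R r w) v = (if v = w then r else f v)" for v
    using add.hyps(2,5) c by (simp add: free_algebra_simps monomial_def)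
  have n: "length w = n" using add.prems[of w] add.hyps(3) unfolding val by simp
  have "length v = n" if "f v \<noteq> \<zero>" for v
    using add.prems[of v] add.hyps(5) that unfolding val by (cases "v = w") auto
  then have IH: "tensor_class f = tensor_class (monomial R (eval_free f) (replicate n e))" using add.IH by blast
  have m: "monomial R r w \<in> carrier F" using monomial_closed[OF add.hyps(2,4)] .
  have "tensor_class (f \<oplus>\<^bsub>F\<^esub> monomial R r w) = tensor_class f \<oplus>\<^bsub>T\<^esub> tensor_class (monomial R r w)"
    using add.hyps(1) m by simp
  also have "\<dots> = tensor_class (monomial R (eval_free f) (replicate n e)
      \<oplus>\<^bsub>F\<^esub> monomial R (r \<otimes> weight w) (replicate n e))"
    unfolding IH tensor_class_monomial[OF add.hyps(2,4)] n
    using add.hyps(1,2,4) re by (intro tensor_class.hom_add[symmetric] monomial_closed) auto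
  also have "\<dots> = tensor_class (monomial R (eval_free (f \<oplus>\<^bsub>F\<^esub> monomial R r w)) (replicate n e))"
    using add.hyps(1,2,4) m by (simp add: monomial_add eval_free_add eval_free_monomial)
  finally show ?case .
qed

lemma tensor_power_iff:
  "C \<in> tensor_power R M n \<longleftrightarrow> (\<exists>f\<in>carrier F. C = tensor_class f \<and> (\<forall>w. f w \<noteq> \<zero> \<longrightarrow> length w = n))"
  unfolding tensor_power_def tensor_class_def by blast

lemma tensor_power_subset: "tensor_power R M n \<subseteq> carrier T"
  using tensor_power_iff tensor_algebra_carrier by auto

text \<open>
  So setting \<open>e = \<one>\<close> is injective in each degree.
\<close>
lemma tensor_power_value_zero:
  assumes "C \<in> tensor_power R M n" "tensor_value C = \<zero>"
  shows "C = \<zero>\<^bsub>T\<^esub>"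
proof -
  obtain f where f: "f \<in> carrier F" "C = tensor_class f" "\<And>w. f w \<noteq> \<zero> \<Longrightarrow> length w = n"
    using assms(1) tensor_power_iff by auto
  then have "eval_free f = \<zero>" using assms(2) tensor_value_tensor_class by simp
  moreover have "monomial R \<zero> (replicate n e) = \<zero>\<^bsub>F\<^esub>"
    by (auto simp: monomial_def free_algebra_simps)
  ultimately show ?thesis using tensor_class_homogeneous[OF f(1,3)] f(2) by simp
qed

lemma tensor_power_add:
  assumes "C \<in> tensor_power R M n" "D \<in> tensor_power R M n"
  shows "C \<oplus>\<^bsub>T\<^esub> D \<in> tensor_power R M n"
proof -
  obtain f where f: "f \<in> carrier F" "C = tensor_class f" "\<forall>w. f w \<noteq> \<zero> \<longrightarrow> length w = n"
    using assms(1) tensor_power_iff by auto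
  obtain g where g: "g \<in> carrier F" "D = tensor_class g" "\<forall>w. g w \<noteq> \<zero> \<longrightarrow> length w = n"
    using assms(2) tensor_power_iff by auto
  have "\<forall>w. (f \<oplus>\<^bsub>F\<^esub> g) w \<noteq> \<zero> \<longrightarrow> length w = n"
    unfolding free_algebra_simps using f(3) g(3) by (metis R.l_zero R.zero_closed)
  moreover have "C \<oplus>\<^bsub>T\<^esub> D = tensor_class (f \<oplus>\<^bsub>F\<^esub> g)" using f g by simp
  ultimately show ?thesis using f(1) g(1) tensor_power_iff F.a_closed by metis
qed

lemma tensor_power_zero: "\<zero>\<^bsub>T\<^esub> \<in> tensor_power R M n"
proof -
  have "\<forall>w. \<zero>\<^bsub>F\<^esub> w \<noteq> \<zero> \<longrightarrow> length w = n" by (simp add: free_algebra_simps(1))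
  then show ?thesis unfolding tensor_power_iff using tensor_class.hom_zero F.zero_closed by metis
qed

lemma tensor_power_mult:
  assumes "C \<in> tensor_power R M n" "D \<in> tensor_power R M m"
  shows "C \<otimes>\<^bsub>T\<^esub> D \<in> tensor_power R M (n + m)"
proof -
  obtain f where f: "f \<in> carrier F" "C = tensor_class f" "\<And>w. f w \<noteq> \<zero> \<Longrightarrow> length w = n"
    using assms(1) tensor_power_iff by auto
  obtain g where g: "g \<in> carrier F" "D = tensor_class g" "\<And>w. g w \<noteq> \<zero> \<Longrightarrow> length w = m"
    using assms(2) tensor_power_iff by auto
  have c: "\<And>w. f w \<in> carrier R" "\<And>w. g w \<in> carrier R"
    using f(1) g(1) unfolding free_algebra_carrier by blast+
  have "length w = n + m" if nz: "(f \<otimes>\<^bsub>F\<^esub> g) w \<noteq> \<zero>" for w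
  proof -
    obtain u v where "w = u @ v" "f u \<noteq> \<zero>" "g v \<noteq> \<zero>"
      using convolution_nonzeroD[OF nz[unfolded free_algebra_mult] c] by blast
    then show ?thesis using f(3) g(3) by simp
  qed
  moreover have "C \<otimes>\<^bsub>T\<^esub> D = tensor_class (f \<otimes>\<^bsub>F\<^esub> g)" using f g by simp
  ultimately show ?thesis using f(1) g(1) tensor_power_iff F.m_closed by metis
qed

lemma tensor_power_monomial:
  "r \<in> carrier R \<Longrightarrow> set w \<subseteq> carrier M \<Longrightarrow> tensor_class (monomial R r w) \<in> tensor_power R M (length w)"
  unfolding tensor_power_iff
  by (rule bexI[of _ "monomial R r w", OF _ monomial_closed]) (auto simp: monomial_def)

text \<open>
  Adding up homogeneous pieces monomial by monomial. The range of degrees grows with the longest word,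
  so shorter sums are padded by zeros.
\<close>
lemma tensor_algebra_decompose:
  assumes "C \<in> carrier T"
  shows "\<exists>N h. (\<forall>n. h n \<in> tensor_power R M n) \<and> C = (\<Oplus>\<^bsub>T\<^esub>n\<in>{..N}. h n)"
proof -
  have hT: "h n \<in> carrier T" if "\<forall>n. h n \<in> tensor_power R M n" for h n
    using that tensor_power_subset by blast
  have pad: "\<exists>h'. (\<forall>n. h' n \<in> tensor_power R M n) \<and> (\<Oplus>\<^bsub>T\<^esub>n\<in>{..N}. h n) = (\<Oplus>\<^bsub>T\<^esub>n\<in>{..N'}. h' n)"
    if h: "\<forall>n. h n \<in> tensor_power R M n" and "N \<le> N'" for N N' h
  proof (intro exI conjI)
    let ?h = "\<lambda>n. if n \<le> N then h n else \<zero>\<^bsub>T\<^esub>"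
    show "\<forall>n. ?h n \<in> tensor_power R M n" using h tensor_power_zero by simp
    show "(\<Oplus>\<^bsub>T\<^esub>n\<in>{..N}. h n) = (\<Oplus>\<^bsub>T\<^esub>n\<in>{..N'}. ?h n)"
      by (rule tensor_class.S.add.finprod_mono_neutral_cong_left) (use \<open>N \<le> N'\<close> hT[OF h] in auto)
  qed
  obtain f where f: "f \<in> carrier F" "C = tensor_class f" using assms unfolding tensor_algebra_carrier by blast
  have "\<exists>N h. (\<forall>n. h n \<in> tensor_power R M n) \<and> tensor_class f = (\<Oplus>\<^bsub>T\<^esub>n\<in>{..N}. h n)"
    using f(1)
  proof (induction f rule: free_algebra_induct)
    case zero
    have "tensor_class (\<lambda>w. \<zero>) = \<zero>\<^bsub>T\<^esub>" using tensor_class.hom_zero by (simp add: free_algebra_simps)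
    then show ?case
      using tensor_power_zero by (intro exI[of _ 0] exI[of _ "\<lambda>n. \<zero>\<^bsub>T\<^esub>"]) simp
  next
    case (add f r w)
    define m where "m = tensor_class (monomial R r w)"
    have m: "m \<in> tensor_power R M (length w)" "m \<in> carrier T"
      using tensor_power_monomial[OF add.hyps(2,4)] tensor_power_subset unfolding m_def by auto
    obtain N h where h: "\<forall>n. h n \<in> tensor_power R M n" "tensor_class f = (\<Oplus>\<^bsub>T\<^esub>n\<in>{..N}. h n)"
      using add.IH by blast
    define N' where "N' = max N (length w)"
    obtain h' where h': "\<forall>n. h' n \<in> tensor_power R M n" "tensor_class f = (\<Oplus>\<^bsub>T\<^esub>n\<in>{..N'}. h' n)"
      using pad[OF h(1), of N N'] h(2) unfolding N'_def by auto
    let ?g = "\<lambda>n. if length w = n then m else \<zero>\<^bsub>T\<^esub>"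
    have g: "\<forall>n. ?g n \<in> tensor_power R M n" using m(1) tensor_power_zero by simp
    have "(\<Oplus>\<^bsub>T\<^esub>n\<in>{..N'}. ?g n) = m"
      using tensor_class.S.finsum_singleton[of "length w" "{..N'}" "\<lambda>_. m"] m(2) unfolding N'_def by simp
    moreover have "tensor_class (f \<oplus>\<^bsub>F\<^esub> monomial R r w) = tensor_class f \<oplus>\<^bsub>T\<^esub> m"
      using add.hyps(1) monomial_closed[OF add.hyps(2,4)] unfolding m_def by simp
    moreover have "(\<Oplus>\<^bsub>T\<^esub>n\<in>{..N'}. h' n \<oplus>\<^bsub>T\<^esub> ?g n) = tensor_class f \<oplus>\<^bsub>T\<^esub> (\<Oplus>\<^bsub>T\<^esub>n\<in>{..N'}. ?g n)"
      unfolding h'(2) using hT[OF h'(1)] hT[OF g] by (intro tensor_class.S.finsum_addf) auto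
    ultimately have "tensor_class (f \<oplus>\<^bsub>F\<^esub> monomial R r w) = (\<Oplus>\<^bsub>T\<^esub>n\<in>{..N'}. h' n \<oplus>\<^bsub>T\<^esub> ?g n)" by simp
    moreover have "\<forall>n. h' n \<oplus>\<^bsub>T\<^esub> ?g n \<in> tensor_power R M n"
      using h'(1) g tensor_power_add by blast
    ultimately show ?case by (intro exI conjI)
  qed
  then show ?thesis using f(2) by simp
qed

end

section \<open>Global sections of the structure sheaf of a spectrum\<close>

lemma Spec_simps:
  "base (Spec R) = zariski R"
  "\<one>\<^bsub>sec (Spec R) U\<^esub> = (\<lambda>\<pp>\<in>U. frac R \<pp> \<one>\<^bsub>R\<^esub> \<one>\<^bsub>R\<^esub>)"
  "\<zero>\<^bsub>sec (Spec R) U\<^esub> = (\<lambda>\<pp>\<in>U. frac R \<pp> \<zero>\<^bsub>R\<^esub> \<one>\<^bsub>R\<^esub>)"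
  "s \<otimes>\<^bsub>sec (Spec R) U\<^esub> t = (\<lambda>\<pp>\<in>U. s \<pp> \<otimes>\<^bsub>localization R \<pp>\<^esub> t \<pp>)"
  "s \<oplus>\<^bsub>sec (Spec R) U\<^esub> t = (\<lambda>\<pp>\<in>U. s \<pp> \<oplus>\<^bsub>localization R \<pp>\<^esub> t \<pp>)"
  by (simp_all add: Spec_def pointwise_ring_def localization_def)

lemma Spec_sec_carrier:
  "s \<in> carrier (sec (Spec R) U) \<longleftrightarrow> s \<in> (\<Pi>\<^sub>E \<pp>\<in>U. carrier (localization R \<pp>)) \<and>
     (\<forall>\<pp>\<in>U. \<exists>V a f. openin (zariski R) V \<and> \<pp> \<in> V \<and> V \<subseteq> U \<and> a \<in> carrier R \<and> f \<in> carrier R \<and>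
       (\<forall>\<qq>\<in>V. f \<notin> \<qq> \<and> s \<qq> = frac R \<qq> a f))"
  by (simp add: Spec_def)

lemma prime_one_notin: "primeideal \<pp> R \<Longrightarrow> \<one>\<^bsub>R\<^esub> \<notin> \<pp>"
  using ideal.one_imp_carrier primeideal.I_notcarr primeideal.axioms(1) by metis

lemma topspace_zariski:
  assumes "ring R"
  shows "topspace (zariski R) = {\<pp>. primeideal \<pp> R}"
proof -
  interpret ring R by fact
  show ?thesis
    unfolding zariski_def topology_generated_by_topspace using prime_one_notin one_closed by blast
qed

lemma openin_zariski_basic:
  "a \<in> carrier R \<Longrightarrow> openin (zariski R) {\<pp>. primeideal \<pp> R \<and> a \<notin> \<pp>}"
  unfolding zariski_def by (rule topology_generated_by_Basis) blast

text \<open>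
  The operations of a localization are unions over all representatives. All members of such a union agree,
  so one pair of representatives computes it.
\<close>
lemma UN_pairs_const:
  assumes "(a0, s0) \<in> A" "(b0, t0) \<in> B" "\<And>a s b t. (a, s) \<in> A \<Longrightarrow> (b, t) \<in> B \<Longrightarrow> G a s b t = c"
  shows "(\<Union>(a, s)\<in>A. \<Union>(b, t)\<in>B. G a s b t) = c"
proof (intro equalityI subsetI)
  fix z assume "z \<in> (\<Union>(a, s)\<in>A. \<Union>(b, t)\<in>B. G a s b t)"
  then obtain a s b t where "(a, s) \<in> A" "(b, t) \<in> B" "z \<in> G a s b t" by auto
  then show "z \<in> c" using assms(3) by simp
next
  fix z assume "z \<in> c"
  then have "z \<in> G a0 s0 b0 t0" using assms by simp
  then show "z \<in> (\<Union>(a, s)\<in>A. \<Union>(b, t)\<in>B. G a s b t)"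
    using assms(1,2) by (intro UN_I[of "(a0, s0)"] UN_I[of "(b0, t0)"] case_prodI) (simp_all, blast)
qed

locale cring_prime = cring R + P: primeideal \<pp> R for R (structure) and \<pp>
begin

lemma compl_mult: "s \<in> carrier R - \<pp> \<Longrightarrow> t \<in> carrier R - \<pp> \<Longrightarrow> s \<otimes> t \<in> carrier R - \<pp>"
  using P.I_prime by blast

lemma frac_memI: "a \<in> carrier R \<Longrightarrow> s \<in> carrier R - \<pp> \<Longrightarrow> (a, s) \<in> frac R \<pp> a s"
  unfolding frac_def by auto

text \<open>
  Transitivity of the equivalence of fractions, in the form that one inclusion between the classes needs:
  the witnesses \<open>u\<close> and \<open>v\<close> combine to \<open>u v s\<close>.
\<close>
lemma frac_eqI:
  assumes ab: "a \<in> carrier R" "b \<in> carrier R" and st: "s \<in> carrier R - \<pp>" "t \<in> carrier R - \<pp>"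
    and u: "u \<in> carrier R - \<pp>" "u \<otimes> (a \<otimes> t) = u \<otimes> (b \<otimes> s)"
  shows "frac R \<pp> a s = frac R \<pp> b t"
proof -
  have sub: "frac R \<pp> a s \<subseteq> frac R \<pp> b t"
    if ab: "a \<in> carrier R" "b \<in> carrier R" and st: "s \<in> carrier R - \<pp>" "t \<in> carrier R - \<pp>"
      and u: "u \<in> carrier R - \<pp>" "u \<otimes> (a \<otimes> t) = u \<otimes> (b \<otimes> s)" for a b s t u
  proof (clarsimp simp: frac_def)
    fix c r v
    assume c: "c \<in> carrier R" "r \<in> carrier R" "r \<notin> \<pp>"
      and v: "v \<in> carrier R" "v \<notin> \<pp>" "v \<otimes> (a \<otimes> r) = v \<otimes> (c \<otimes> s)"
    have "(u \<otimes> v \<otimes> s) \<otimes> (b \<otimes> r) = (v \<otimes> r) \<otimes> (u \<otimes> (b \<otimes> s))"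
      using ab st u(1) c v(1,2) by (simp add: m_ac)
    also have "\<dots> = (u \<otimes> t) \<otimes> (v \<otimes> (a \<otimes> r))"
      unfolding u(2)[symmetric] using ab st u(1) c v(1,2) by (simp add: m_ac)
    also have "\<dots> = (u \<otimes> v \<otimes> s) \<otimes> (c \<otimes> t)"
      unfolding v(3) using ab st u(1) c v(1,2) by (simp add: m_ac)
    finally have "(u \<otimes> v \<otimes> s) \<otimes> (b \<otimes> r) = (u \<otimes> v \<otimes> s) \<otimes> (c \<otimes> t)" .
    moreover have "u \<otimes> v \<otimes> s \<in> carrier R - \<pp>"
      using compl_mult u(1) v(1,2) st(1) by blast
    ultimately show "\<exists>w\<in>carrier R - \<pp>. w \<otimes> (b \<otimes> r) = w \<otimes> (c \<otimes> t)" by blast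
  qed
  from sub[OF ab st u] sub[OF ab(2,1) st(2,1) u(1) u(2)[symmetric]] show ?thesis by blast
qed

lemma frac_memD:
  assumes "a \<in> carrier R" "s \<in> carrier R - \<pp>" "(b, t) \<in> frac R \<pp> a s"
  shows "b \<in> carrier R" "t \<in> carrier R - \<pp>" "\<exists>u\<in>carrier R - \<pp>. u \<otimes> (a \<otimes> t) = u \<otimes> (b \<otimes> s)"
  using assms unfolding frac_def by auto

lemma localization_mult:
  assumes a: "a \<in> carrier R" "s \<in> carrier R - \<pp>" and b: "b \<in> carrier R" "t \<in> carrier R - \<pp>"
  shows "frac R \<pp> a s \<otimes>\<^bsub>localization R \<pp>\<^esub> frac R \<pp> b t = frac R \<pp> (a \<otimes> b) (s \<otimes> t)"
proof -
  have eq: "frac R \<pp> (a' \<otimes> b') (s' \<otimes> t') = frac R \<pp> (a \<otimes> b) (s \<otimes> t)"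
    if as: "(a', s') \<in> frac R \<pp> a s" and bt: "(b', t') \<in> frac R \<pp> b t" for a' s' b' t'
  proof -
    note a' = frac_memD(1,2)[OF a as] and b' = frac_memD(1,2)[OF b bt]
    have R: "a \<in> carrier R" "s \<in> carrier R" "b \<in> carrier R" "t \<in> carrier R"
      "a' \<in> carrier R" "s' \<in> carrier R" "b' \<in> carrier R" "t' \<in> carrier R"
      using a b a' b' by auto
    obtain u where u: "u \<in> carrier R - \<pp>" "u \<otimes> (a \<otimes> s') = u \<otimes> (a' \<otimes> s)"
      using frac_memD(3)[OF a as] by blast
    obtain v where v: "v \<in> carrier R - \<pp>" "v \<otimes> (b \<otimes> t') = v \<otimes> (b' \<otimes> t)"
      using frac_memD(3)[OF b bt] by blast
    have uv: "u \<in> carrier R" "v \<in> carrier R" using u(1) v(1) by auto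
    have "(u \<otimes> v) \<otimes> ((a' \<otimes> b') \<otimes> (s \<otimes> t)) = (u \<otimes> (a' \<otimes> s)) \<otimes> (v \<otimes> (b' \<otimes> t))"
      using R uv by algebra
    also have "\<dots> = (u \<otimes> v) \<otimes> ((a \<otimes> b) \<otimes> (s' \<otimes> t'))"
      unfolding u(2)[symmetric] v(2)[symmetric] using R uv by algebra
    finally have "(u \<otimes> v) \<otimes> ((a' \<otimes> b') \<otimes> (s \<otimes> t)) = (u \<otimes> v) \<otimes> ((a \<otimes> b) \<otimes> (s' \<otimes> t'))" .
    then show ?thesis
      using a b a' b' compl_mult u(1) v(1) by (intro frac_eqI[of _ _ _ _ "u \<otimes> v"]) auto
  qed
  have "frac R \<pp> a s \<otimes>\<^bsub>localization R \<pp>\<^esub> frac R \<pp> b t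
      = (\<Union>(a', s')\<in>frac R \<pp> a s. \<Union>(b', t')\<in>frac R \<pp> b t. frac R \<pp> (a' \<otimes> b') (s' \<otimes> t'))"
    by (simp add: localization_def)
  also have "\<dots> = frac R \<pp> (a \<otimes> b) (s \<otimes> t)"
    by (rule UN_pairs_const[OF frac_memI[OF a] frac_memI[OF b] eq])
  finally show ?thesis .
qed

lemma localization_add:
  assumes a: "a \<in> carrier R" "s \<in> carrier R - \<pp>" and b: "b \<in> carrier R" "t \<in> carrier R - \<pp>"
  shows "frac R \<pp> a s \<oplus>\<^bsub>localization R \<pp>\<^esub> frac R \<pp> b t = frac R \<pp> (a \<otimes> t \<oplus> b \<otimes> s) (s \<otimes> t)"
proof -
  have eq: "frac R \<pp> (a' \<otimes> t' \<oplus> b' \<otimes> s') (s' \<otimes> t') = frac R \<pp> (a \<otimes> t \<oplus> b \<otimes> s) (s \<otimes> t)"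
    if as: "(a', s') \<in> frac R \<pp> a s" and bt: "(b', t') \<in> frac R \<pp> b t" for a' s' b' t'
  proof -
    note a' = frac_memD(1,2)[OF a as] and b' = frac_memD(1,2)[OF b bt]
    have R: "a \<in> carrier R" "s \<in> carrier R" "b \<in> carrier R" "t \<in> carrier R"
      "a' \<in> carrier R" "s' \<in> carrier R" "b' \<in> carrier R" "t' \<in> carrier R"
      using a b a' b' by auto
    obtain u where u: "u \<in> carrier R - \<pp>" "u \<otimes> (a \<otimes> s') = u \<otimes> (a' \<otimes> s)"
      using frac_memD(3)[OF a as] by blast
    obtain v where v: "v \<in> carrier R - \<pp>" "v \<otimes> (b \<otimes> t') = v \<otimes> (b' \<otimes> t)"
      using frac_memD(3)[OF b bt] by blast
    have uv: "u \<in> carrier R" "v \<in> carrier R" using u(1) v(1) by auto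
    have "(u \<otimes> v) \<otimes> ((a' \<otimes> t' \<oplus> b' \<otimes> s') \<otimes> (s \<otimes> t))
        = (u \<otimes> (a' \<otimes> s)) \<otimes> (v \<otimes> (t \<otimes> t')) \<oplus> (v \<otimes> (b' \<otimes> t)) \<otimes> (u \<otimes> (s \<otimes> s'))"
      using R uv by algebra
    also have "\<dots> = (u \<otimes> v) \<otimes> ((a \<otimes> t \<oplus> b \<otimes> s) \<otimes> (s' \<otimes> t'))"
      unfolding u(2)[symmetric] v(2)[symmetric]
      using R uv by algebra
    finally have "(u \<otimes> v) \<otimes> ((a' \<otimes> t' \<oplus> b' \<otimes> s') \<otimes> (s \<otimes> t))
        = (u \<otimes> v) \<otimes> ((a \<otimes> t \<oplus> b \<otimes> s) \<otimes> (s' \<otimes> t'))" .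
    then show ?thesis
      using a b a' b' compl_mult u(1) v(1) by (intro frac_eqI[of _ _ _ _ "u \<otimes> v"]) auto
  qed
  have "frac R \<pp> a s \<oplus>\<^bsub>localization R \<pp>\<^esub> frac R \<pp> b t
      = (\<Union>(a', s')\<in>frac R \<pp> a s. \<Union>(b', t')\<in>frac R \<pp> b t. frac R \<pp> (a' \<otimes> t' \<oplus> b' \<otimes> s') (s' \<otimes> t'))"
    by (simp add: localization_def)
  also have "\<dots> = frac R \<pp> (a \<otimes> t \<oplus> b \<otimes> s) (s \<otimes> t)"
    by (rule UN_pairs_const[OF frac_memI[OF a] frac_memI[OF b] eq])
  finally show ?thesis .
qed

end

text \<open>
  The global section given by one fraction \<open>a / f\<close>, where \<open>f\<close> should vanish nowhere.
\<close>
definition frac_section :: "('r, 'e) ring_scheme \<Rightarrow> 'r \<Rightarrow> 'r \<Rightarrow> 'r set \<Rightarrow> ('r \<times> 'r) set" where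
  "frac_section R a f = (\<lambda>\<pp>\<in>topspace (zariski R). frac R \<pp> a f)"

abbreviation spec_ring :: "('r, 'e) ring_scheme \<Rightarrow> ('r set \<Rightarrow> ('r \<times> 'r) set) ring" where
  "spec_ring R \<equiv> sec (Spec R) (topspace (zariski R))"

definition nowhere_vanishing :: "('r, 'e) ring_scheme \<Rightarrow> 'r \<Rightarrow> bool" where
  "nowhere_vanishing R f \<longleftrightarrow> f \<in> carrier R \<and> (\<forall>\<pp>. primeideal \<pp> R \<longrightarrow> f \<notin> \<pp>)"

context cring
begin

lemma nowhere_vanishing_one: "nowhere_vanishing R \<one>"
  unfolding nowhere_vanishing_def using prime_one_notin by auto

lemma nowhere_vanishing_mult:
  "nowhere_vanishing R f \<Longrightarrow> nowhere_vanishing R g \<Longrightarrow> nowhere_vanishing R (f \<otimes> g)"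
  unfolding nowhere_vanishing_def using primeideal.I_prime[of _ R f g] by auto

lemma cring_prime_topspace: "\<pp> \<in> topspace (zariski R) \<Longrightarrow> cring_prime R \<pp>"
  using topspace_zariski[OF ring_axioms] is_cring by (simp add: cring_prime_def)

lemma nowhere_vanishingD:
  "nowhere_vanishing R f \<Longrightarrow> \<pp> \<in> topspace (zariski R) \<Longrightarrow> f \<in> carrier R - \<pp>"
  unfolding nowhere_vanishing_def topspace_zariski[OF ring_axioms] by blast

lemma frac_section_closed:
  assumes "a \<in> carrier R" "nowhere_vanishing R f"
  shows "frac_section R a f \<in> carrier (spec_ring R)"
proof -
  have "frac_section R a f \<in> (\<Pi>\<^sub>E \<pp>\<in>topspace (zariski R). carrier (localization R \<pp>))"
    unfolding frac_section_def localization_def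
    using assms(1) nowhere_vanishingD[OF assms(2)] by (auto intro!: exI)
  moreover have "f \<in> carrier R" using assms(2) by (simp add: nowhere_vanishing_def)
  ultimately show ?thesis
    unfolding Spec_sec_carrier
    using assms(1) nowhere_vanishingD[OF assms(2)] openin_topspace[of "zariski R"]
    by - (intro conjI ballI, assumption,
      rule exI[of _ "topspace (zariski R)"], rule exI[of _ a], rule exI[of _ f],
        auto simp: frac_section_def)
qed

lemma frac_section_mult:
  assumes "a \<in> carrier R" "nowhere_vanishing R f" "b \<in> carrier R" "nowhere_vanishing R g"
  shows "frac_section R a f \<otimes>\<^bsub>spec_ring R\<^esub> frac_section R b g = frac_section R (a \<otimes> b) (f \<otimes> g)"
  unfolding Spec_simps frac_section_def
  using assms cring_prime.localization_mult[OF cring_prime_topspace] nowhere_vanishingD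
  by (intro restrict_ext) simp

lemma frac_section_add:
  assumes "a \<in> carrier R" "nowhere_vanishing R f" "b \<in> carrier R" "nowhere_vanishing R g"
  shows "frac_section R a f \<oplus>\<^bsub>spec_ring R\<^esub> frac_section R b g
    = frac_section R (a \<otimes> g \<oplus> b \<otimes> f) (f \<otimes> g)"
  unfolding Spec_simps frac_section_def
  using assms cring_prime.localization_add[OF cring_prime_topspace] nowhere_vanishingD
  by (intro restrict_ext) simp

lemma frac_section_one: "\<one>\<^bsub>spec_ring R\<^esub> = frac_section R \<one> \<one>"
  unfolding Spec_simps frac_section_def ..

lemma frac_section_eqI:
  assumes "a \<in> carrier R" "nowhere_vanishing R f" "b \<in> carrier R" "nowhere_vanishing R g"
    "a \<otimes> g = b \<otimes> f"
  shows "frac_section R a f = frac_section R b g"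
  unfolding frac_section_def
proof (intro restrict_ext)
  fix \<pp> assume p: "\<pp> \<in> topspace (zariski R)"
  interpret cring_prime R \<pp> using cring_prime_topspace[OF p] .
  show "frac R \<pp> a f = frac R \<pp> b g"
    using assms nowhere_vanishingD[OF _ p] nowhere_vanishingD[OF nowhere_vanishing_one p]
    by (intro frac_eqI[of _ _ _ _ \<one>]) auto
qed

text \<open>
  A section is a fraction near each point, and the only neighbourhood of a point is the whole space.
\<close>
lemma spec_ring_frac_section:
  assumes triv: "\<And>U. openin (zariski R) U \<Longrightarrow> U = {} \<or> U = topspace (zariski R)"
    and ne: "topspace (zariski R) \<noteq> {}" and s: "s \<in> carrier (spec_ring R)"
  obtains a f where "a \<in> carrier R" "nowhere_vanishing R f" "s = frac_section R a f"
proof -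
  obtain \<pp> where p: "\<pp> \<in> topspace (zariski R)" using ne by blast
  have "\<exists>V a f. openin (zariski R) V \<and> \<pp> \<in> V \<and> V \<subseteq> topspace (zariski R) \<and>
      a \<in> carrier R \<and> f \<in> carrier R \<and> (\<forall>\<qq>\<in>V. f \<notin> \<qq> \<and> s \<qq> = frac R \<qq> a f)"
    using s[unfolded Spec_sec_carrier, THEN conjunct2] p by (rule bspec)
  then obtain V a f where "openin (zariski R) V \<and> \<pp> \<in> V \<and> V \<subseteq> topspace (zariski R) \<and>
      a \<in> carrier R \<and> f \<in> carrier R \<and> (\<forall>\<qq>\<in>V. f \<notin> \<qq> \<and> s \<qq> = frac R \<qq> a f)"
    by (elim exE)
  then have V: "openin (zariski R) V" "\<pp> \<in> V" "a \<in> carrier R" "f \<in> carrier R"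
      "\<And>\<qq>. \<qq> \<in> V \<Longrightarrow> f \<notin> \<qq> \<and> s \<qq> = frac R \<qq> a f"
    by simp_all
  have VT: "V = topspace (zariski R)" using triv[OF V(1)] V(2) by blast
  have "nowhere_vanishing R f"
    using V(4,5) unfolding VT topspace_zariski[OF ring_axioms] nowhere_vanishing_def by auto
  moreover have "s = frac_section R a f"
  proof
    fix \<qq>
    have "s \<in> extensional (topspace (zariski R))"
      using s unfolding Spec_sec_carrier by (auto simp: PiE_def)
    then show "s \<qq> = frac_section R a f \<qq>"
      using V(5) unfolding VT frac_section_def by (cases "\<qq> \<in> topspace (zariski R)") (auto simp: extensional_def)
  qed
  ultimately show thesis using that V(3) by blast
qed

text \<open>
  A section is a fraction \<open>a / f\<close>. The open set where \<open>a\<close> does not vanish is empty or everything. In the first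
  case \<open>a\<close> lies in all primes and is nilpotent; in the second \<open>f / a\<close> is an inverse. The argument is carried out
  in the ring \<open>A\<close>, onto which the sections map.
\<close>
lemma unit_or_nilpotent_of_indiscrete_Spec:
  assumes triv: "\<And>U. openin (zariski R) U \<Longrightarrow> U = {} \<or> U = topspace (zariski R)"
    and ne: "topspace (zariski R) \<noteq> {}"
    and A: "cring A" and h: "h \<in> ring_hom (spec_ring R) A" "h ` carrier (spec_ring R) = carrier A"
    and x: "x \<in> carrier A"
  shows "x \<in> Units A \<or> (\<exists>n::nat. x [^]\<^bsub>A\<^esub> n = \<zero>\<^bsub>A\<^esub>)"
proof -
  interpret A: cring A by fact
  define H where "H a f = h (frac_section R a f)" for a f
  have H_closed: "H a f \<in> carrier A" if "a \<in> carrier R" "nowhere_vanishing R f" for a f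
    using h(1) frac_section_closed that unfolding H_def ring_hom_def by blast
  have H_mult: "H a f \<otimes>\<^bsub>A\<^esub> H b g = H (a \<otimes> b) (f \<otimes> g)"
    if "a \<in> carrier R" "nowhere_vanishing R f" "b \<in> carrier R" "nowhere_vanishing R g" for a b f g
    unfolding H_def frac_section_mult[OF that, symmetric]
    by (rule ring_hom_mult[OF h(1) frac_section_closed[OF that(1,2)] frac_section_closed[OF that(3,4)], symmetric])
  have H_one: "H \<one> \<one> = \<one>\<^bsub>A\<^esub>"
    unfolding H_def using ring_hom_one[OF h(1)] frac_section_one by simp
  have H_surj: "\<exists>a f. a \<in> carrier R \<and> nowhere_vanishing R f \<and> y = H a f" if y: "y \<in> carrier A" for y
  proof -
    obtain s where s: "s \<in> carrier (spec_ring R)" "y = h s" using y h(2) by auto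
    obtain a f where "a \<in> carrier R" "nowhere_vanishing R f" "s = frac_section R a f"
      by (rule spec_ring_frac_section[OF triv ne s(1)])
    then show ?thesis using s(2) unfolding H_def by blast
  qed
  have fR: "f \<in> carrier R" if "nowhere_vanishing R f" for f
    using that by (simp add: nowhere_vanishing_def)
  (* The zero of A is the image of some a / g, and multiplying by a / g does not change 0 / f. *)
  have H_zero: "H \<zero> f = \<zero>\<^bsub>A\<^esub>" if f: "nowhere_vanishing R f" for f
  proof -
    obtain a g where ag: "a \<in> carrier R" "nowhere_vanishing R g" "\<zero>\<^bsub>A\<^esub> = H a g"
      using H_surj[OF A.zero_closed] by blast
    have "H \<zero> f = H (\<zero> \<otimes> a) (f \<otimes> g)"
      unfolding H_def using ag(1,2) f fR nowhere_vanishing_mult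
      by (intro arg_cong[where f = h] frac_section_eqI) auto
    also have "\<dots> = H \<zero> f \<otimes>\<^bsub>A\<^esub> H a g" using H_mult ag(1,2) f by simp
    also have "\<dots> = \<zero>\<^bsub>A\<^esub>" unfolding ag(3)[symmetric] using H_closed[OF _ f] by simp
    finally show ?thesis .
  qed
  obtain a f where af: "a \<in> carrier R" "nowhere_vanishing R f" "x = H a f" using H_surj[OF x] by blast
  define D where "D = {\<pp>. primeideal \<pp> R \<and> a \<notin> \<pp>}"
  have "D = {} \<or> D = topspace (zariski R)"
    using triv openin_zariski_basic[OF af(1)] unfolding D_def by blast
  then show ?thesis
  proof
    assume "D = {}"
    then obtain n :: nat where n: "a [^] n = \<zero>"
      using nilpotent_if_in_all_primes[OF af(1)] unfolding D_def by blast
    have "\<exists>g. nowhere_vanishing R g \<and> x [^]\<^bsub>A\<^esub> m = H (a [^] m) g" for m :: nat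
    proof (induction m)
      case 0
      then show ?case using nowhere_vanishing_one H_one by auto
    next
      case (Suc m)
      then obtain g where g: "nowhere_vanishing R g" "x [^]\<^bsub>A\<^esub> m = H (a [^] m) g" by blast
      then have "x [^]\<^bsub>A\<^esub> Suc m = H (a [^] Suc m) (g \<otimes> f)"
        using H_mult[of "a [^] m" g a f] af by simp
      then show ?case using nowhere_vanishing_mult[OF g(1) af(2)] by blast
    qed
    from this[of n] have "x [^]\<^bsub>A\<^esub> n = \<zero>\<^bsub>A\<^esub>" using n H_zero by auto
    then show ?thesis by blast
  next
    assume "D = topspace (zariski R)"
    then have a: "nowhere_vanishing R a"
      using af(1) unfolding D_def topspace_zariski[OF ring_axioms] nowhere_vanishing_def by blast
    have "x \<otimes>\<^bsub>A\<^esub> H f a = H (a \<otimes> f) (f \<otimes> a)"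
      using H_mult[OF af(1,2) fR[OF af(2)] a] af(3) by simp
    also have "\<dots> = H \<one> \<one>"
      unfolding H_def using af a fR nowhere_vanishing_mult nowhere_vanishing_one
      by (intro arg_cong[where f = h] frac_section_eqI) (auto simp: m_comm)
    finally have "x \<otimes>\<^bsub>A\<^esub> H f a = \<one>\<^bsub>A\<^esub>" using H_one by simp
    then have "x \<in> Units A"
      using x H_closed[OF fR[OF af(2)] a] A.m_comm[of x "H f a"] unfolding Units_def
      by (auto intro!: bexI[of _ "H f a"])
    then show ?thesis by blast
  qed
qed

end

context field
begin

lemma field_primes: "{\<pp>. primeideal \<pp> R} = {{\<zero>}}"
proof -
  have "\<pp> = {\<zero>}" if p: "primeideal \<pp> R" for \<pp>
  proof -
    have "\<pp> \<in> {I. ideal I R}" using primeideal.axioms(1)[OF p] by simp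
    then have "\<pp> = {\<zero>} \<or> \<pp> = carrier R" unfolding all_ideals by simp
    then show ?thesis using primeideal.I_notcarr[OF p] by simp
  qed
  then show ?thesis using zeroprimeideal by blast
qed

lemma topspace_zariski_field: "topspace (zariski R) = {{\<zero>}}"
  using topspace_zariski[OF ring_axioms] field_primes by simp

lemma zariski_field_indiscrete:
  "openin (zariski R) U \<Longrightarrow> U = {} \<or> U = topspace (zariski R)"
  using openin_subset[of "zariski R" U] unfolding topspace_zariski_field by blast

lemma frac_section_field_hom: "(\<lambda>c. frac_section R c \<one>) \<in> ring_hom R (spec_ring R)"
proof (rule ring_hom_memI)
  fix c d assume c: "c \<in> carrier R" "d \<in> carrier R"
  show "frac_section R c \<one> \<in> carrier (spec_ring R)"
    using c frac_section_closed nowhere_vanishing_one by blast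
  show "frac_section R (c \<otimes> d) \<one> = frac_section R c \<one> \<otimes>\<^bsub>spec_ring R\<^esub> frac_section R d \<one>"
    using c nowhere_vanishing_one by (simp add: frac_section_mult)
  show "frac_section R (c \<oplus> d) \<one> = frac_section R c \<one> \<oplus>\<^bsub>spec_ring R\<^esub> frac_section R d \<one>"
    using c nowhere_vanishing_one by (simp add: frac_section_add)
qed (simp add: frac_section_one)

text \<open>
  The only prime ideal of a field is zero, so every denominator can be cleared.
\<close>
lemma spec_ring_field_surj:
  "carrier (spec_ring R) = (\<lambda>c. frac_section R c \<one>) ` carrier R"
proof (intro equalityI subsetI)
  fix s assume "s \<in> carrier (spec_ring R)"
  moreover have "topspace (zariski R) \<noteq> {}" using topspace_zariski_field by simp
  ultimately obtain a f where af: "a \<in> carrier R" "nowhere_vanishing R f" "s = frac_section R a f"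
    using spec_ring_frac_section[OF zariski_field_indiscrete] by metis
  have f: "f \<in> carrier R" "f \<noteq> \<zero>"
    using nowhere_vanishingD[OF af(2), of "{\<zero>}"] topspace_zariski_field by auto
  then have fU: "f \<in> Units R" using field_Units by simp
  have "frac_section R a f = frac_section R (a \<otimes> inv f) \<one>"
    using af(1,2) f(1) fU nowhere_vanishing_one by (intro frac_section_eqI) (auto simp: m_assoc)
  then show "s \<in> (\<lambda>c. frac_section R c \<one>) ` carrier R" using af fU by auto
qed (use frac_section_closed nowhere_vanishing_one in auto)

end

section \<open>Schemes with an indiscrete underlying space\<close>

text \<open>
  The closure of a point outside a nonempty open set is an irreducible closed set that is strictly smaller
  than the space, which is a chain of length one.
\<close>
lemma indiscrete_of_irreducible_krull_dim_0:
  assumes dim: "krull_dim T = 0" and irr: "irreducible_in T (topspace T)" and U: "openin T U"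
  shows "U = {} \<or> U = topspace T"
proof (rule ccontr)
  assume neg: "\<not> ?thesis"
  have UT: "U \<subseteq> topspace T" using openin_subset[OF U] .
  obtain x where x: "x \<in> topspace T" "x \<notin> U" using neg UT by blast
  define Z where "Z = T closure_of {x}"
  have xZ: "x \<in> Z" unfolding Z_def using closure_of_subset[of "{x}" T] x(1) by auto
  have "closedin T (topspace T - U)" using U by blast
  then have "Z \<subseteq> topspace T - U" unfolding Z_def using x by (intro closure_of_minimal) auto
  then have Zs: "Z \<subset> topspace T" using neg UT by blast
  have Zmin: "Z \<subseteq> A" if "closedin T A" "x \<in> A" for A
    unfolding Z_def using that by (intro closure_of_minimal) auto
  have "irreducible_in T Z"
    unfolding irreducible_in_def using Zs xZ Zmin by blast
  moreover have "closedin T Z" unfolding Z_def by simp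
  ultimately have
    "\<exists>Z. (\<forall>i\<le>1. closedin T (Z i) \<and> irreducible_in T (Z i)) \<and> (\<forall>i<1::nat. Z i \<subset> Z (Suc i))"
    using irr Zs by (intro exI[of _ "\<lambda>i::nat. if i = 0 then Z else topspace T"]) auto
  then have "ereal (real 1) \<le> krull_dim T"
    unfolding krull_dim_def by (intro Sup_upper) blast
  then show False using dim by simp
qed

lemma ring_iso_image: "h \<in> ring_iso R S \<Longrightarrow> h \<in> ring_hom R S \<and> h ` carrier R = carrier S"
  unfolding ring_iso_def bij_betw_def by blast

lemma homeomorphic_indiscrete:
  assumes hom: "homeomorphic_map S S' f"
    and triv: "\<And>U. openin S U \<Longrightarrow> U = {} \<or> U = topspace S"
    and W: "openin S' W"
  shows "W = {} \<or> W = topspace S'"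
proof -
  have img: "f ` topspace S = topspace S'" using homeomorphic_imp_surjective_map[OF hom] .
  have "openin S {x \<in> topspace S. f x \<in> W}"
    using homeomorphic_imp_continuous_map[OF hom] W by (simp add: continuous_map_def)
  then have "{x \<in> topspace S. f x \<in> W} = {} \<or> {x \<in> topspace S. f x \<in> W} = topspace S"
    by (rule triv)
  then show ?thesis
  proof
    assume *: "{x \<in> topspace S. f x \<in> W} = {}"
    have "W \<subseteq> f ` topspace S" using openin_subset[OF W] img by simp
    then have "W = {}" using * by auto
    then show ?thesis ..
  next
    assume "{x \<in> topspace S. f x \<in> W} = topspace S"
    then have "f ` topspace S \<subseteq> W" by auto
    then show ?thesis using img openin_subset[OF W] by simp
  qed
qed

locale indiscrete_ringed_space = ringed_space X for X :: "('p, 'a) ring_presheaf" +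
  assumes indiscrete: "openin (base X) U \<Longrightarrow> U = {} \<or> U = topspace (base X)"
    and nonempty: "topspace (base X) \<noteq> {}"
begin

abbreviation S :: "'p set" where "S \<equiv> topspace (base X)"
abbreviation A :: "'a ring" where "A \<equiv> sec X S"

sublocale A: cring A using sec_cring openin_topspace .

lemma open_nonempty: "openin (base X) U \<Longrightarrow> x \<in> U \<Longrightarrow> U = S"
  using indiscrete by blast

lemma affine_unit_or_nilpotent:
  assumes aff: "affine_open X S" and a: "a \<in> carrier A"
  shows "a \<in> Units A \<or> (\<exists>n::nat. a [^]\<^bsub>A\<^esub> n = \<zero>\<^bsub>A\<^esub>)"
proof -
  obtain R :: "'a ring" and m where R: "cring R" and iso: "ringed_space_iso (restrict_space X S) (Spec R) m"
    using aff unfolding affine_open_def by blast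
  have base: "base (restrict_space X S) = base X" and sec: "sec (restrict_space X S) = sec X"
    unfolding restrict_space_def by (simp_all add: subtopology_topspace)
  have hom: "homeomorphic_map (base X) (zariski R) (fst m)"
    using iso unfolding ringed_space_iso_def base Spec_simps by blast
  have img: "fst m ` S = topspace (zariski R)" using homeomorphic_imp_surjective_map[OF hom] .
  have "preim (restrict_space X S) (fst m) (topspace (zariski R)) = S"
    unfolding preim_def base using img by auto
  then have "snd m (topspace (zariski R)) \<in> ring_iso (spec_ring R) A"
    using iso unfolding ringed_space_iso_def sec Spec_simps by (metis openin_topspace)
  then have h: "snd m (topspace (zariski R)) \<in> ring_hom (spec_ring R) A"
      "snd m (topspace (zariski R)) ` carrier (spec_ring R) = carrier A"
    using ring_iso_image by blast+
  have ne: "topspace (zariski R) \<noteq> {}" using img nonempty by blast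
  show ?thesis
    by (rule cring.unit_or_nilpotent_of_indiscrete_Spec[OF R homeomorphic_indiscrete[OF hom indiscrete] ne A.is_cring h a])
qed

definition structure_hom ::
    "'k ring \<Rightarrow> ('p, 'a, 'k set, 'k set \<Rightarrow> ('k \<times> 'k) set) mor \<Rightarrow> 'k \<Rightarrow> 'a" where
  "structure_hom k \<pi> c = snd \<pi> (topspace (zariski k)) (frac_section k c \<one>\<^bsub>k\<^esub>)"

lemma preim_topspace:
  assumes "morphism X (Spec k) \<pi>"
  shows "preim X (fst \<pi>) (topspace (zariski k)) = S"
  using assms unfolding morphism_def continuous_map_def preim_def Spec_simps by auto

lemma morphism_global_hom:
  assumes "morphism X (Spec k) \<pi>"
  shows "snd \<pi> (topspace (zariski k)) \<in> ring_hom (spec_ring k) A"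
proof -
  have "openin (base (Spec k)) (topspace (zariski k))" by (simp add: Spec_simps)
  moreover have "\<forall>V. openin (base (Spec k)) V \<longrightarrow>
      snd \<pi> V \<in> ring_hom (sec (Spec k) V) (sec X (preim X (fst \<pi>) V))"
    using assms unfolding morphism_def by (elim conjE) assumption
  ultimately have "snd \<pi> (topspace (zariski k))
      \<in> ring_hom (spec_ring k) (sec X (preim X (fst \<pi>) (topspace (zariski k))))"
    by simp
  then show ?thesis unfolding preim_topspace[OF assms] .
qed

lemma structure_hom:
  assumes k: "field k" and mor: "morphism X (Spec k) \<pi>"
  shows "structure_hom k \<pi> \<in> ring_hom k A"
proof -
  have "snd \<pi> (topspace (zariski k)) \<circ> (\<lambda>c. frac_section k c \<one>\<^bsub>k\<^esub>) \<in> ring_hom k A"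
    using ring_hom_trans[OF field.frac_section_field_hom[OF k] morphism_global_hom[OF mor]] .
  moreover have "snd \<pi> (topspace (zariski k)) \<circ> (\<lambda>c. frac_section k c \<one>\<^bsub>k\<^esub>) = structure_hom k \<pi>"
    by (simp add: fun_eq_iff structure_hom_def)
  ultimately show ?thesis by simp
qed

text \<open>
  The neighbourhood of the only point of the spectrum of \<open>k\<close> and the nonempty member of the affine cover
  are the whole spaces, so the condition of finite type speaks of the global sections.
\<close>
lemma finite_type_coordinate_ring:
  assumes k: "field k" and mor: "morphism X (Spec k) \<pi>" and ft: "finite_type X (Spec k) \<pi>"
  shows "affine_open X S"
    and "\<exists>G. finite G \<and> G \<subseteq> carrier A \<and> generate_ring A (structure_hom k \<pi> ` carrier k \<union> G) = carrier A"
proof -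
  interpret k: field k by fact
  define P where "P = topspace (zariski k)"
  have "{\<zero>\<^bsub>k\<^esub>} \<in> topspace (base (Spec k))" by (simp add: Spec_simps k.topspace_zariski_field)
  from bspec[OF ft[unfolded finite_type_def] this]
  obtain V \<U> where V: "{\<zero>\<^bsub>k\<^esub>} \<in> V" "affine_open (Spec k) V"
    and U: "\<Union>\<U> = preim X (fst \<pi>) V" "\<forall>U\<in>\<U>. affine_open X U \<and>
           finitely_generated_algebra (sec (Spec k) V) (sec X U)
             (\<lambda>t. res X (preim X (fst \<pi>) V) U (snd \<pi> V t))"
    by (elim exE conjE)
  have "openin (zariski k) V" using V(2) unfolding affine_open_def Spec_simps by (rule conjunct1)
  then have VP: "V = P" using k.zariski_field_indiscrete V(1) unfolding P_def by blast
  have pre: "preim X (fst \<pi>) V = S" using preim_topspace[OF mor] unfolding VP P_def .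
  obtain U where Uin: "U \<in> \<U>" "U \<noteq> {}" using U(1) nonempty unfolding pre by blast
  have aff: "affine_open X U" using bspec[OF U(2) Uin(1)] by (rule conjunct1)
  then have "openin (base X) U" unfolding affine_open_def by (rule conjunct1)
  then have US: "U = S" using Uin(2) indiscrete by blast
  show "affine_open X S" using aff unfolding US .
  have "finitely_generated_algebra (sec (Spec k) V) A (\<lambda>t. res X S S (snd \<pi> V t))"
    using bspec[OF U(2) Uin(1)] unfolding pre US by (rule conjunct2)
  then obtain G where G: "finite G" "G \<subseteq> carrier A"
    "generate_ring A ((\<lambda>t. res X S S (snd \<pi> P t)) ` carrier (spec_ring k) \<union> G) = carrier A"
    unfolding finitely_generated_algebra_def VP P_def by (elim exE conjE)
  have "(\<lambda>t. res X S S (snd \<pi> P t)) ` carrier (spec_ring k) = structure_hom k \<pi> ` carrier k"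
    unfolding k.spec_ring_field_surj image_image
  proof (rule image_cong[OF refl])
    fix c assume c: "c \<in> carrier k"
    have "structure_hom k \<pi> c \<in> carrier A" using ring_hom_closed[OF structure_hom[OF k mor] c] .
    then show "res X S S (snd \<pi> P (frac_section k c \<one>\<^bsub>k\<^esub>)) = structure_hom k \<pi> c"
      using res_id[OF openin_topspace] unfolding structure_hom_def P_def by simp
  qed
  then show "\<exists>G. finite G \<and> G \<subseteq> carrier A \<and> generate_ring A (structure_hom k \<pi> ` carrier k \<union> G) = carrier A"
    using G by auto
qed

text \<open>
  The line bundle is trivial near a point, hence on the only neighbourhood of that point.
\<close>
lemma line_bundle_free:
  assumes lb: "line_bundle X M"
  shows "\<exists>\<theta> e. free_rank_one_module A (msec M S) \<theta> e"
proof -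
  interpret M: sheaf_of_modules X M using lb unfolding line_bundle_def by (rule conjunct1)
  interpret m: module A "msec M S" using M.msec_module[OF openin_topspace] .
  obtain x where x: "x \<in> S" using nonempty by blast
  obtain U \<phi> where U: "openin (base X) U" "x \<in> U" and
    \<phi>U: "\<forall>V. openin (base X) V \<and> V \<subseteq> U \<longrightarrow>
          bij_betw (\<phi> V) (carrier (sec X V)) (carrier (msec M V)) \<and>
          (\<forall>r\<in>carrier (sec X V). \<forall>s\<in>carrier (sec X V).
             \<phi> V (r \<oplus>\<^bsub>sec X V\<^esub> s) = \<phi> V r \<oplus>\<^bsub>msec M V\<^esub> \<phi> V s \<and>
             \<phi> V (r \<otimes>\<^bsub>sec X V\<^esub> s) = r \<odot>\<^bsub>msec M V\<^esub> \<phi> V s)"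
    using bspec[OF conjunct2[OF lb[unfolded line_bundle_def]] x] by (elim exE conjE)
  have "U = S" using open_nonempty U by blast
  then have \<phi>: "bij_betw (\<phi> S) (carrier A) (carrier (msec M S))"
    and \<phi>_add: "\<And>r s. r \<in> carrier A \<Longrightarrow> s \<in> carrier A \<Longrightarrow>
      \<phi> S (r \<oplus>\<^bsub>A\<^esub> s) = \<phi> S r \<oplus>\<^bsub>msec M S\<^esub> \<phi> S s"
    and \<phi>_mult: "\<And>r s. r \<in> carrier A \<Longrightarrow> s \<in> carrier A \<Longrightarrow>
      \<phi> S (r \<otimes>\<^bsub>A\<^esub> s) = r \<odot>\<^bsub>msec M S\<^esub> \<phi> S s"
    using \<phi>U by auto
  define \<theta> where "\<theta> = inv_into (carrier A) (\<phi> S)"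
  have \<theta>\<phi>: "\<theta> (\<phi> S r) = r" if "r \<in> carrier A" for r
    unfolding \<theta>_def using bij_betw_inv_into_left[OF \<phi> that] .
  have \<phi>\<theta>: "\<phi> S (\<theta> u) = u" if "u \<in> carrier (msec M S)" for u
    unfolding \<theta>_def using bij_betw_inv_into_right[OF \<phi> that] .
  have \<theta>c: "\<theta> u \<in> carrier A" if "u \<in> carrier (msec M S)" for u
    unfolding \<theta>_def using bij_betwE[OF bij_betw_inv_into[OF \<phi>]] that by blast
  have \<phi>c: "\<phi> S r \<in> carrier (msec M S)" if "r \<in> carrier A" for r
    using bij_betwE[OF \<phi>] that by blast
  have "free_rank_one_module A (msec M S) \<theta> (\<phi> S \<one>\<^bsub>A\<^esub>)"
  proof unfold_locales
    fix u v assume u: "u \<in> carrier (msec M S)"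
    show "\<theta> u \<in> carrier A" using \<theta>c[OF u] .
    show "u = \<theta> u \<odot>\<^bsub>msec M S\<^esub> \<phi> S \<one>\<^bsub>A\<^esub>"
      using \<phi>_mult[of "\<theta> u" "\<one>\<^bsub>A\<^esub>"] \<theta>c[OF u] \<phi>\<theta>[OF u] by simp
    assume v: "v \<in> carrier (msec M S)"
    show "\<theta> (u \<oplus>\<^bsub>msec M S\<^esub> v) = \<theta> u \<oplus>\<^bsub>A\<^esub> \<theta> v"
      using \<phi>_add[of "\<theta> u" "\<theta> v"] \<theta>\<phi>[of "\<theta> u \<oplus>\<^bsub>A\<^esub> \<theta> v"] \<theta>c u v \<phi>\<theta> by simp
  next
    fix r u assume r: "r \<in> carrier A" and u: "u \<in> carrier (msec M S)"
    show "\<theta> (r \<odot>\<^bsub>msec M S\<^esub> u) = r \<otimes>\<^bsub>A\<^esub> \<theta> u"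
      using \<phi>_mult[of r "\<theta> u"] \<theta>\<phi>[of "r \<otimes>\<^bsub>A\<^esub> \<theta> u"] \<theta>c u r \<phi>\<theta> by simp
  next
    show "\<phi> S \<one>\<^bsub>A\<^esub> \<in> carrier (msec M S)" using \<phi>c by simp
    show "\<theta> (\<phi> S \<one>\<^bsub>A\<^esub>) = \<one>\<^bsub>A\<^esub>" using \<theta>\<phi> by simp
  qed
  then show ?thesis by blast
qed

end

section \<open>Tensor powers of a line bundle on an indiscrete space\<close>

locale indiscrete_line_bundle =
  indiscrete_ringed_space X + sheaf_of_modules X M + fr: free_rank_one_module "sec X (topspace (base X))" "msec M (topspace (base X))" \<theta> e
  for X :: "('p, 'a) ring_presheaf" and M :: "('p, 'a, 'm) module_presheaf" and \<theta> e
begin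

abbreviation TP :: "('p, ('m list \<Rightarrow> 'a) set) ring_presheaf" where "TP \<equiv> tensor_presheaf X M"
abbreviation TS :: "('p, 'a, 'm) power_section ring" where "TS \<equiv> tensor_sections X M"

lemma tensor_presheaf_simps: "base TP = base X" "sec TP S = fr.T"
  by (simp_all add: tensor_presheaf_def)

lemma free_algebra_map_id:
  assumes f: "f \<in> carrier fr.F"
  shows "free_algebra_map A A (res X S S) (mres M S S) f = f"
proof
  fix v
  have c: "\<And>w. f w \<in> carrier A" and B: "\<And>w. f w \<noteq> \<zero>\<^bsub>A\<^esub> \<Longrightarrow> set w \<subseteq> carrier (msec M S)"
    using f unfolding free_algebra_carrier by blast+
  have "map (mres M S S) w = w" if "f w \<noteq> \<zero>\<^bsub>A\<^esub>" for w
    using B[OF that] mres_id[OF openin_topspace] by (intro map_idI) auto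
  then have "{w. f w \<noteq> \<zero>\<^bsub>A\<^esub> \<and> map (mres M S S) w = v} = (if f v \<noteq> \<zero>\<^bsub>A\<^esub> then {v} else {})"
    by auto
  then show "free_algebra_map A A (res X S S) (mres M S S) f v = f v"
    unfolding free_algebra_map_def using c[of v] res_id[OF openin_topspace c] by auto
qed

text \<open>
  The restriction of a class \<open>C\<close> is by definition the sum of the tensor ideal and the image of \<open>C\<close>. Here the
  image is \<open>C\<close> itself, and adding the ideal, the zero of the quotient, changes nothing.
\<close>
lemma tensor_presheaf_res_id:
  assumes C: "C \<in> carrier fr.T"
  shows "res TP S S C = C"
proof -
  have "C \<subseteq> carrier fr.F"
    using C fr.J.a_rcosets_carrier unfolding tensor_algebra_def FactRing_def by auto
  then have "free_algebra_map A A (res X S S) (mres M S S) ` C = C"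
    using free_algebra_map_id by force
  then have "res TP S S C = \<zero>\<^bsub>fr.T\<^esub> \<oplus>\<^bsub>fr.T\<^esub> C"
    by (simp add: tensor_presheaf_def tensor_algebra_def FactRing_def)
  then show ?thesis using C fr.tensor_class.S.l_zero by simp
qed

text \<open>
  The whole space is the only neighbourhood, so a germ contains a single section.
\<close>
lemma germ_tensor:
  assumes x: "x \<in> S" and C: "C \<in> carrier fr.T"
  shows "germ TP x S C = {(S, C)}"
proof (intro equalityI subsetI)
  fix z assume "z \<in> germ TP x S C"
  then obtain V t W where z: "z = (V, t)" "openin (base X) V" "x \<in> V" "t \<in> carrier (sec TP V)"
    "openin (base X) W" "x \<in> W" "res TP S W C = res TP V W t"
    unfolding germ_def tensor_presheaf_simps by blast
  have "V = S" "W = S" using open_nonempty[OF z(2,3)] open_nonempty[OF z(5,6)] .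
  then show "z \<in> {(S, C)}"
    using z tensor_presheaf_res_id C tensor_presheaf_simps(2) by auto
next
  fix z assume "z \<in> {(S, C)}"
  then show "z \<in> germ TP x S C"
    unfolding germ_def tensor_presheaf_simps using x C
    by (auto simp: tensor_presheaf_simps intro!: exI[of _ S])
qed

text \<open>
  The section whose germ at each point is the germ of \<open>C\<close>, a single pair.
\<close>
definition global_tensor :: "('m list \<Rightarrow> 'a) set \<Rightarrow> ('p, 'a, 'm) power_section" where
  "global_tensor C = (\<lambda>x\<in>S. {(S, C)})"

lemma global_tensor_eq_germ:
  assumes "C \<in> carrier fr.T" shows "global_tensor C = (\<lambda>x\<in>S. germ TP x S C)"
  unfolding global_tensor_def using germ_tensor[OF _ assms] by (intro restrict_ext) simp

lemma stalk_carrier: "C \<in> carrier fr.T \<Longrightarrow> x \<in> S \<Longrightarrow> {(S, C)} \<in> carrier (stalk TP x)"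
  unfolding stalk_def tensor_presheaf_simps using germ_tensor openin_topspace
  by (simp, intro exI[of _ S] exI[of _ C]) (simp add: tensor_presheaf_simps)

lemma tensor_sections_carrier:
  "s \<in> carrier TS \<longleftrightarrow> s \<in> (\<Pi>\<^sub>E x\<in>S. carrier (stalk TP x)) \<and>
    (\<forall>x\<in>S. \<exists>V t. openin (base X) V \<and> x \<in> V \<and> V \<subseteq> S \<and> t \<in> carrier (sec TP V) \<and>
      (\<forall>y\<in>V. s y = germ TP y V t))"
  unfolding tensor_sections_def sheafification_def by (simp add: tensor_presheaf_simps)

lemma section_eq_global_tensor:
  assumes s: "s \<in> carrier TS" and C: "C \<in> carrier fr.T" and eq: "\<And>y. y \<in> S \<Longrightarrow> s y = germ TP y S C"
  shows "s = global_tensor C"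
proof
  fix y
  have "s \<in> extensional S" using s unfolding tensor_sections_carrier PiE_def by blast
  then show "s y = global_tensor C y"
    using eq germ_tensor[OF _ C] unfolding global_tensor_def by (cases "y \<in> S") (auto simp: extensional_def)
qed

text \<open>
  Sheafification adds no sections, since a local description is already a global one.
\<close>
lemma tensor_sections_eq: "carrier TS = global_tensor ` carrier fr.T"
proof (intro equalityI subsetI)
  fix s assume s: "s \<in> carrier TS"
  obtain x where x: "x \<in> S" using nonempty by blast
  have "\<exists>V t. openin (base X) V \<and> x \<in> V \<and> V \<subseteq> S \<and> t \<in> carrier (sec TP V) \<and>
      (\<forall>y\<in>V. s y = germ TP y V t)"
    using s[unfolded tensor_sections_carrier, THEN conjunct2] x by (rule bspec)
  then obtain V C where V: "openin (base X) V" "x \<in> V" "C \<in> carrier (sec TP V)"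
    "\<forall>y\<in>V. s y = germ TP y V C" by (elim exE conjE)
  have VS: "V = S" using open_nonempty[OF V(1,2)] .
  have CT: "C \<in> carrier fr.T" using V(3) unfolding VS tensor_presheaf_simps .
  have "s = global_tensor C" by (rule section_eq_global_tensor[OF s CT]) (use V(4) VS in simp)
  with CT show "s \<in> global_tensor ` carrier fr.T" by blast
next
  fix s assume "s \<in> global_tensor ` carrier fr.T"
  then obtain C where C: "C \<in> carrier fr.T" "s = global_tensor C" by blast
  have "s \<in> (\<Pi>\<^sub>E x\<in>S. carrier (stalk TP x))"
    unfolding C(2) global_tensor_def using stalk_carrier[OF C(1)] by auto
  moreover have "\<exists>V t. openin (base X) V \<and> x \<in> V \<and> V \<subseteq> S \<and> t \<in> carrier (sec TP V) \<and>
      (\<forall>y\<in>V. s y = germ TP y V t)" if "x \<in> S" for x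
    by (rule exI[of _ S], rule exI[of _ C])
      (use that C germ_tensor[OF _ C(1)] in \<open>auto simp: global_tensor_def tensor_presheaf_simps\<close>)
  ultimately show "s \<in> carrier TS" unfolding tensor_sections_carrier by blast
qed

lemma stalk_ops:
  assumes "C \<in> carrier fr.T" "D \<in> carrier fr.T" "x \<in> S"
  shows "{(S, C)} \<otimes>\<^bsub>stalk TP x\<^esub> {(S, D)} = {(S, C \<otimes>\<^bsub>fr.T\<^esub> D)}"
    and "{(S, C)} \<oplus>\<^bsub>stalk TP x\<^esub> {(S, D)} = {(S, C \<oplus>\<^bsub>fr.T\<^esub> D)}"
    and "\<one>\<^bsub>stalk TP x\<^esub> = {(S, \<one>\<^bsub>fr.T\<^esub>)}"
    and "\<zero>\<^bsub>stalk TP x\<^esub> = {(S, \<zero>\<^bsub>fr.T\<^esub>)}"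
  unfolding stalk_def using assms
  by (simp_all add: tensor_presheaf_simps tensor_presheaf_res_id germ_tensor)

lemma tensor_sections_ops:
  assumes "C \<in> carrier fr.T" "D \<in> carrier fr.T"
  shows "global_tensor C \<otimes>\<^bsub>TS\<^esub> global_tensor D = global_tensor (C \<otimes>\<^bsub>fr.T\<^esub> D)"
    and "global_tensor C \<oplus>\<^bsub>TS\<^esub> global_tensor D = global_tensor (C \<oplus>\<^bsub>fr.T\<^esub> D)"
    and "\<one>\<^bsub>TS\<^esub> = global_tensor \<one>\<^bsub>fr.T\<^esub>"
    and "\<zero>\<^bsub>TS\<^esub> = global_tensor \<zero>\<^bsub>fr.T\<^esub>"
  unfolding tensor_sections_def sheafification_def global_tensor_def
  using stalk_ops[OF assms]
  by (simp_all add: tensor_presheaf_simps pointwise_ring_def restrict_def fun_eq_iff)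

lemma global_tensor_inj: "global_tensor C = global_tensor D \<Longrightarrow> C = D"
proof -
  assume eq: "global_tensor C = global_tensor D"
  obtain x where "x \<in> S" using nonempty by blast
  then show "C = D" using fun_cong[OF eq, of x] unfolding global_tensor_def by simp
qed

lemma global_tensor_iso: "global_tensor \<in> ring_iso fr.T TS"
proof (rule ring_iso_memI)
  show "bij_betw global_tensor (carrier fr.T) (carrier TS)"
    unfolding bij_betw_def tensor_sections_eq using global_tensor_inj by (auto intro: inj_onI)
  show "global_tensor \<one>\<^bsub>fr.T\<^esub> = \<one>\<^bsub>TS\<^esub>"
    using tensor_sections_ops(3)[OF fr.tensor_class.S.zero_closed fr.tensor_class.S.zero_closed] by (rule sym)
qed (simp_all add: tensor_sections_ops tensor_sections_eq)

lemma tensor_sections_ring: "ring TS"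
  using fr.tensor_class.S.ring_iso_imp_img_ring[OF global_tensor_iso]
  unfolding tensor_sections_ops(4)[OF fr.tensor_class.S.zero_closed fr.tensor_class.S.zero_closed, symmetric]
  by simp

sublocale global_tensor: ring_hom_ring fr.T TS global_tensor
  using global_tensor_iso tensor_sections_ring fr.tensor_class.S.ring_axioms ring_iso_image by (intro ring_hom_ringI2) auto

lemma power_sections_eq: "power_sections X M n = global_tensor ` tensor_power A (msec M S) n"
proof (intro equalityI subsetI)
  fix s assume s: "s \<in> power_sections X M n"
  then have sT: "s \<in> carrier TS" unfolding power_sections_def by blast
  obtain x where x: "x \<in> S" using nonempty by blast
  then obtain V C where V: "openin (base X) V" "x \<in> V" "C \<in> tensor_power (sec X V) (msec M V) n"
    "\<forall>y\<in>V. s y = germ TP y V C" using s unfolding power_sections_def by blast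
  have VS: "V = S" using open_nonempty[OF V(1,2)] .
  have C: "C \<in> tensor_power A (msec M S) n" using V(3) unfolding VS .
  then have "C \<in> carrier fr.T" using fr.tensor_power_subset by blast
  then have "s = global_tensor C" by (rule section_eq_global_tensor[OF sT]) (use V(4) VS in simp)
  with C show "s \<in> global_tensor ` tensor_power A (msec M S) n" by blast
next
  fix s assume "s \<in> global_tensor ` tensor_power A (msec M S) n"
  then obtain C where C: "C \<in> tensor_power A (msec M S) n" "s = global_tensor C" by blast
  then have CT: "C \<in> carrier fr.T" using fr.tensor_power_subset by blast
  have "\<exists>V t. openin (base X) V \<and> x \<in> V \<and> t \<in> tensor_power (sec X V) (msec M V) n \<and>
       (\<forall>y\<in>V. s y = germ TP y V t)" if "x \<in> S" for x
    by (rule exI[of _ S], rule exI[of _ C])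
      (use that C germ_tensor[OF _ CT] in \<open>auto simp: global_tensor_def\<close>)
  moreover have "s \<in> carrier TS" using CT C(2) tensor_sections_eq by blast
  ultimately show "s \<in> power_sections X M n" unfolding power_sections_def by blast
qed

text \<open>
  Every element of the tensor algebra is a sum of homogeneous ones, so the direct sum of the tensor powers
  is the entire ring of sections.
\<close>
lemma section_ring_eq: "section_ring X M = TS"
proof -
  have "carrier TS = {\<Oplus>\<^bsub>TS\<^esub>n\<in>{..N}. h n | N h. \<forall>n. h n \<in> power_sections X M n}"
  proof (intro equalityI subsetI)
    fix s assume "s \<in> carrier TS"
    then obtain C where C: "C \<in> carrier fr.T" "s = global_tensor C" unfolding tensor_sections_eq by blast
    obtain N h where h: "\<forall>n. h n \<in> tensor_power A (msec M S) n" "C = (\<Oplus>\<^bsub>fr.T\<^esub>n\<in>{..N}. h n)"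
      using fr.tensor_algebra_decompose[OF C(1)] by blast
    have "s = (\<Oplus>\<^bsub>TS\<^esub>n\<in>{..N}. (global_tensor \<circ> h) n)"
      unfolding C(2) h(2) using h(1) fr.tensor_power_subset by (subst global_tensor.hom_finsum) (auto simp: comp_def)
    moreover have "\<forall>n. (global_tensor \<circ> h) n \<in> power_sections X M n" using h(1) power_sections_eq by auto
    ultimately show "s \<in> {\<Oplus>\<^bsub>TS\<^esub>n\<in>{..N}. h n | N h. \<forall>n. h n \<in> power_sections X M n}" by blast
  next
    fix s assume "s \<in> {\<Oplus>\<^bsub>TS\<^esub>n\<in>{..N}. h n | N h. \<forall>n. h n \<in> power_sections X M n}"
    then obtain N h where h: "\<forall>n. h n \<in> power_sections X M n" "s = (\<Oplus>\<^bsub>TS\<^esub>n\<in>{..N}. h n)" by blast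
    have "h n \<in> carrier TS" for n using h(1) unfolding power_sections_def by blast
    then show "s \<in> carrier TS" unfolding h(2) by (intro global_tensor.S.finsum_closed) auto
  qed
  then show ?thesis unfolding section_ring_def by simp
qed

text \<open>
  The map to \<open>A\<close> that sets the generator of the line bundle to \<open>\<one>\<close>.
\<close>
definition section_value :: "('p, 'a, 'm) power_section \<Rightarrow> 'a" where
  "section_value s = fr.tensor_value (the_inv_into (carrier fr.T) global_tensor s)"

lemma section_value_global_tensor: "C \<in> carrier fr.T \<Longrightarrow> section_value (global_tensor C) = fr.tensor_value C"
  unfolding section_value_def using global_tensor_inj by (subst the_inv_into_f_f) (auto intro: inj_onI)

lemma section_value_hom: "ring_hom_ring TS A section_value"
proof -
  interpret v: ring_hom_ring fr.T A fr.tensor_value using fr.tensor_value_hom .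
  show ?thesis
  proof (rule ring_hom_ringI)
    show "section_value \<one>\<^bsub>TS\<^esub> = \<one>\<^bsub>A\<^esub>"
      using section_value_global_tensor[OF fr.tensor_class.S.one_closed] global_tensor.hom_one v.hom_one by simp
    fix x y assume "x \<in> carrier TS" "y \<in> carrier TS"
    then obtain C D where C: "C \<in> carrier fr.T" "x = global_tensor C" and D: "D \<in> carrier fr.T" "y = global_tensor D"
      unfolding tensor_sections_eq by blast
    show "section_value (x \<otimes>\<^bsub>TS\<^esub> y) = section_value x \<otimes>\<^bsub>A\<^esub> section_value y"
      using C D section_value_global_tensor[of "C \<otimes>\<^bsub>fr.T\<^esub> D"] by (simp add: section_value_global_tensor)
    show "section_value (x \<oplus>\<^bsub>TS\<^esub> y) = section_value x \<oplus>\<^bsub>A\<^esub> section_value y"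
      using C D section_value_global_tensor[of "C \<oplus>\<^bsub>fr.T\<^esub> D"] by (simp add: section_value_global_tensor)
  qed (auto simp: tensor_sections_ring A.ring_axioms tensor_sections_eq section_value_global_tensor)
qed

lemma section_value_zero:
  assumes "s \<in> power_sections X M n" "section_value s = \<zero>\<^bsub>A\<^esub>"
  shows "s = \<zero>\<^bsub>TS\<^esub>"
proof -
  obtain C where C: "C \<in> tensor_power A (msec M S) n" "s = global_tensor C"
    using assms(1) power_sections_eq by blast
  then have "C \<in> carrier fr.T" using fr.tensor_power_subset by blast
  then have "C = \<zero>\<^bsub>fr.T\<^esub>"
    using fr.tensor_power_value_zero[OF C(1)] assms(2) section_value_global_tensor unfolding C(2) by simp
  then show ?thesis unfolding C(2) by simp
qed

lemma power_sections_add: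
  assumes "s \<in> power_sections X M n" "t \<in> power_sections X M n"
  shows "s \<oplus>\<^bsub>TS\<^esub> t \<in> power_sections X M n"
proof -
  obtain C where C: "C \<in> tensor_power A (msec M S) n" "s = global_tensor C" using assms(1) power_sections_eq by blast
  obtain D where D: "D \<in> tensor_power A (msec M S) n" "t = global_tensor D" using assms(2) power_sections_eq by blast
  have "s \<oplus>\<^bsub>TS\<^esub> t = global_tensor (C \<oplus>\<^bsub>fr.T\<^esub> D)"
    using C D fr.tensor_power_subset by (auto simp: subset_iff)
  then show ?thesis using fr.tensor_power_add[OF C(1) D(1)] power_sections_eq by blast
qed

lemma power_sections_mult:
  assumes "s \<in> power_sections X M n" "t \<in> power_sections X M m"
  shows "s \<otimes>\<^bsub>TS\<^esub> t \<in> power_sections X M (n + m)"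
proof -
  obtain C where C: "C \<in> tensor_power A (msec M S) n" "s = global_tensor C" using assms(1) power_sections_eq by blast
  obtain D where D: "D \<in> tensor_power A (msec M S) m" "t = global_tensor D" using assms(2) power_sections_eq by blast
  have "s \<otimes>\<^bsub>TS\<^esub> t = global_tensor (C \<otimes>\<^bsub>fr.T\<^esub> D)"
    using C D fr.tensor_power_subset by (auto simp: subset_iff)
  then show ?thesis using fr.tensor_power_mult[OF C(1) D(1)] power_sections_eq by blast
qed

lemma power_sections_zero: "\<zero>\<^bsub>TS\<^esub> \<in> power_sections X M n"
  using power_sections_eq fr.tensor_power_zero global_tensor.hom_zero by (metis imageI)

lemma power_sections_one: "\<one>\<^bsub>TS\<^esub> \<in> power_sections X M 0"
  using power_sections_eq fr.tensor_power_monomial[of "\<one>\<^bsub>A\<^esub>" "[]"] fr.one_eq_monomial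
    global_tensor.hom_one fr.tensor_class.hom_one by (metis A.one_closed empty_subsetI imageI list.set(1) list.size(3))

lemma scalar_hom:
  assumes k: "field k" and mor: "morphism X (Spec k) \<pi>"
  shows "ring_hom_ring k TS (scalar k X \<pi> M)"
    and "c \<in> carrier k \<Longrightarrow> scalar k X \<pi> M c \<in> power_sections X M 0"
    and "c \<in> carrier k \<Longrightarrow> section_value (scalar k X \<pi> M c) = structure_hom k \<pi> c"
proof -
  interpret k: field k by fact
  let ?r = "structure_hom k \<pi>"
  have r: "?r \<in> ring_hom k A" using structure_hom[OF k mor] .
  have rc: "?r c \<in> carrier A" if "c \<in> carrier k" for c using ring_hom_closed[OF r that] .
  have cc: "fr.tensor_class (monomial A (?r c) []) \<in> carrier fr.T" if "c \<in> carrier k" for c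
    using rc[OF that] by (intro fr.tensor_class.hom_closed A.monomial_closed) auto
  have eq: "scalar k X \<pi> M c = global_tensor (fr.tensor_class (monomial A (?r c) []))" if "c \<in> carrier k" for c
  proof -
    have "scalar k X \<pi> M c = (\<lambda>x\<in>S. germ TP x S (fr.tensor_class (monomial A (?r c) [])))"
      unfolding scalar_def Let_def fr.tensor_class_def structure_hom_def frac_section_def by (simp add: Spec_simps)
    then show ?thesis unfolding global_tensor_eq_germ[OF cc[OF that]] .
  qed
  have m: "monomial A (?r c) [] \<in> carrier fr.F" if "c \<in> carrier k" for c
    using rc[OF that] by (intro A.monomial_closed) auto
  have p: "scalar k X \<pi> M c \<in> power_sections X M 0" if "c \<in> carrier k" for c
    unfolding eq[OF that] power_sections_eq using fr.tensor_power_monomial[of "?r c" "[]"] rc[OF that] by auto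
  then show "c \<in> carrier k \<Longrightarrow> scalar k X \<pi> M c \<in> power_sections X M 0" .
  show "c \<in> carrier k \<Longrightarrow> section_value (scalar k X \<pi> M c) = ?r c"
    using eq cc m rc by (simp add: section_value_global_tensor fr.tensor_value_tensor_class fr.eval_free_monomial)
  show "ring_hom_ring k TS (scalar k X \<pi> M)"
  proof (rule ring_hom_ringI)
    show "scalar k X \<pi> M c \<in> carrier TS" if "c \<in> carrier k" for c
      using p[OF that] unfolding power_sections_def by blast
    show "scalar k X \<pi> M \<one>\<^bsub>k\<^esub> = \<one>\<^bsub>TS\<^esub>"
      using eq[OF k.one_closed] ring_hom_one[OF r] fr.one_eq_monomial fr.tensor_class.hom_one global_tensor.hom_one by simp
    fix c d assume c: "c \<in> carrier k" and d: "d \<in> carrier k"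
    have "monomial A (?r (c \<otimes>\<^bsub>k\<^esub> d)) [] = monomial A (?r c) [] \<otimes>\<^bsub>fr.F\<^esub> monomial A (?r d) []"
      using ring_hom_mult[OF r c d] A.monomial_mult[OF rc[OF c] rc[OF d], of "carrier (msec M S)" "[]" "[]"] by simp
    then show "scalar k X \<pi> M (c \<otimes>\<^bsub>k\<^esub> d) = scalar k X \<pi> M c \<otimes>\<^bsub>TS\<^esub> scalar k X \<pi> M d"
      using eq c d cc m by simp
    have "monomial A (?r (c \<oplus>\<^bsub>k\<^esub> d)) [] = monomial A (?r c) [] \<oplus>\<^bsub>fr.F\<^esub> monomial A (?r d) []"
      using ring_hom_add[OF r c d] fr.monomial_add[OF rc[OF c] rc[OF d]] by simp
    then show "scalar k X \<pi> M (c \<oplus>\<^bsub>k\<^esub> d) = scalar k X \<pi> M c \<oplus>\<^bsub>TS\<^esub> scalar k X \<pi> M d"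
      using eq c d cc m by simp
  qed (simp_all add: k.ring_axioms tensor_sections_ring)
qed

end

section \<open>Growth of the graded pieces\<close>

text \<open>
  The ring \<open>S\<close> has homogeneous parts \<open>P n\<close>, on each of which \<open>\<Phi>\<close> is injective. The dimensions of the parts of
  \<open>L\<close> are bounded by that of \<open>A\<close>. As \<open>\<Phi> y\<close> is a unit, multiplication by \<open>y\<close> is injective on each part and raises
  the degree by \<open>r\<close>, so along an arithmetic progression of difference \<open>r\<close> the dimensions do not decrease.
\<close>
theorem graded_dimension_convergent:
  fixes S (structure)
  assumes S: "ring S" and A: "cring A" and \<Phi>: "ring_hom_ring S A \<Phi>" and K: "subfield K S"
    and P_zero: "\<And>n. \<zero>\<^bsub>S\<^esub> \<in> P n"
    and P_add: "\<And>n u v. u \<in> P n \<Longrightarrow> v \<in> P n \<Longrightarrow> u \<oplus>\<^bsub>S\<^esub> v \<in> P n"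
    and P_mult: "\<And>n m u v. u \<in> P n \<Longrightarrow> v \<in> P m \<Longrightarrow> u \<otimes>\<^bsub>S\<^esub> v \<in> P (n + m)"
    and KP: "K \<subseteq> P 0"
    and \<Phi>_inj: "\<And>n u. u \<in> carrier S \<Longrightarrow> u \<in> P n \<Longrightarrow> \<Phi> u = \<zero>\<^bsub>A\<^esub> \<Longrightarrow> u = \<zero>\<^bsub>S\<^esub>"
    and Vs: "set Vs \<subseteq> carrier A" "ring.Span A (\<Phi> ` K) Vs = carrier A"
    and un: "\<And>a. a \<in> carrier A \<Longrightarrow> a \<in> Units A \<or> (\<exists>n::nat. a [^]\<^bsub>A\<^esub> n = \<zero>\<^bsub>A\<^esub>)"
    and L: "subring L S" "K \<subseteq> L"
    and y: "y \<in> L \<inter> P r" "\<And>m::nat. y [^]\<^bsub>S\<^esub> m \<noteq> \<zero>\<^bsub>S\<^esub>"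
  shows "convergent (\<lambda>n. real ((ring.dim S over K) (L \<inter> P (a + n * r))))"
proof -
  interpret S: ring S by fact
  interpret A: cring A by fact
  interpret \<Phi>: ring_hom_ring S A \<Phi> by fact
  note LE = subringE[OF L(1)]
  have yS: "y \<in> carrier S" using y(1) LE(1) by auto
  have KS: "K \<subseteq> carrier S" using subfieldE(3)[OF K] .
  have P_one: "\<one>\<^bsub>S\<^esub> \<in> P 0" using subringE(3)[OF subfieldE(1)[OF K]] KP by auto
  define E where "E n = L \<inter> P n" for n
  define d where "d n = (ring.dim S over K) (E n)" for n
  have E_sub: "linear_subspace S K (E n)" for n
    unfolding linear_subspace_def E_def
    using LE P_zero P_add P_mult[of _ 0 _ n] KP L(2) by auto
  have ES: "E n \<subseteq> carrier S" for n using LE(1) unfolding E_def by auto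
  have y_pow: "y [^]\<^bsub>S\<^esub> m \<in> P (m * r)" for m :: nat
  proof (induction m)
    case 0
    then show ?case using P_one by simp
  next
    case (Suc m)
    then show ?case using P_mult[OF Suc, of y r] y(1) by (simp add: add.commute)
  qed
  have "\<Phi> y [^]\<^bsub>A\<^esub> m \<noteq> \<zero>\<^bsub>A\<^esub>" for m :: nat
  proof
    assume "\<Phi> y [^]\<^bsub>A\<^esub> m = \<zero>\<^bsub>A\<^esub>"
    then have "\<Phi> (y [^]\<^bsub>S\<^esub> m) = \<zero>\<^bsub>A\<^esub>" using \<Phi>.hom_nat_pow[OF yS] by simp
    then show False using \<Phi>_inj[OF _ y_pow[of m]] y(2)[of m] yS by auto
  qed
  then have yU: "\<Phi> y \<in> Units A" using un[of "\<Phi> y"] yS by auto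
  have one: "\<one>\<^bsub>A\<^esub> \<noteq> \<zero>\<^bsub>A\<^esub>"
  proof
    assume "\<one>\<^bsub>A\<^esub> = \<zero>\<^bsub>A\<^esub>"
    then have "\<Phi> \<one>\<^bsub>S\<^esub> = \<zero>\<^bsub>A\<^esub>" by simp
    then have "\<one>\<^bsub>S\<^esub> = \<zero>\<^bsub>S\<^esub>" using \<Phi>_inj[OF _ P_one] by simp
    then show False using subfieldE(6)[OF K] by simp
  qed
  have K': "subfield (\<Phi> ` K) A" using \<Phi>.img_is_subfield[OF K one] by simp
  have \<Phi>_semi: "semilinear S A \<Phi> K (E n) \<Phi>" for n
    unfolding semilinear_def using ES KS by (auto simp: subset_iff)
  have diff: "u = v" if "u \<in> E n" "v \<in> E n" "\<Phi> u = \<Phi> v" for u v n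
  proof -
    have uv: "u \<in> carrier S" "v \<in> carrier S" using that ES by auto
    have "u \<ominus>\<^bsub>S\<^esub> v \<in> E n"
      using linear_subspace_minus[OF S K E_sub that(2)] E_sub[of n] that(1)
      unfolding S.minus_eq linear_subspace_def by blast
    moreover have "\<Phi> (u \<ominus>\<^bsub>S\<^esub> v) = \<zero>\<^bsub>A\<^esub>"
      using that(3) uv by (simp add: S.minus_eq A.r_neg)
    ultimately have "u \<ominus>\<^bsub>S\<^esub> v = \<zero>\<^bsub>S\<^esub>" using \<Phi>_inj[of _ n] uv unfolding E_def by auto
    then show ?thesis using uv S.r_right_minus_eq by blast
  qed
  then have \<Phi>_injE: "inj_on \<Phi> (E n)" for n by (rule inj_onI)
  have bound: "length Us \<le> length Vs" if "S.independent K Us" "set Us \<subseteq> E n" for Us n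
  proof -
    have "A.independent (\<Phi> ` K) (map \<Phi> Us)"
      by (rule independent_semilinear_image[OF S A.ring_axioms E_sub \<Phi>_semi \<Phi>_injE that(2,1)])
    moreover have "set (map \<Phi> Us) \<subseteq> A.Span (\<Phi> ` K) Vs"
      unfolding Vs(2) using that(2) ES by (auto simp: subset_iff)
    ultimately show ?thesis
      using A.independent_length_le_spanning[OF K' Vs(1), of "map \<Phi> Us"] by simp
  qed
  have basis: "\<exists>Us. S.independent K Us \<and> set Us \<subseteq> E n \<and> S.Span K Us = E n \<and> d n = length Us" for n
    by (rule S.dimension_exists_if_bounded[OF K E_sub bound]) (auto simp: d_def)
  have d_bound: "d n \<le> length Vs" for n
  proof -
    obtain Us where "S.independent K Us" "set Us \<subseteq> E n" "d n = length Us" using basis[of n] by blast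
    then show ?thesis using bound[of Us n] by simp
  qed
  have mono: "d n \<le> d (n + r)" for n
  proof -
    obtain Us where Us: "S.independent K Us" "set Us \<subseteq> E n" "d n = length Us" using basis[of n] by blast
    obtain Ws where Ws: "S.independent K Ws" "set Ws \<subseteq> E (n + r)" "S.Span K Ws = E (n + r)" "d (n + r) = length Ws"
      using basis[of "n + r"] by blast
    let ?g = "\<lambda>u. u \<otimes>\<^bsub>S\<^esub> y"
    have gE: "?g u \<in> E (n + r)" if "u \<in> E n" for u
      using that P_mult[of u n y r] y(1) LE(6) unfolding E_def by auto
    have semi: "semilinear S S id K (E n) ?g"
      unfolding semilinear_def using ES[of n] KS yS
      by (auto simp: subset_iff S.l_distr S.m_assoc)
    have "inj_on ?g (E n)"
    proof (rule inj_onI)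
      fix u v assume u: "u \<in> E n" and v: "v \<in> E n" and eq: "u \<otimes>\<^bsub>S\<^esub> y = v \<otimes>\<^bsub>S\<^esub> y"
      have uv: "u \<in> carrier S" "v \<in> carrier S" using u v ES by auto
      have "\<Phi> u \<otimes>\<^bsub>A\<^esub> \<Phi> y = \<Phi> v \<otimes>\<^bsub>A\<^esub> \<Phi> y"
        using arg_cong[OF eq, of \<Phi>] uv yS by simp
      then have "\<Phi> y \<otimes>\<^bsub>A\<^esub> \<Phi> u = \<Phi> y \<otimes>\<^bsub>A\<^esub> \<Phi> v"
        using uv yS by (simp add: A.m_comm)
      then have "\<Phi> u = \<Phi> v" using A.Units_l_cancel[OF yU] uv by simp
      then show "u = v" using diff u v by blast
    qed
    then have "S.independent (id ` K) (map ?g Us)"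
      by (rule independent_semilinear_image[OF S S E_sub semi _ Us(2,1)])
    moreover have "set (map ?g Us) \<subseteq> S.Span K Ws" unfolding Ws(3) using Us(2) gE by auto
    moreover have "set Ws \<subseteq> carrier S" using Ws(2) ES by blast
    ultimately show ?thesis
      using S.independent_length_le_spanning[OF K, of Ws "map ?g Us"] Us(3) Ws(4) by simp
  qed
  have "incseq (\<lambda>n. real (d (a + n * r)))"
  proof (rule incseq_SucI)
    show "real (d (a + n * r)) \<le> real (d (a + Suc n * r))" for n
      using mono[of "a + n * r"] by (simp add: algebra_simps)
  qed
  moreover have "Bseq (\<lambda>n. real (d (a + n * r)))"
    by (rule BseqI'[of _ "real (length Vs)"]) (simp add: d_bound)
  ultimately have "convergent (\<lambda>n. real (d (a + n * r)))"
    by (intro Bseq_monoseq_convergent) (auto simp: incseq_def monoseq_def)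
  then show ?thesis unfolding d_def E_def .
qed

text \<open>
  Since \<open>\<sigma>(L) = 1\<close>, there is a single algebraically independent \<open>y\<close>. If \<open>y\<^sup>m = 0\<close>, the polynomial \<open>t\<^sup>m\<close>
  contradicts its independence.
\<close>
lemma exists_nonnilpotent_of_kodaira_iitaka_dim_0:
  assumes A: "ring (section_ring X M)" and k: "field k"
    and \<iota>: "ring_hom_ring k (section_ring X M) (scalar k X \<pi> M)"
    and dim: "kodaira_iitaka_dim k X \<pi> M L = 0"
    and L: "L \<subseteq> carrier (section_ring X M)"
  shows "\<exists>r>0. \<exists>y\<in>graded_piece X M L r. \<forall>m::nat. y [^]\<^bsub>section_ring X M\<^esub> m \<noteq> \<zero>\<^bsub>section_ring X M\<^esub>"
proof -
  let ?R = "section_ring X M"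
  interpret R: ring ?R by fact
  interpret k: field k by fact
  interpret \<iota>: ring_hom_ring k ?R "scalar k X \<pi> M" by fact
  let ?indep = "\<lambda>ys. (\<forall>y\<in>set ys. \<exists>n>0. y \<in> graded_piece X M L n) \<and>
     algebraically_independent k ?R (scalar k X \<pi> M) ys"
  have "sigma k X \<pi> M L = 1"
  proof -
    have "ereal_of_enat (sigma k X \<pi> M L) - 1 = 0"
      using dim unfolding kodaira_iitaka_dim_def by (simp split: if_splits)
    then show ?thesis
      by (cases "sigma k X \<pi> M L") (auto simp: one_ereal_def zero_ereal_def one_enat_def)
  qed
  then have Sup1: "Sup {enat (length ys) | ys. ?indep ys} = 1" unfolding sigma_def .
  then have "0 < Sup {enat (length ys) | ys. ?indep ys}" by simp
  then obtain ys where ys: "0 < enat (length ys)" "?indep ys" unfolding less_Sup_iff by blast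
  have "enat (length ys) \<le> 1" using ys(2) unfolding Sup1[symmetric] by (intro Sup_upper) blast
  then have "length ys = 1"
    using ys(1) by (cases "length ys") (simp_all add: one_enat_def zero_enat_def)
  then obtain y where y: "ys = [y]" by (auto simp: length_Suc_conv)
  obtain r where r: "r > 0" "y \<in> graded_piece X M L r" using ys(2) unfolding y by auto
  have yR: "y \<in> carrier ?R" using r(2) L unfolding graded_piece_def by auto
  have "y [^]\<^bsub>?R\<^esub> m \<noteq> \<zero>\<^bsub>?R\<^esub>" for m :: nat
  proof
    assume z: "y [^]\<^bsub>?R\<^esub> m = \<zero>\<^bsub>?R\<^esub>"
    have "algebraically_independent k ?R (scalar k X \<pi> M) [y]" using ys(2) unfolding y by blast
    moreover have "(\<Oplus>\<^bsub>?R\<^esub>e\<in>{[m]}. scalar k X \<pi> M \<one>\<^bsub>k\<^esub> \<otimes>\<^bsub>?R\<^esub>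
        foldr (\<otimes>\<^bsub>?R\<^esub>) (map2 (\<lambda>y i. y [^]\<^bsub>?R\<^esub> i) [y] e) \<one>\<^bsub>?R\<^esub>) = \<zero>\<^bsub>?R\<^esub>"
      using z yR by (simp add: R.finsum_insert)
    ultimately have "\<forall>e\<in>{[m]}. \<one>\<^bsub>k\<^esub> = \<zero>\<^bsub>k\<^esub>"
      unfolding algebraically_independent_def
      by (elim allE[of _ "{[m]}"] allE[of _ "\<lambda>_. \<one>\<^bsub>k\<^esub>"]) simp
    then show False by simp
  qed
  then show ?thesis using r by blast
qed

theorem proposition11p1:
  fixes k :: "'k ring"
    and X :: "('p, 'a) ring_presheaf"
    and \<pi> :: "('p, 'a, 'k set, 'k set \<Rightarrow> ('k \<times> 'k) set) mor"
    and \<L> :: "('p, 'a, 'm) module_presheaf"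
    and L :: "('p, 'a, 'm) power_section set"
  assumes "field k"
    and "proper_scheme_over k X \<pi>"
    and "krull_dim (base X) = 0"
    and "irreducible_in (base X) (topspace (base X))"
    and "\<not> reduced X"
    and "graded_linear_series k X \<pi> \<L> L"
    and "kodaira_iitaka_dim k X \<pi> \<L> L = 0"
  shows "\<exists>r>0. \<forall>a>0. convergent (\<lambda>n. real (graded_piece_dim k X \<pi> \<L> L (a + n * r)))"
proof -
  have rs: "ringed_space X" and mor: "morphism X (Spec k) \<pi>" and ft: "finite_type X (Spec k) \<pi>"
    using assms(2) unfolding proper_scheme_over_def scheme_def proper_def by simp_all
  have lb: "line_bundle X \<L>" and L: "subring L (section_ring X \<L>)" "scalar k X \<pi> \<L> ` carrier k \<subseteq> L"
    using assms(6) unfolding graded_linear_series_def by simp_all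
  interpret X: indiscrete_ringed_space X
  proof (intro indiscrete_ringed_space.intro indiscrete_ringed_space_axioms.intro rs)
    show "topspace (base X) \<noteq> {}" using assms(4) unfolding irreducible_in_def by blast
    show "U = {} \<or> U = topspace (base X)" if "openin (base X) U" for U
      using indiscrete_of_irreducible_krull_dim_0[OF assms(3,4) that] .
  qed
  obtain \<theta> e where free: "free_rank_one_module (sec X (topspace (base X))) (msec \<L> (topspace (base X))) \<theta> e"
    using X.line_bundle_free[OF lb] by blast
  interpret M: indiscrete_line_bundle X \<L> \<theta> e
    using lb free X.indiscrete_ringed_space_axioms
    unfolding line_bundle_def by (intro indiscrete_line_bundle.intro) simp_all
  let ?R = "section_ring X \<L>"
  let ?K = "scalar k X \<pi> \<L> ` carrier k"
  let ?\<Phi> = "M.section_value"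
  note eq = M.section_ring_eq
  have R: "ring ?R" unfolding eq using M.tensor_sections_ring .
  have \<Phi>: "ring_hom_ring ?R X.A ?\<Phi>" unfolding eq using M.section_value_hom .
  interpret k: field k by fact
  interpret \<iota>: ring_hom_ring k ?R "scalar k X \<pi> \<L>" unfolding eq using M.scalar_hom(1)[OF assms(1) mor] .
  interpret \<Phi>: ring_hom_ring ?R X.A ?\<Phi> by fact
  obtain r y where r: "r > 0" and y: "y \<in> L \<inter> power_sections X \<L> r"
      "\<And>m::nat. y [^]\<^bsub>?R\<^esub> m \<noteq> \<zero>\<^bsub>?R\<^esub>"
    using exists_nonnilpotent_of_kodaira_iitaka_dim_0[OF R assms(1) \<iota>.ring_hom_ring_axioms assms(7) subringE(1)[OF L(1)]]
    unfolding graded_piece_def by blast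
  have zero: "s = \<zero>\<^bsub>?R\<^esub>" if "s \<in> power_sections X \<L> n" "?\<Phi> s = \<zero>\<^bsub>X.A\<^esub>" for s n
    using M.section_value_zero[OF that] unfolding eq .
  have one_P: "\<one>\<^bsub>?R\<^esub> \<in> power_sections X \<L> 0" unfolding eq using M.power_sections_one .
  have one: "\<one>\<^bsub>?R\<^esub> \<noteq> \<zero>\<^bsub>?R\<^esub>" using y(2)[of 0] by simp
  (* A nonnilpotent section exists, so neither ring is zero. *)
  have oneA: "\<one>\<^bsub>X.A\<^esub> \<noteq> \<zero>\<^bsub>X.A\<^esub>" using zero[OF one_P] one \<Phi>.hom_one by auto
  have K: "subfield ?K ?R" using \<iota>.img_is_subfield(2)[OF k.carrier_is_subfield one] .
  have K': "subfield (?\<Phi> ` ?K) X.A" using \<Phi>.img_is_subfield(2)[OF K oneA] .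
  have \<Phi>K: "?\<Phi> ` ?K = X.structure_hom k \<pi> ` carrier k"
    using M.scalar_hom(3)[OF assms(1) mor] by (simp add: image_image)
  obtain G where G: "finite G" "G \<subseteq> carrier X.A" "generate_ring X.A (?\<Phi> ` ?K \<union> G) = carrier X.A"
    using X.finite_type_coordinate_ring(2)[OF assms(1) mor ft] unfolding \<Phi>K by blast
  note un = X.affine_unit_or_nilpotent[OF X.finite_type_coordinate_ring(1)[OF assms(1) mor ft]]
  obtain Vs where Vs: "set Vs \<subseteq> carrier X.A" "X.A.Span (?\<Phi> ` ?K) Vs = carrier X.A"
    using X.A.finite_dim_of_unit_or_nilpotent[OF K' G un] by blast
  have "convergent (\<lambda>n. real (graded_piece_dim k X \<pi> \<L> L (a + n * r)))" for a
    unfolding graded_piece_dim_def graded_piece_def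
  proof (rule graded_dimension_convergent[where P = "power_sections X \<L>" and r = r, OF R X.A.is_cring \<Phi> K _ _ _ _ _ Vs un L(1,2) y])
    show "?K \<subseteq> power_sections X \<L> 0" using M.scalar_hom(2)[OF assms(1) mor] by blast
  qed (auto simp: eq M.power_sections_zero M.power_sections_add M.power_sections_mult
      intro: M.section_value_zero)
  then show ?thesis using r by blast
qed

end
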